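(* Let $n\ge 1$ be an integer, let $l_1\gg l_2\gg\dots\gg l_n>0$ be real numbers, let $P=\{x\in\mathbb{R}^n : l_1x_1+\dots+l_nx_n=1\}$, and let $\mathcal{H}_n$ be the arrangement in $\mathbb{R}^n$ of the hyperplanes $\{x_i=0\}$ ($1\le i\le n$) and $\{x_i+x_j=0\}$ ($1\le i<j\le n$). The following seven sets are in bijection (i.e. they are finite and have the same cardinality): (1) The set of bounded regions of the affine hyperplane arrangement $\mathcal{H}_n\cap P$ in $P$. (2) The set of ordered partitions of $[n]$ all of whose left-to-right minima occur at odd locations. (3) The set of signed permutations of $[n]$ with decreasing blocks all of whose left-to-right minima have positive signs. (4) The set of build-tree codes of length $n$ such that there is a $v^+$ after (but not necessarily adjacent to) each $v^-$. (5) The set of build-tree codes of length $n$ such that there is a $v^+$ before (but not necessarily adjacent to) each $v^-$. (6) The set of Klazar trees with $n+1$ vertices. (7) The set of drawings of rooted plane trees with $n+1$ vertices. Moreover, let $b_n$ be the common cardinality of these sets for $n\ge1$, and set $b_0=1$. Then the sequence $\{b_n\}$ has the exponential generating function $$\sum_{n=0}^{\infty}b_n\frac{x^n}{n!}=\sqrt{\frac{e^x}{2-e^x}}.$$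
   Context: Notation: $[n]=\{1,2,\dots,n\}$. The condition $l_1\gg l_2\gg\dots\gg l_n>0$ ("far greater than") is taken to mean $l_n>0$ and $l_i>l_{i+1}+l_{i+2}+\dots+l_n$ for every $1\le i\le n-1$. Regions: $\mathcal{H}_n\cap P=\{H\cap P: H\in\mathcal{H}_n\}$, an arrangement in the affine space $P$. Its regions are the connected components of $P\setminus\bigcup_{H\in\mathcal{H}_n}H$. Ordered partition of $[n]$: an ordered sequence $(A_1,\dots,A_k)$ of disjoint non-empty subsets (blocks) whose union is $[n]$. Its left-to-right minima are $m_i=\min(A_1\cup\dots\cup A_i)$, $1\le i\le k$; $m_i$ occurs at an odd location if $m_i\in A_j$ for some odd $j$. Signed permutation of $[n]$: a permutation $(a_1,\dots,a_n)$ of $[n]$ together with a map $\sigma\colon[n]\to\{\pm1\}$; $\sigma(i)$ is the sign of $i$. It has decreasing blocks if $a_i>a_{i+1}$ whenever the adjacent entries $a_i,a_{i+1}$ have the same sign (i.e. $\sigma(a_i)=\sigma(a_{i+1})$). Its left-to-right minima are $m_i=\min(a_1,\dots,a_i)$, $1\le i\le n$; the sign of $m_i$ is $\sigma(m_i)$. Build-tree code of length $n$: a sequence $c_1c_2\cdots c_n$ of pairs $c_i=(a_i,\sigma_i)$ with integers $0\le a_i\le i-1$ and $\sigma_i\in\{\pm1\}$ such that $(a_i,\sigma_i)\ne(0,-1)$. One writes $v^+$ for $(v,+1)$ and $v^-$ for $(v,-1)$. "There is a $v^+$ after (resp. before) each $v^-$" means: for every position $i$ and every $v$ with $c_i=v^-$,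 there is a position $k>i$ (resp. $k<i$) with $c_k=v^+$. Rooted plane tree: a finite rooted tree in which the children of each vertex are linearly ordered from left to right; such trees are considered up to isomorphism preserving the root and these orders. A leaf is a vertex without children. Increasingly labeled tree: a rooted plane tree $T$ with $n+1$ vertices together with a bijection $\lambda$ from its vertices to $\{0,1,\dots,n\}$ such that $\lambda(u)>\lambda(v)$ whenever $u$ is a child of $v$; considered up to label-preserving isomorphism of rooted plane trees. Right associate: in an increasingly labeled tree $(T,\lambda)$, consider the siblings $w$ of $v$ lying to the right of $v$ such that $\lambda(w)>\lambda(v)$ and $\lambda(w)$ is smaller than the labels of all siblings strictly between $v$ and $w$. If any such $w$ exists, the right associate $u$ of $v$ is the one with the smallest label; otherwise $v$ has no right associate. Klazar tree: an increasingly labeled tree such that for every vertex $v$ having a right associate $u$, $v$ is not a leaf and $\lambda(u)$ is larger than the minimum of the labels of the children of $v$. Drawing of a rooted plane tree $T$ with $n+1$ vertices: a sequence of (unlabeled) rooted plane trees $T_0,T_1,\dots,T_n=T$, where $T_0$ consists only of the root, such that for each $0\le i\le n-1$ the tree $T_i$ can be obtained from $T_{i+1}$ by removing a (non-root) leaf together with its pendant edge. Set (7) consists of all drawings of all rooted plane trees with $n+1$ vertices; two drawings are equal if their trees $T_i$ are isomorphic as rooted plane trees for every $i$. *)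

theory Defs
  imports
    "HOL-Analysis.Analysis"
    "HOL-Library.Disjoint_Sets"
    "HOL-Combinatorics.Multiset_Permutations"
    "HOL-Computational_Algebra.Formal_Power_Series"
begin

text \<open>
  Since the dimension varies, \<open>\<real>\<^sup>n\<close> is the space of extensional functions
  \<open>{1..n} \<rightarrow>\<^sub>E UNIV\<close> with the product topology; the Euclidean norm is \<open>L2_set x {1..n}\<close>.
\<close>

definition far_decreasing :: "nat \<Rightarrow> (nat \<Rightarrow> real) \<Rightarrow> bool" where
  "far_decreasing n l \<longleftrightarrow> l n > 0 \<and> (\<forall>i\<in>{1..n - 1}. l i > (\<Sum>j=i+1..n. l j))"

definition affine_slice :: "nat \<Rightarrow> (nat \<Rightarrow> real) \<Rightarrow> (nat \<Rightarrow> real) set" where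
  "affine_slice n l = {x \<in> topspace (powertop_real {1..n}). (\<Sum>i=1..n. l i * x i) = 1}"

definition arrangement :: "nat \<Rightarrow> (nat \<Rightarrow> real) set set" where
  "arrangement n =
     {{x \<in> topspace (powertop_real {1..n}). x i = 0} | i. 1 \<le> i \<and> i \<le> n} \<union>
     {{x \<in> topspace (powertop_real {1..n}). x i + x j = 0} | i j. 1 \<le> i \<and> i < j \<and> j \<le> n}"

definition regions :: "nat \<Rightarrow> (nat \<Rightarrow> real) \<Rightarrow> (nat \<Rightarrow> real) set set" where
  "regions n l = connected_components_of
     (subtopology (powertop_real {1..n}) (affine_slice n l - \<Union>(arrangement n)))"

definition bounded_regions :: "nat \<Rightarrow> (nat \<Rightarrow> real) \<Rightarrow> (nat \<Rightarrow> real) set set" where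
  "bounded_regions n l = {R \<in> regions n l. \<exists>B. \<forall>x\<in>R. L2_set x {1..n} \<le> B}"

definition ordered_partitions :: "nat \<Rightarrow> nat set list set" where
  "ordered_partitions n = {As. distinct As \<and> partition_on {1..n} (set As)}"

text \<open>Blocks are numbered from 1, so the block at list index \<open>j\<close> is at location \<open>j + 1\<close>.\<close>

definition ordered_partitions_odd_minima :: "nat \<Rightarrow> nat set list set" where
  "ordered_partitions_odd_minima n = {As \<in> ordered_partitions n.
     \<forall>i\<in>{1..length As}. \<exists>j<length As. odd (j + 1) \<and> Min (\<Union>(set (take i As))) \<in> As ! j}"

definition signed_permutations :: "nat \<Rightarrow> (nat list \<times> (nat \<Rightarrow> int)) set" where
  "signed_permutations n = permutations_of_set {1..n} \<times> ({1..n} \<rightarrow>\<^sub>E {1, - 1})"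

definition decreasing_blocks :: "nat list \<Rightarrow> (nat \<Rightarrow> int) \<Rightarrow> bool" where
  "decreasing_blocks as \<sigma> \<longleftrightarrow>
     (\<forall>i. i + 1 < length as \<longrightarrow> \<sigma> (as ! i) = \<sigma> (as ! (i + 1)) \<longrightarrow> as ! i > as ! (i + 1))"

definition positive_minima :: "nat list \<Rightarrow> (nat \<Rightarrow> int) \<Rightarrow> bool" where
  "positive_minima as \<sigma> \<longleftrightarrow> (\<forall>i\<in>{1..length as}. \<sigma> (Min (set (take i as))) = 1)"

definition signed_permutations_pos_minima :: "nat \<Rightarrow> (nat list \<times> (nat \<Rightarrow> int)) set" where
  "signed_permutations_pos_minima n =
     {(as, \<sigma>) \<in> signed_permutations n. decreasing_blocks as \<sigma> \<and> positive_minima as \<sigma>}"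

text \<open>List indices start at 0, so the bound \<open>a\<^sub>i \<le> i - 1\<close> becomes \<open>fst (c ! i) \<le> i\<close>.\<close>

definition build_tree_codes :: "nat \<Rightarrow> (nat \<times> int) list set" where
  "build_tree_codes n = {c. length c = n \<and>
     (\<forall>i<n. fst (c ! i) \<le> i \<and> snd (c ! i) \<in> {1, - 1} \<and> c ! i \<noteq> (0, - 1))}"

definition build_tree_codes_plus_after :: "nat \<Rightarrow> (nat \<times> int) list set" where
  "build_tree_codes_plus_after n = {c \<in> build_tree_codes n.
     \<forall>i<n. \<forall>v. c ! i = (v, - 1) \<longrightarrow> (\<exists>k<n. k > i \<and> c ! k = (v, 1))}"

definition build_tree_codes_plus_before :: "nat \<Rightarrow> (nat \<times> int) list set" where
  "build_tree_codes_plus_before n = {c \<in> build_tree_codes n.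
     \<forall>i<n. \<forall>v. c ! i = (v, - 1) \<longrightarrow> (\<exists>k<n. k < i \<and> c ! k = (v, 1))}"

text \<open>
  The values of the datatypes \<open>ltree\<close> and \<open>plane_tree\<close> are exactly the isomorphism classes of
  finite labelled, respectively unlabelled, rooted plane trees.
\<close>

datatype 'a ltree = Node (label: 'a) (children: "'a ltree list")

primrec labels :: "'a ltree \<Rightarrow> 'a list" where
  "labels (Node a ts) = a # concat (map labels ts)"

text \<open>
  When the labels are distinct, the vertices correspond bijectively to the subtrees hanging from
  them.
\<close>

primrec subtrees :: "'a ltree \<Rightarrow> 'a ltree set" where
  "subtrees (Node a ts) = insert (Node a ts) (\<Union>(set (map subtrees ts)))"

definition increasing_trees :: "nat \<Rightarrow> nat ltree set" where
  "increasing_trees n = {T. distinct (labels T) \<and> set (labels T) = {0..n} \<and>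
     (\<forall>v\<in>subtrees T. \<forall>u\<in>set (children v). label u > label v)}"

text \<open>
  The following two definitions refer to the children \<open>ts\<close> of one vertex, listed from left to right
  and identified by their indices in \<open>ts\<close>.
\<close>

definition associate_candidates :: "nat ltree list \<Rightarrow> nat \<Rightarrow> nat set" where
  "associate_candidates ts i = {j. i < j \<and> j < length ts \<and> label (ts ! j) > label (ts ! i) \<and>
     (\<forall>k. i < k \<and> k < j \<longrightarrow> label (ts ! j) < label (ts ! k))}"

definition is_right_associate :: "nat ltree list \<Rightarrow> nat \<Rightarrow> nat \<Rightarrow> bool" where
  "is_right_associate ts i j \<longleftrightarrow> j \<in> associate_candidates ts i \<and>
     (\<forall>j'\<in>associate_candidates ts i. label (ts ! j) \<le> label (ts ! j'))"

definition klazar_trees :: "nat \<Rightarrow> nat ltree set" where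
  "klazar_trees n = {T \<in> increasing_trees n.
     \<forall>p\<in>subtrees T. \<forall>i<length (children p). \<forall>j. is_right_associate (children p) i j \<longrightarrow>
       children (children p ! i) \<noteq> [] \<and>
       label (children p ! j) > Min (label ` set (children (children p ! i)))}"

datatype plane_tree = PNode "plane_tree list"

primrec num_vertices :: "plane_tree \<Rightarrow> nat" where
  "num_vertices (PNode ts) = 1 + sum_list (map num_vertices ts)"

text \<open>\<open>remove_leaf T T'\<close>: \<open>T'\<close> arises from \<open>T\<close> by removing a non-root leaf.\<close>

inductive remove_leaf :: "plane_tree \<Rightarrow> plane_tree \<Rightarrow> bool" where
  child: "remove_leaf (PNode (xs @ PNode [] # ys)) (PNode (xs @ ys))"
| deeper: "remove_leaf t t' \<Longrightarrow> remove_leaf (PNode (xs @ t # ys)) (PNode (xs @ t' # ys))"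

definition is_drawing :: "plane_tree list \<Rightarrow> plane_tree \<Rightarrow> bool" where
  "is_drawing Ts T \<longleftrightarrow> length Ts = num_vertices T \<and> Ts ! 0 = PNode [] \<and> last Ts = T \<and>
     (\<forall>i. i + 1 < length Ts \<longrightarrow> remove_leaf (Ts ! (i + 1)) (Ts ! i))"

definition drawings :: "nat \<Rightarrow> plane_tree list set" where
  "drawings n = {Ts. \<exists>T. num_vertices T = n + 1 \<and> is_drawing Ts T}"

end

theory Submission imports Defs begin

text \<open>
  Let \<open>G = sqrt (e^x / (2 - e^x))\<close>, and let \<open>F = 1 / (2 - e^x)\<close> be the exponential generating function
  of the ordered set partitions. Then \<open>G\<^sup>2 = e^x F\<close> and \<open>2 F = 1 + G\<^sup>2\<close>, whence \<open>F' = G\<^sup>2 F\<close> and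
  \<open>G' = G F\<close>. Two combinatorial mechanisms produce \<open>G\<close>.

  Codes, drawings and Klazar trees grow step by step. Each structure of size \<open>n\<close> has a number \<open>k\<close> of
  active vertices, such that exactly \<open>2 k + 1\<close> of its extensions to size \<open>n + 1\<close> have \<open>k\<close> active
  vertices again and exactly \<open>n - k\<close> have \<open>k + 1\<close>. The number of ways to grow by further steps then has
  the generating function \<open>G ^ (2 k + 1) * F ^ (n - k)\<close>, because differentiating this monomial
  reproduces the two kinds of extensions; starting with the empty structure gives \<open>G\<close>
  (\<open>growth_count_egf\<close>, \<open>card_generating_tree\<close>). In a code with a plus before each minus, the
  active vertices are the nonzero values that have already occurred with a plus. In a drawing, and in a
  Klazar tree with its labels added in increasing order, they are the vertices other than the root that
  have children: in both cases a new leaf has one essentially different place at the far left of every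
  children list and one directly to the right of every sibling with children
  (\<open>card_enlargements\<close>, \<open>card_growths\<close>). Codes with a plus after each minus result from those with a
  plus before each minus by exchanging the signs of the first and the last occurrence of each value.

  A signed permutation with decreasing blocks and positive left-to-right minima is cut at its entry
  \<open>1\<close>. In front of it stands a smaller object of the same kind. Behind it stands a word with decreasing
  blocks that is arbitrary except that its first sign is negative; such words correspond to ordered
  partitions, the blocks being the maximal runs of equal sign. This is the equation \<open>G' = G F\<close>
  (\<open>card_good_words\<close>). Splitting the whole signed permutation into runs gives the ordered
  partitions with left-to-right minima at odd locations.

  A region of the arrangement is determined by the signs of all \<open>x\<^sub>i + x\<^sub>j\<close>. Listing the indices by
  decreasing absolute value of their coordinates, and runs of equal sign in decreasing order of the
  indices, attaches a unique signed permutation with decreasing blocks to each region. If its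
  left-to-right minima are positive, every negative coordinate is dominated by a positive one with a
  much larger weight, so \<open>l\<^sub>1 x\<^sub>1 + \<dots> + l\<^sub>n x\<^sub>n = 1\<close> bounds all coordinates (\<open>cell_bounded\<close>). If the
  minimum of some prefix is negative, the signed indicator vector of this prefix has a negative weighted
  sum, and moving in its direction shows that the region is unbounded (\<open>cell_unbounded\<close>). Hence
  the bounded regions correspond to the signed permutations of the previous paragraph
  (\<open>bij_betw_cell\<close>).
\<close>

section \<open>The generating function\<close>

definition half_fubini :: "real fps" where
  "half_fubini = fps_radical root 2 (fps_exp 1 / (2 - fps_exp 1))"

text \<open>
  The exponential generating function of the ordered set partitions, see \<open>card_ordered_partitions\<close>.
\<close>

definition fubini :: "real fps" where
  "fubini = inverse (2 - fps_exp 1)"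

lemma fubini_inverse: "fubini * (2 - fps_exp 1) = 1"
  unfolding fubini_def by (rule inverse_mult_eq_1) simp

lemma half_fubini_square: "half_fubini ^ 2 = fps_exp 1 * fubini"
proof -
  have q: "fps_exp 1 / (2 - fps_exp (1::real)) = fps_exp 1 * fubini"
    unfolding fubini_def by (rule fps_divide_unit) simp
  have n0: "fps_nth (fps_exp 1 * fubini) 0 = 1"
    by (simp add: fubini_def fps_mult_nth)
  have "half_fubini ^ Suc 1 = fps_exp 1 * fubini"
    unfolding half_fubini_def q
    using power_radical[of "fps_exp 1 * fubini" root 1] n0 by (simp add: numeral_2_eq_2)
  then show ?thesis by (simp add: numeral_2_eq_2)
qed

lemma half_fubini_0 [simp]: "fps_nth half_fubini 0 = 1"
  by (simp add: half_fubini_def fubini_def fps_divide_unit fps_mult_nth)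

lemma fubini_eq_half_fubini: "2 * fubini = 1 + half_fubini ^ 2"
  using fubini_inverse half_fubini_square by (simp add: algebra_simps)

lemma fubini_0 [simp]: "fps_nth fubini 0 = 1"
  by (simp add: fubini_def)

text \<open>
  Together with \<open>half_fubini_deriv\<close> this makes the monomials \<open>half_fubini ^ a * fubini ^ b\<close> closed
  under differentiation, which is what turns them into counting functions of a growth process.
\<close>

lemma fubini_deriv: "fps_deriv fubini = half_fubini ^ 2 * fubini"
proof -
  have "fps_deriv (fubini * (2 - fps_exp 1)) = 0"
    by (simp add: fubini_inverse)
  then have "fps_deriv fubini * (2 - fps_exp 1) = fubini * fps_exp 1"
    by (simp add: algebra_simps)
  then have "fps_deriv fubini * ((2 - fps_exp 1) * fubini) = fubini * fps_exp 1 * fubini"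
    by (metis mult.assoc)
  then show ?thesis
    using fubini_inverse by (simp add: half_fubini_square mult_ac)
qed

lemma half_fubini_deriv: "fps_deriv half_fubini = half_fubini * fubini"
proof -
  have "fps_deriv (half_fubini ^ 2) = fps_deriv (2 * fubini - 1)"
    by (simp add: fubini_eq_half_fubini)
  then have "2 * half_fubini * fps_deriv half_fubini = 2 * half_fubini ^ 2 * fubini"
    by (simp add: power2_eq_square fubini_deriv)
  then have "2 * half_fubini * fps_deriv half_fubini = 2 * half_fubini * (half_fubini * fubini)"
    by (simp add: power2_eq_square mult_ac)
  moreover have "2 * half_fubini \<noteq> 0"
    by (metis half_fubini_0 fps_zero_nth mult_eq_0_iff zero_neq_numeral zero_neq_one)
  ultimately show ?thesis by simp
qed

section \<open>Generating trees\<close>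

text \<open>
  The number of ways in which a structure with \<open>p\<close> passive and \<open>k\<close> active vertices, besides its root,
  can grow by \<open>m\<close> steps, if every step adds a passive vertex below some vertex: below the root in one
  way, below an active vertex in two ways, and below a passive vertex in one way, which makes that
  vertex active.
\<close>

fun growth_count :: "nat \<Rightarrow> nat \<Rightarrow> nat \<Rightarrow> nat" where
  "growth_count 0 p k = 1"
| "growth_count (Suc m) p k =
     (2 * k + 1) * growth_count m (Suc p) k + p * growth_count m p (Suc k)"

text \<open>
  The subtrees growing at different vertices do not influence each other, so their generating functions
  multiply: the root contributes \<open>half_fubini\<close>, an active vertex \<open>half_fubini ^ 2\<close>, and a passive vertex
  \<open>fubini\<close>. Formally, the product rule for this monomial is the recursion of \<open>growth_count\<close>.
\<close>

lemma growth_count_egf: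
  "real (growth_count m p k) = fact m * fps_nth (half_fubini ^ (2 * k + 1) * fubini ^ p) m"
proof (induction m arbitrary: p k)
  case 0
  show ?case by (simp add: fps_nth_power_0 fps_mult_nth)
next
  case (Suc m)
  let ?Z = "\<lambda>p k. half_fubini ^ (2 * k + 1) * fubini ^ p"
  have const: "fps_const (of_nat c) = (of_nat c :: real fps)" for c
    by (simp add: fps_of_nat)
  have nth: "fps_nth (of_nat c * A) m = real c * fps_nth A m" for c and A :: "real fps"
    by (metis const fps_mult_left_const_nth)
  have "fps_deriv (half_fubini ^ Suc (2 * k)) = of_nat (2 * k + 1) * half_fubini ^ (2 * k + 1) * fubini"
    unfolding fps_deriv_power diff_Suc_1 half_fubini_deriv const
    by (simp add: mult_ac del: of_nat_Suc)
  moreover have "fps_deriv (fubini ^ p) = of_nat p * fubini ^ p * half_fubini ^ 2"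
    unfolding fps_deriv_power fubini_deriv const
    by (cases p) (simp_all add: mult_ac del: of_nat_Suc)
  ultimately have d: "fps_deriv (?Z p k) = of_nat (2 * k + 1) * ?Z (Suc p) k + of_nat p * ?Z p (Suc k)"
    unfolding fps_deriv_mult Suc_eq_plus1[symmetric] by (simp add: algebra_simps power2_eq_square)
  have "fact (Suc m) * fps_nth (?Z p k) (Suc m) = fact m * fps_nth (fps_deriv (?Z p k)) m"
    by (simp only: fps_deriv_nth fact_Suc) simp
  also have "\<dots> = real (2 * k + 1) * (fact m * fps_nth (?Z (Suc p) k) m)
      + real p * (fact m * fps_nth (?Z p (Suc k)) m)"
    unfolding d fps_add_nth nth by (simp only: algebra_simps)
  finally show ?case
    by (simp only: growth_count.simps Suc of_nat_add of_nat_mult)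
qed

definition half_fubini_number :: "nat \<Rightarrow> nat" where
  "half_fubini_number n = growth_count n 0 0"

lemma half_fubini_number_egf: "real (half_fubini_number n) = fact n * fps_nth half_fubini n"
  by (simp add: half_fubini_number_def growth_count_egf)

text \<open>
  Summing \<open>growth_count m\<close> over all structures of size \<open>n\<close> counts the structures of size \<open>n + m\<close>, so
  the sum depends on \<open>n + m\<close> only; comparing the cases \<open>n = 0\<close> and \<open>m = 0\<close> gives the cardinality.
\<close>

lemma card_generating_tree:
  fixes X :: "nat \<Rightarrow> 'a set" and offspring :: "nat \<Rightarrow> 'a \<Rightarrow> 'a set" and k :: "'a \<Rightarrow> nat"
  assumes base: "X 0 = {r}" "k r = 0"
    and step: "\<And>n. X (Suc n) = (\<Union>x\<in>X n. offspring n x)"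
    and disj: "\<And>n x y. x \<in> X n \<Longrightarrow> y \<in> X n \<Longrightarrow> x \<noteq> y \<Longrightarrow> offspring n x \<inter> offspring n y = {}"
    and fin: "\<And>n x. x \<in> X n \<Longrightarrow> finite (offspring n x)"
    and k: "\<And>n x y. x \<in> X n \<Longrightarrow> y \<in> offspring n x \<Longrightarrow> k y = k x \<or> k y = Suc (k x)"
    and stay: "\<And>n x. x \<in> X n \<Longrightarrow> card {y \<in> offspring n x. k y = k x} = 2 * k x + 1"
    and rise: "\<And>n x. x \<in> X n \<Longrightarrow> card {y \<in> offspring n x. k y = Suc (k x)} + k x = n"
  shows "finite (X n) \<and> card (X n) = half_fubini_number n"
proof -
  have finX: "finite (X n)" for n
    by (induction n) (auto simp: base step fin)
  have key: "(\<Sum>x\<in>X n. growth_count m (n - k x) (k x)) = growth_count (n + m) 0 0" for m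
  proof (induction n arbitrary: m)
    case 0
    show ?case by (simp add: base)
  next
    case (Suc n)
    have one: "(\<Sum>y\<in>offspring n x. growth_count m (Suc n - k y) (k y))
        = growth_count (Suc m) (n - k x) (k x)" if x: "x \<in> X n" for x
    proof -
      let ?A = "{y \<in> offspring n x. k y = k x}" and ?B = "{y \<in> offspring n x. k y = Suc (k x)}"
      have "offspring n x = ?A \<union> ?B" using k[OF x] by auto
      then have "(\<Sum>y\<in>offspring n x. growth_count m (Suc n - k y) (k y)) =
          (\<Sum>y\<in>?A \<union> ?B. growth_count m (Suc n - k y) (k y))" by simp
      also have "\<dots> = (\<Sum>y\<in>?A. growth_count m (Suc n - k y) (k y))
          + (\<Sum>y\<in>?B. growth_count m (Suc n - k y) (k y))"
        using fin[OF x] by (intro sum.union_disjoint) auto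
      also have "\<dots> = (\<Sum>y\<in>?A. growth_count m (Suc n - k x) (k x))
          + (\<Sum>y\<in>?B. growth_count m (n - k x) (Suc (k x)))"
        by (intro arg_cong2[where f="(+)"] sum.cong) auto
      also have "\<dots> = (2 * k x + 1) * growth_count m (Suc (n - k x)) (k x)
          + (n - k x) * growth_count m (n - k x) (Suc (k x))"
      proof -
        have "card ?B = n - k x" "Suc n - k x = Suc (n - k x)" using rise[OF x] by linarith+
        then show ?thesis using stay[OF x] by simp
      qed
      finally show ?thesis by simp
    qed
    have "(\<Sum>x\<in>X (Suc n). growth_count m (Suc n - k x) (k x))
        = (\<Sum>x\<in>X n. \<Sum>y\<in>offspring n x. growth_count m (Suc n - k y) (k y))"
      unfolding step using finX fin disj by (intro sum.UNION_disjoint) auto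
    also have "\<dots> = (\<Sum>x\<in>X n. growth_count (Suc m) (n - k x) (k x))"
      using one by (rule sum.cong[OF refl])
    finally show ?case by (simp add: Suc.IH del: growth_count.simps)
  qed
  from key[where m=0] show ?thesis
    using finX by (simp add: half_fubini_number_def)
qed

section \<open>Build-tree codes\<close>

lemma codes_before_0: "build_tree_codes_plus_before 0 = {[]}"
  by (auto simp: build_tree_codes_plus_before_def build_tree_codes_def)

text \<open>
  The values \<open>v\<close> that may be appended with a minus sign; these are the active vertices of the code.
\<close>

definition seen :: "(nat \<times> int) list \<Rightarrow> nat set" where
  "seen c = {v. v > 0 \<and> (v, 1) \<in> set c}"

definition code_extensions :: "nat \<Rightarrow> (nat \<times> int) list \<Rightarrow> (nat \<times> int) list set" where
  "code_extensions n c = (\<lambda>x. c @ [x]) ` ({..n} \<times> {1} \<union> seen c \<times> {- 1})"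

lemma seen_bound:
  assumes "c \<in> build_tree_codes_plus_before n"
  shows "seen c \<subseteq> {1..n}"
proof
  fix v assume "v \<in> seen c"
  then obtain i where "v > 0" "i < n" "c ! i = (v, 1)"
    using assms by (auto simp: seen_def in_set_conv_nth build_tree_codes_plus_before_def build_tree_codes_def)
  moreover have "fst (c ! i) \<le> i"
    using assms \<open>i < n\<close> by (auto simp: build_tree_codes_plus_before_def build_tree_codes_def)
  ultimately show "v \<in> {1..n}" by simp
qed

text \<open>
  The condition on a minus sign looks only to the left of it, so a code is valid if and only if its
  prefix is valid and its last entry is compatible with the prefix.
\<close>

lemma codes_before_snoc:
  "c @ [x] \<in> build_tree_codes_plus_before (Suc n) \<longleftrightarrow>
     c \<in> build_tree_codes_plus_before n \<and> x \<in> {..n} \<times> {1} \<union> seen c \<times> {- 1}"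
    (is "?l \<longleftrightarrow> ?r")
proof
  assume l: ?l
  then have len: "length c = n"
    and tree: "\<And>i. i < Suc n \<Longrightarrow> fst ((c @ [x]) ! i) \<le> i \<and> snd ((c @ [x]) ! i) \<in> {1, - 1} \<and> (c @ [x]) ! i \<noteq> (0, - 1)"
    and plus: "\<And>i v. i < Suc n \<Longrightarrow> (c @ [x]) ! i = (v, - 1) \<Longrightarrow> \<exists>k<Suc n. k < i \<and> (c @ [x]) ! k = (v, 1)"
    by (auto simp: build_tree_codes_plus_before_def build_tree_codes_def)
  have "c \<in> build_tree_codes_plus_before n"
    unfolding build_tree_codes_plus_before_def build_tree_codes_def mem_Collect_eq
  proof (intro conjI allI impI len)
    fix i assume i: "i < n"
    show "fst (c ! i) \<le> i" "snd (c ! i) \<in> {1, - 1}" "c ! i \<noteq> (0, - 1)"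
      using tree[of i] i len by (auto simp: nth_append)
    fix v assume "c ! i = (v, - 1)"
    then obtain k where "k < i" "(c @ [x]) ! k = (v, 1)"
      using plus[of i v] i len by (auto simp: nth_append)
    then show "\<exists>k<n. i > k \<and> c ! k = (v, 1)"
      using i len by (intro exI[of _ k]) (auto simp: nth_append)
  qed
  moreover have "x \<in> {..n} \<times> {1} \<union> seen c \<times> {- 1}"
  proof (cases x)
    case (Pair v s)
    consider "s = 1" | "s = - 1" "v > 0" using tree[of n] len Pair by (auto simp: nth_append)
    then show ?thesis
    proof cases
      case 1
      then show ?thesis using tree[of n] len Pair by auto
    next
      case 2
      then obtain k where "k < n" "c ! k = (v, 1)"
        using plus[of n v] len Pair by (auto simp: nth_append split: if_splits)
      then have "(v, 1) \<in> set c"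
        using len by (metis nth_mem)
      with 2 Pair show ?thesis by (auto simp: seen_def)
    qed
  qed
  ultimately show ?r by blast
next
  assume r: ?r
  then have len: "length c = n"
    and tree: "\<And>i. i < n \<Longrightarrow> fst (c ! i) \<le> i \<and> snd (c ! i) \<in> {1, - 1} \<and> c ! i \<noteq> (0, - 1)"
    and plus: "\<And>i v. i < n \<Longrightarrow> c ! i = (v, - 1) \<Longrightarrow> \<exists>k<n. k < i \<and> c ! k = (v, 1)"
    by (auto simp: build_tree_codes_plus_before_def build_tree_codes_def)
  have sb: "seen c \<subseteq> {1..n}" using r seen_bound by blast
  show ?l
    unfolding build_tree_codes_plus_before_def build_tree_codes_def mem_Collect_eq
  proof (intro conjI allI impI)
    show "length (c @ [x]) = Suc n" using len by simp
    fix i assume i: "i < Suc n"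
    show "fst ((c @ [x]) ! i) \<le> i" "snd ((c @ [x]) ! i) \<in> {1, - 1}" "(c @ [x]) ! i \<noteq> (0, - 1)"
      using tree[of i] r sb i len by (auto simp: nth_append less_Suc_eq)
    fix v assume v: "(c @ [x]) ! i = (v, - 1)"
    show "\<exists>k<Suc n. i > k \<and> (c @ [x]) ! k = (v, 1)"
    proof (cases "i = n")
      case True
      then have "x = (v, - 1)" using v len by (simp add: nth_append)
      then have "(v, 1) \<in> set c" using r by (auto simp: seen_def)
      then show ?thesis using len True by (auto simp: nth_append in_set_conv_nth)
    next
      case False
      then show ?thesis using plus[of i v] v i len by (fastforce simp: nth_append)
    qed
  qed
qed

lemma codes_before_Suc:
  "build_tree_codes_plus_before (Suc n) =
    (\<Union>c\<in>build_tree_codes_plus_before n. code_extensions n c)"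
proof -
  have "c \<in> build_tree_codes_plus_before (Suc n) \<longleftrightarrow>
      c \<in> (\<Union>c\<in>build_tree_codes_plus_before n. code_extensions n c)" for c
  proof (cases c rule: rev_cases)
    case Nil
    then show ?thesis
      by (auto simp: build_tree_codes_plus_before_def build_tree_codes_def code_extensions_def)
  next
    case (snoc d x)
    have "d @ [x] \<in> (\<Union>c\<in>build_tree_codes_plus_before n. code_extensions n c) \<longleftrightarrow>
        d \<in> build_tree_codes_plus_before n \<and> x \<in> {..n} \<times> {1} \<union> seen d \<times> {- 1}"
      unfolding code_extensions_def by (simp add: image_iff)
    then show ?thesis
      unfolding snoc codes_before_snoc by (rule sym)
  qed
  then show ?thesis by (rule set_eqI)
qed

lemma seen_snoc:
  "seen (c @ [x]) = (if x \<in> {(v, 1) |v. v > 0} then insert (fst x) (seen c) else seen c)"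
  by (auto simp: seen_def)

lemma finite_seen [simp]: "finite (seen c)"
  by (rule finite_subset[of _ "fst ` set c"]) (force simp: seen_def)+

text \<open>
  The entry \<open>0\<^sup>+\<close> and the entries \<open>v\<^sup>+\<close>, \<open>v\<^sup>-\<close> with \<open>v\<close> already seen leave \<open>seen\<close> unchanged; a first
  occurrence \<open>v\<^sup>+\<close> enlarges it.
\<close>

lemma card_code_extensions:
  assumes "c \<in> build_tree_codes_plus_before n"
  shows "card {y \<in> code_extensions n c. card (seen y) = card (seen c)} = 2 * card (seen c) + 1"
    and "card {y \<in> code_extensions n c. card (seen y) = Suc (card (seen c))} + card (seen c) = n"
proof -
  note sb = seen_bound[OF assms]
  have n0: "0 \<notin> seen c" by (simp add: seen_def)
  have st: "card (seen (c @ [x])) = card (seen c) \<longleftrightarrow> x \<notin> ({1..n} - seen c) \<times> {1}"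
    "card (seen (c @ [x])) = Suc (card (seen c)) \<longleftrightarrow> x \<in> ({1..n} - seen c) \<times> {1}"
    if "x \<in> {..n} \<times> {1} \<union> seen c \<times> {- 1}" for x
    using that sb by (auto simp: seen_snoc card_insert_if)
  have "{y \<in> code_extensions n c. card (seen y) = card (seen c)}
      = (\<lambda>x. c @ [x]) ` (insert 0 (seen c) \<times> {1} \<union> seen c \<times> {- 1})"
    unfolding code_extensions_def using st sb by auto
  also have "card \<dots> = card (insert 0 (seen c) \<times> {1 :: int} \<union> seen c \<times> {- 1})"
    by (rule card_image) (simp add: inj_on_def)
  also have "\<dots> = 2 * card (seen c) + 1"
    using n0 by (subst card_Un_disjoint) (auto simp: card_cartesian_product)
  finally show "card {y \<in> code_extensions n c. card (seen y) = card (seen c)} = 2 * card (seen c) + 1" .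
  have "{y \<in> code_extensions n c. card (seen y) = Suc (card (seen c))}
      = (\<lambda>x. c @ [x]) ` (({1..n} - seen c) \<times> {1})"
    unfolding code_extensions_def using st sb by auto
  also have "card \<dots> = card (({1..n} - seen c) \<times> {1 :: int})"
    by (rule card_image) (simp add: inj_on_def)
  also have "\<dots> = n - card (seen c)"
    using sb by (simp add: card_cartesian_product card_Diff_subset)
  finally show "card {y \<in> code_extensions n c. card (seen y) = Suc (card (seen c))} + card (seen c) = n"
    using card_mono[OF _ sb] by simp
qed

theorem card_codes_before:
  "finite (build_tree_codes_plus_before n) \<and>
   card (build_tree_codes_plus_before n) = half_fubini_number n"
proof (rule card_generating_tree[where offspring = code_extensions and k = "\<lambda>c. card (seen c)"])
  fix n c d
  assume c: "c \<in> build_tree_codes_plus_before n"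
  show "finite (code_extensions n c)" by (simp add: code_extensions_def)
  show "card (seen d) = card (seen c) \<or> card (seen d) = Suc (card (seen c))"
    if "d \<in> code_extensions n c"
    using that by (auto simp: code_extensions_def seen_snoc card_insert_if split: if_splits)
  show "code_extensions n c \<inter> code_extensions n d = {}" if "c \<noteq> d"
    using that by (auto simp: code_extensions_def)
  show "card {y \<in> code_extensions n c. card (seen y) = card (seen c)} = 2 * card (seen c) + 1"
    and "card {y \<in> code_extensions n c. card (seen y) = Suc (card (seen c))} + card (seen c) = n"
    by (rule card_code_extensions[OF c])+
next
  show "build_tree_codes_plus_before (Suc n) =
    (\<Union>c\<in>build_tree_codes_plus_before n. code_extensions n c)" for n
    by (rule codes_before_Suc)
  show "build_tree_codes_plus_before 0 = {[]}" "card (seen []) = 0"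
    by (simp_all add: codes_before_0 seen_def)
qed

definition occurrences :: "(nat \<times> int) list \<Rightarrow> nat \<Rightarrow> nat set" where
  "occurrences c i = {j. j < length c \<and> fst (c ! j) = fst (c ! i)}"

text \<open>
  Exchanges the first and the last occurrence of each value and fixes all other positions.
\<close>

definition partner :: "(nat \<times> int) list \<Rightarrow> nat \<Rightarrow> nat" where
  "partner c i =
    (if i = Min (occurrences c i) then Max (occurrences c i)
     else if i = Max (occurrences c i) then Min (occurrences c i) else i)"

text \<open>
  A valid code has a plus at the first, respectively last, occurrence of every value. Moving only the
  signs, not the values, preserves the bounds \<open>a\<^sub>i < i\<close> and interchanges the two conditions.
\<close>

definition exchange_signs :: "(nat \<times> int) list \<Rightarrow> (nat \<times> int) list" where
  "exchange_signs c = map (\<lambda>i. (fst (c ! i), snd (c ! partner c i))) [0..<length c]"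

lemma finite_occurrences [simp]: "finite (occurrences c i)"
  by (simp add: occurrences_def)

lemma self_occurrence: "i < length c \<Longrightarrow> i \<in> occurrences c i"
  by (simp add: occurrences_def)

lemma Min_Max_occurrences:
  assumes "i < length c"
  shows "Min (occurrences c i) \<in> occurrences c i" "Max (occurrences c i) \<in> occurrences c i"
  using self_occurrence[OF assms] by (auto intro!: Min_in Max_in simp del: finite_occurrences) simp_all

lemma partner_in: "i < length c \<Longrightarrow> partner c i \<in> occurrences c i"
  using Min_Max_occurrences self_occurrence by (simp add: partner_def)

lemma occurrences_cong: "j \<in> occurrences c i \<Longrightarrow> occurrences c j = occurrences c i"
  by (auto simp: occurrences_def)

lemma partner_partner: "i < length c \<Longrightarrow> partner c (partner c i) = i"
  using occurrences_cong[OF partner_in, of i c] by (auto simp: partner_def)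

lemma length_exchange_signs [simp]: "length (exchange_signs c) = length c"
  by (simp add: exchange_signs_def)

lemma nth_exchange_signs:
  "i < length c \<Longrightarrow> exchange_signs c ! i = (fst (c ! i), snd (c ! partner c i))"
  by (simp add: exchange_signs_def)

lemma occurrences_exchange_signs:
  "i < length c \<Longrightarrow> occurrences (exchange_signs c) i = occurrences c i"
  by (auto simp: occurrences_def nth_exchange_signs)

lemma partner_exchange_signs: "i < length c \<Longrightarrow> partner (exchange_signs c) i = partner c i"
  by (simp add: partner_def occurrences_exchange_signs)

lemma exchange_signs_involution: "exchange_signs (exchange_signs c) = c"
proof (rule nth_equalityI)
  fix i assume "i < length (exchange_signs (exchange_signs c))"
  then have i: "i < length c" by simp
  then have "partner c i < length c"
    using partner_in[OF i] by (simp add: occurrences_def)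
  with i show "exchange_signs (exchange_signs c) ! i = c ! i"
    by (simp add: nth_exchange_signs partner_exchange_signs partner_partner)
qed simp

lemma build_tree_codes_iff:
  "c \<in> build_tree_codes n \<longleftrightarrow> length c = n \<and>
     (\<forall>i<n. fst (c ! i) \<le> i \<and> (snd (c ! i) = 1 \<or> snd (c ! i) = - 1 \<and> fst (c ! i) \<noteq> 0))"
  by (auto simp: build_tree_codes_def prod_eq_iff)

lemma exchange_signs_code:
  assumes "c \<in> build_tree_codes n"
  shows "exchange_signs c \<in> build_tree_codes n"
proof -
  have "fst (c ! partner c i) = fst (c ! i)" "partner c i < length c" if "i < length c" for i
    using partner_in[OF that] by (simp_all add: occurrences_def)
  then show ?thesis
    using assms by (fastforce simp: build_tree_codes_iff nth_exchange_signs)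
qed

text \<open>
  It suffices to look at the first occurrence of each value: a plus there precedes every later minus,
  whereas a minus there has no plus before it.
\<close>

lemma plus_before_iff:
  "c \<in> build_tree_codes_plus_before n \<longleftrightarrow>
     c \<in> build_tree_codes n \<and> (\<forall>i<n. snd (c ! Min (occurrences c i)) = 1)"
proof (cases "c \<in> build_tree_codes n")
  case True
  then have len: "length c = n" and sgn: "\<And>i. i < n \<Longrightarrow> snd (c ! i) = 1 \<or> snd (c ! i) = - 1"
    by (auto simp: build_tree_codes_iff)
  have "(\<forall>i<n. \<forall>v. c ! i = (v, - 1) \<longrightarrow> (\<exists>k<n. k < i \<and> c ! k = (v, 1))) \<longleftrightarrow>
      (\<forall>i<n. snd (c ! Min (occurrences c i)) = 1)" (is "?l \<longleftrightarrow> ?r")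
  proof (intro iffI allI impI)
    fix i assume l: ?l and i: "i < n"
    let ?m = "Min (occurrences c i)"
    have m: "?m < n" "fst (c ! ?m) = fst (c ! i)"
      using Min_Max_occurrences(1)[of i c] i len by (auto simp: occurrences_def)
    show "snd (c ! ?m) = 1"
    proof (rule ccontr)
      assume "snd (c ! ?m) \<noteq> 1"
      then have "c ! ?m = (fst (c ! i), - 1)" using sgn[OF m(1)] m(2) by (simp add: prod_eq_iff)
      then obtain k where "k < n" "k < ?m" "c ! k = (fst (c ! i), 1)" using l m(1) by blast
      then have "k \<in> occurrences c i" using len by (simp add: occurrences_def)
      then show False using \<open>k < ?m\<close> Min_le[OF finite_occurrences] by (meson leD)
    qed
  next
    fix i v assume r: ?r and i: "i < n" and v: "c ! i = (v, - 1)"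
    let ?m = "Min (occurrences c i)"
    have m: "?m < n" "fst (c ! ?m) = v"
      using Min_Max_occurrences(1)[of i c] i len v by (auto simp: occurrences_def)
    have s: "snd (c ! ?m) = 1" using r i by blast
    have "?m \<le> i" using self_occurrence i len by simp
    moreover have "?m \<noteq> i"
    proof
      assume "?m = i"
      then show False using s v by simp
    qed
    ultimately show "\<exists>k<n. k < i \<and> c ! k = (v, 1)"
      using m s by (intro exI[of _ ?m]) (simp add: prod_eq_iff)
  qed
  with True show ?thesis by (simp add: build_tree_codes_plus_before_def)
qed (simp add: build_tree_codes_plus_before_def)

lemma plus_after_iff:
  "c \<in> build_tree_codes_plus_after n \<longleftrightarrow>
     c \<in> build_tree_codes n \<and> (\<forall>i<n. snd (c ! Max (occurrences c i)) = 1)"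
proof (cases "c \<in> build_tree_codes n")
  case True
  then have len: "length c = n" and sgn: "\<And>i. i < n \<Longrightarrow> snd (c ! i) = 1 \<or> snd (c ! i) = - 1"
    by (auto simp: build_tree_codes_iff)
  have "(\<forall>i<n. \<forall>v. c ! i = (v, - 1) \<longrightarrow> (\<exists>k<n. k > i \<and> c ! k = (v, 1))) \<longleftrightarrow>
      (\<forall>i<n. snd (c ! Max (occurrences c i)) = 1)" (is "?l \<longleftrightarrow> ?r")
  proof (intro iffI allI impI)
    fix i assume l: ?l and i: "i < n"
    let ?m = "Max (occurrences c i)"
    have m: "?m < n" "fst (c ! ?m) = fst (c ! i)"
      using Min_Max_occurrences(2)[of i c] i len by (auto simp: occurrences_def)
    show "snd (c ! ?m) = 1"
    proof (rule ccontr)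
      assume "snd (c ! ?m) \<noteq> 1"
      then have "c ! ?m = (fst (c ! i), - 1)" using sgn[OF m(1)] m(2) by (simp add: prod_eq_iff)
      then obtain k where "k < n" "k > ?m" "c ! k = (fst (c ! i), 1)" using l m(1) by blast
      then have "k \<in> occurrences c i" using len by (simp add: occurrences_def)
      then show False using \<open>k > ?m\<close> Max_ge[OF finite_occurrences] by (meson leD)
    qed
  next
    fix i v assume r: ?r and i: "i < n" and v: "c ! i = (v, - 1)"
    let ?m = "Max (occurrences c i)"
    have m: "?m < n" "fst (c ! ?m) = v"
      using Min_Max_occurrences(2)[of i c] i len v by (auto simp: occurrences_def)
    have s: "snd (c ! ?m) = 1" using r i by blast
    have "?m \<ge> i" using self_occurrence i len by simp
    moreover have "?m \<noteq> i"
    proof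
      assume "?m = i"
      then show False using s v by simp
    qed
    ultimately show "\<exists>k<n. k > i \<and> c ! k = (v, 1)"
      using m s by (intro exI[of _ ?m]) (simp add: prod_eq_iff)
  qed
  with True show ?thesis by (simp add: build_tree_codes_plus_after_def)
qed (simp add: build_tree_codes_plus_after_def)

lemma partner_Min_Max:
  assumes "i < length c"
  shows "partner c (Min (occurrences c i)) = Max (occurrences c i)"
    and "partner c (Max (occurrences c i)) = Min (occurrences c i)"
  using occurrences_cong[OF Min_Max_occurrences(1)[OF assms]]
    occurrences_cong[OF Min_Max_occurrences(2)[OF assms]]
  by (simp_all add: partner_def)

lemma exchange_signs_before_after:
  "c \<in> build_tree_codes_plus_before n \<Longrightarrow> exchange_signs c \<in> build_tree_codes_plus_after n"
  "c \<in> build_tree_codes_plus_after n \<Longrightarrow> exchange_signs c \<in> build_tree_codes_plus_before n"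
proof -
  have m: "Min (occurrences c i) < length c" "Max (occurrences c i) < length c" if "i < length c" for i
    using Min_Max_occurrences[OF that] by (simp_all add: occurrences_def)
  have len: "n = length c" if "c \<in> build_tree_codes n" using that by (simp add: build_tree_codes_def)
  show "c \<in> build_tree_codes_plus_before n \<Longrightarrow> exchange_signs c \<in> build_tree_codes_plus_after n"
    "c \<in> build_tree_codes_plus_after n \<Longrightarrow> exchange_signs c \<in> build_tree_codes_plus_before n"
    unfolding plus_before_iff plus_after_iff
    using exchange_signs_code m
    by (auto dest!: len simp: occurrences_exchange_signs nth_exchange_signs partner_Min_Max)
qed

theorem card_codes_after:
  "finite (build_tree_codes_plus_after n) \<and>
   card (build_tree_codes_plus_after n) = half_fubini_number n"
proof -
  have "bij_betw exchange_signs (build_tree_codes_plus_before n) (build_tree_codes_plus_after n)"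
    by (rule bij_betw_byWitness[where f' = exchange_signs])
      (auto simp: exchange_signs_involution exchange_signs_before_after)
  then show ?thesis
    using card_codes_before bij_betw_finite bij_betw_same_card by metis
qed

section \<open>Drawings of plane trees\<close>

text \<open>
  A plane tree is the forest of the children of its root, so all recursions are done on forests, along
  the first tree and the remaining ones.
\<close>

lemma plane_forest_induct [case_names Nil Cons]:
  assumes "P []" and "\<And>us ts. P us \<Longrightarrow> P ts \<Longrightarrow> P (PNode us # ts)"
  shows "P ts"
proof (induction ts rule: measure_induct_rule[where f = "\<lambda>ts. \<Sum>t\<leftarrow>ts. num_vertices t"])
  case (less ts)
  show ?case
  proof (cases ts)
    case (Cons t us)
    obtain vs where "t = PNode vs" by (cases t)
    then have "(\<Sum>t\<leftarrow>vs. num_vertices t) < (\<Sum>t\<leftarrow>ts. num_vertices t)"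
      "(\<Sum>t\<leftarrow>us. num_vertices t) < (\<Sum>t\<leftarrow>ts. num_vertices t)"
      using Cons by auto
    then show ?thesis using less assms(2) Cons \<open>t = PNode vs\<close> by simp
  qed (simp add: assms(1))
qed

inductive add_leaf :: "plane_tree list \<Rightarrow> plane_tree list \<Rightarrow> bool" where
  here: "add_leaf ts (PNode [] # ts)"
| inside: "add_leaf us us' \<Longrightarrow> add_leaf (PNode us # ts) (PNode us' # ts)"
| beyond: "add_leaf ts ts' \<Longrightarrow> add_leaf (t # ts) (t # ts')"

lemma add_leaf_append: "add_leaf ts ts' \<Longrightarrow> add_leaf (xs @ ts) (xs @ ts')"
  by (induction xs) (auto intro: add_leaf.intros)

lemma remove_leaf_iff_add_leaf:
  "remove_leaf (PNode ts') (PNode ts) \<longleftrightarrow> add_leaf ts ts'"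
proof
  have "add_leaf us us'" if "remove_leaf (PNode us') (PNode us)"  for us us'
    using that
  proof (induction "PNode us'" "PNode us" arbitrary: us us' rule: remove_leaf.induct)
    case (child xs ys)
    show ?case by (intro add_leaf_append add_leaf.here)
  next
    case (deeper t t' xs ys)
    obtain vs vs' where "t = PNode vs" "t' = PNode vs'" by (cases t, cases t')
    with deeper show ?case by (auto intro!: add_leaf_append add_leaf.inside)
  qed
  then show "remove_leaf (PNode ts') (PNode ts) \<Longrightarrow> add_leaf ts ts'" .
  show "add_leaf ts ts' \<Longrightarrow> remove_leaf (PNode ts') (PNode ts)"
  proof (induction rule: add_leaf.induct)
    case (here ts)
    show ?case using remove_leaf.child[of "[]" ts] by simp
  next
    case (inside us us' ts)
    then show ?case using remove_leaf.deeper[of _ _ "[]" ts] by simp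
  next
    case (beyond ts ts' t)
    from beyond.IH show ?case
    proof cases
      case (child xs ys)
      then show ?thesis using remove_leaf.child[of "t # xs" ys] by simp
    next
      case (deeper u u' xs ys)
      then show ?thesis using remove_leaf.deeper[of u u' "t # xs" ys] by simp
    qed
  qed
qed

definition num_forest :: "plane_tree list \<Rightarrow> nat" where
  "num_forest ts = (\<Sum>t\<leftarrow>ts. num_vertices t)"

lemma num_forest_simps [simp]:
  "num_forest [] = 0" "num_forest (PNode us # ts) = Suc (num_forest us + num_forest ts)"
  by (simp_all add: num_forest_def)

text \<open>
  The forest below the root of a drawn tree is the structure that grows; the active vertices are those
  with children.
\<close>

fun num_inner :: "plane_tree list \<Rightarrow> nat" where
  "num_inner [] = 0"
| "num_inner (PNode us # ts) = (if us = [] then 0 else Suc (num_inner us)) + num_inner ts"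

definition enlargements :: "plane_tree list \<Rightarrow> plane_tree list set" where
  "enlargements ts = {ts'. add_leaf ts ts'}"

lemma enlargements_Nil: "enlargements [] = {[PNode []]}"
  by (auto simp: enlargements_def intro: add_leaf.intros elim: add_leaf.cases)

text \<open>
  A leaf inserted to the left of a leaf yields the same forest as one inserted directly to its right,
  so only two kinds of insertion remain.
\<close>

lemma enlargements_leaf:
  "enlargements (PNode [] # ts) = insert (PNode [PNode []] # ts) ((#) (PNode []) ` enlargements ts)"
proof -
  have nil: "add_leaf [] us \<longleftrightarrow> us = [PNode []]" for us
    using enlargements_Nil by (auto simp: enlargements_def)
  have "add_leaf (PNode [] # ts) ts' \<longleftrightarrow>
      ts' = PNode [PNode []] # ts \<or> (\<exists>us. ts' = PNode [] # us \<and> add_leaf ts us)" for ts'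
    by (subst add_leaf.simps) (auto simp: nil intro: add_leaf.here)
  then show ?thesis
    by (auto simp: enlargements_def)
qed

lemma enlargements_Cons:
  assumes "us \<noteq> []"
  shows "enlargements (PNode us # ts) = insert (PNode [] # PNode us # ts)
    ((\<lambda>us'. PNode us' # ts) ` enlargements us \<union> (#) (PNode us) ` enlargements ts)"
proof -
  have "add_leaf (PNode us # ts) ts' \<longleftrightarrow> ts' = PNode [] # PNode us # ts \<or>
      (\<exists>us'. ts' = PNode us' # ts \<and> add_leaf us us') \<or>
      (\<exists>ts''. ts' = PNode us # ts'' \<and> add_leaf ts ts'')" for ts'
    by (subst add_leaf.simps) auto
  then show ?thesis
    by (auto simp: enlargements_def)
qed

lemma num_forest_enlargement: "us \<in> enlargements ts \<Longrightarrow> num_forest us = Suc (num_forest ts)"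
  unfolding enlargements_def mem_Collect_eq
  by (induction rule: add_leaf.induct) (auto simp: num_forest_def)

lemma finite_enlargements: "finite (enlargements ts)"
proof (induction ts rule: plane_forest_induct)
  case (Cons us ts)
  then show ?case by (cases "us = []") (simp_all add: enlargements_leaf enlargements_Cons)
qed (simp add: enlargements_Nil)

text \<open>
  A new leaf goes to the far left of some children list or directly to the right of a sibling that has
  children; all other places repeat one of these forests. This gives two places for each inner vertex
  and one for the root, which do not create an inner vertex, and one place below each leaf, which does.
\<close>

lemma card_enlargements:
  "(\<forall>us\<in>enlargements ts. num_inner us = num_inner ts \<or> num_inner us = Suc (num_inner ts)) \<and>
   card {us \<in> enlargements ts. num_inner us = num_inner ts} = 2 * num_inner ts + 1 \<and>
   card {us \<in> enlargements ts. num_inner us = Suc (num_inner ts)} + num_inner ts = num_forest ts"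
proof (induction ts rule: plane_forest_induct)
  case Nil
  have "{us \<in> enlargements []. num_inner us = 0} = {[PNode []]}"
    "{us \<in> enlargements []. num_inner us = Suc 0} = {}"
    by (auto simp: enlargements_Nil)
  then show ?case by (simp add: enlargements_Nil)
next
  case (Cons us ts)
  let ?E = "\<lambda>ts c. {ts' \<in> enlargements ts. num_inner ts' = c}"
  have ne: "us' \<noteq> []" if "us' \<in> enlargements us" for us'
    using num_forest_enlargement[OF that] by auto
  have ns: "us' \<noteq> us" if "us' \<in> enlargements us" for us'
    using num_forest_enlargement[OF that] by auto
  have fin: "finite (?E ts c)" for ts c using finite_enlargements by simp
  show ?case
  proof (cases "us = []")
    case True
    have "?E (PNode us # ts) (num_inner ts) = (#) (PNode []) ` ?E ts (num_inner ts)"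
      unfolding True enlargements_leaf by auto
    moreover have "?E (PNode us # ts) (Suc (num_inner ts)) =
        insert (PNode [PNode []] # ts) ((#) (PNode []) ` ?E ts (Suc (num_inner ts)))"
      unfolding True enlargements_leaf by auto
    moreover have "card (insert (PNode [PNode []] # ts) ((#) (PNode []) ` ?E ts (Suc (num_inner ts))))
        = Suc (card (?E ts (Suc (num_inner ts))))"
      using fin by (subst card_insert_disjoint) (auto simp: card_image)
    ultimately show ?thesis
      using Cons True by (auto simp: card_image enlargements_leaf)
  next
    case False
    let ?f = "\<lambda>us'. PNode us' # ts" and ?g = "(#) (PNode us)"
    let ?s = "num_inner (PNode us # ts)"
    have rel: "\<forall>ts'\<in>enlargements (PNode us # ts). num_inner ts' = ?s \<or> num_inner ts' = Suc ?s"
      using Cons False ne by (fastforce simp: enlargements_Cons)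
    have split: "?E (PNode us # ts) (?s + i) =
        (if i = 0 then {PNode [] # PNode us # ts} else {}) \<union>
        (?f ` ?E us (num_inner us + i) \<union> ?g ` ?E ts (num_inner ts + i))" for i
      using False ne by (auto simp: enlargements_Cons)
    have disj: "?f ` ?E us i \<inter> ?g ` ?E ts j = {}" for i j
      using ns by auto
    have notin: "PNode [] # PNode us # ts \<notin> ?f ` ?E us i \<union> ?g ` ?E ts j" for i j
      using False by auto
    have both: "card (?f ` ?E us i \<union> ?g ` ?E ts j) = card (?E us i) + card (?E ts j)" for i j
      using fin disj by (subst card_Un_disjoint) (auto simp: card_image inj_on_def)
    have "card (?E (PNode us # ts) ?s) = Suc (card (?E us (num_inner us)) + card (?E ts (num_inner ts)))"
      using split[of 0] notin[of "num_inner us" "num_inner ts"] fin both by simp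
    moreover have "card (?E (PNode us # ts) (Suc ?s)) = card (?E us (Suc (num_inner us))) + card (?E ts (Suc (num_inner ts)))"
      using split[of 1] both by simp
    ultimately show ?thesis
      using Cons rel False by simp
  qed
qed

fun subforest :: "plane_tree \<Rightarrow> plane_tree list" where
  "subforest (PNode ts) = ts"

definition drawing_extensions :: "plane_tree list \<Rightarrow> plane_tree list set" where
  "drawing_extensions Ts = (\<lambda>ts. Ts @ [PNode ts]) ` enlargements (subforest (last Ts))"

lemma num_vertices_eq: "num_vertices T = Suc (num_forest (subforest T))"
  by (cases T) (simp add: num_forest_def)

lemma remove_leaf_iff: "remove_leaf T' T \<longleftrightarrow> subforest T' \<in> enlargements (subforest T)"
  by (cases T; cases T') (simp add: remove_leaf_iff_add_leaf enlargements_def)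

text \<open>
  The sizes are forced: they start at one and increase by one with every added leaf.
\<close>

lemma drawings_iff:
  "Ts \<in> drawings n \<longleftrightarrow> length Ts = Suc n \<and> Ts ! 0 = PNode [] \<and>
     (\<forall>i<n. remove_leaf (Ts ! Suc i) (Ts ! i))" (is "?l \<longleftrightarrow> ?r")
proof
  show "?l \<Longrightarrow> ?r" by (auto simp: drawings_def is_drawing_def)
  assume r: ?r
  have "i \<le> n \<Longrightarrow> num_vertices (Ts ! i) = Suc i" for i
  proof (induction i)
    case (Suc i)
    then show ?case
      using r num_forest_enlargement[of "subforest (Ts ! Suc i)" "subforest (Ts ! i)"]
      by (simp add: remove_leaf_iff num_vertices_eq)
  qed (use r in simp)
  moreover have "last Ts = Ts ! n"
    using r by (subst last_conv_nth) auto
  ultimately show ?l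
    using r \<open>last Ts = Ts ! n\<close> by (auto simp: drawings_def is_drawing_def)
qed

lemma drawings_snoc:
  assumes "Ts \<noteq> []"
  shows "Ts @ [T] \<in> drawings (Suc n) \<longleftrightarrow> Ts \<in> drawings n \<and> remove_leaf T (last Ts)"
proof (cases "length Ts = Suc n")
  case True
  then have "last Ts = Ts ! n" using last_conv_nth[OF assms] by simp
  with True show ?thesis
    by (auto simp: drawings_iff nth_append All_less_Suc)
qed (simp add: drawings_iff)

lemma drawings_Suc: "drawings (Suc n) = (\<Union>Ts\<in>drawings n. drawing_extensions Ts)"
proof -
  have "Us \<in> drawings (Suc n) \<longleftrightarrow> Us \<in> (\<Union>Ts\<in>drawings n. drawing_extensions Ts)" for Us
  proof (cases Us rule: rev_cases)
    case Nil
    then show ?thesis by (auto simp: drawings_iff drawing_extensions_def)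
  next
    case (snoc Ts T)
    have "Ts @ [T] \<in> drawing_extensions Us' \<longleftrightarrow> Us' = Ts \<and> remove_leaf T (last Ts)" for Us'
      by (cases T) (auto simp: drawing_extensions_def remove_leaf_iff)
    then have "Us \<in> (\<Union>Ts\<in>drawings n. drawing_extensions Ts) \<longleftrightarrow> Ts \<in> drawings n \<and> remove_leaf T (last Ts)"
      unfolding snoc by auto
    moreover have "Us \<in> drawings (Suc n) \<longleftrightarrow> Ts \<in> drawings n \<and> remove_leaf T (last Ts)"
    proof (cases "Ts = []")
      case True
      then show ?thesis by (simp add: snoc drawings_iff)
    qed (simp add: snoc drawings_snoc)
    ultimately show ?thesis by simp
  qed
  then show ?thesis by (rule set_eqI)
qed

theorem card_drawings: "finite (drawings n) \<and> card (drawings n) = half_fubini_number n"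
proof (rule card_generating_tree[where offspring = "\<lambda>n. drawing_extensions"
      and k = "\<lambda>Ts. num_inner (subforest (last Ts))"])
  show "drawings (Suc n) = (\<Union>Ts\<in>drawings n. drawing_extensions Ts)" for n
    by (rule drawings_Suc)
  show "drawings 0 = {[PNode []]}"
    by (auto simp: drawings_iff length_Suc_conv)
  show "num_inner (subforest (last [PNode []])) = 0" by simp
next
  fix n Ts Us assume Ts: "Ts \<in> drawings n"
  let ?ts = "subforest (last Ts)"
  have *: "card {Us \<in> drawing_extensions Ts. num_inner (subforest (last Us)) = c} =
      card {us \<in> enlargements ?ts. num_inner us = c}" for c
  proof -
    have "{Us \<in> drawing_extensions Ts. num_inner (subforest (last Us)) = c} =
        (\<lambda>ts. Ts @ [PNode ts]) ` {us \<in> enlargements ?ts. num_inner us = c}"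
      by (auto simp: drawing_extensions_def)
    then show ?thesis by (simp add: card_image inj_on_def)
  qed
  have "num_forest ?ts = n"
  proof -
    have "num_vertices (last Ts) = Suc n" using Ts by (auto simp: drawings_def is_drawing_def)
    then show ?thesis by (simp add: num_vertices_eq)
  qed
  then show "card {Us \<in> drawing_extensions Ts. num_inner (subforest (last Us)) = num_inner ?ts} = 2 * num_inner ?ts + 1"
    "card {Us \<in> drawing_extensions Ts. num_inner (subforest (last Us)) = Suc (num_inner ?ts)} + num_inner ?ts = n"
    unfolding * using card_enlargements[of ?ts] by auto
  show "num_inner (subforest (last Us)) = num_inner ?ts \<or> num_inner (subforest (last Us)) = Suc (num_inner ?ts)"
    if "Us \<in> drawing_extensions Ts"
    using that card_enlargements[of ?ts] by (auto simp: drawing_extensions_def)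
  show "finite (drawing_extensions Ts)"
    by (simp add: drawing_extensions_def finite_enlargements)
  show "drawing_extensions Ts \<inter> drawing_extensions Us = {}" if "Ts \<noteq> Us"
    using that by (auto simp: drawing_extensions_def)
qed

section \<open>Klazar trees\<close>

lemma labelled_forest_induct [case_names Nil Cons]:
  assumes "P []" and "\<And>a us ts. P us \<Longrightarrow> P ts \<Longrightarrow> P (Node a us # ts)"
  shows "P ts"
proof (induction ts rule: measure_induct_rule[where f = "size_list size"])
  case (less ts)
  show ?case
  proof (cases ts)
    case (Cons t us)
    obtain a vs where "t = Node a vs" by (cases t)
    then show ?thesis using less[of vs] less[of us] assms(2) Cons by simp
  qed (simp add: assms(1))
qed

definition forest_labels :: "'a ltree list \<Rightarrow> 'a list" where
  "forest_labels ts = concat (map labels ts)"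

lemma forest_labels_simps [simp]:
  "forest_labels [] = []"
  "forest_labels (Node a us # ts) = a # forest_labels us @ forest_labels ts"
  by (simp_all add: forest_labels_def)

lemma root_labels_subset: "label ` set ts \<subseteq> set (forest_labels ts)"
  by (induction ts rule: labelled_forest_induct) auto

text \<open>
  If \<open>a\<close> is the label of a vertex and \<open>ts\<close> lists its right siblings, then the right associate is the
  minimum of this prefix: behind the first smaller sibling there are no candidates, and among the
  candidates in the prefix, its left-to-right minima, the smallest one is chosen.
\<close>

definition larger_prefix :: "nat \<Rightarrow> nat ltree list \<Rightarrow> nat ltree list" where
  "larger_prefix a ts = takeWhile (\<lambda>u. a < label u) ts"

text \<open>
  Klazar forests below a vertex with label \<open>m\<close>. The last clause says that the right associate of the
  first root, if there is one, is larger than some child of that root.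
\<close>

fun klazar_forest :: "nat \<Rightarrow> nat ltree list \<Rightarrow> bool" where
  "klazar_forest m [] \<longleftrightarrow> True"
| "klazar_forest m (Node a us # ts) \<longleftrightarrow> m < a \<and> klazar_forest a us \<and> klazar_forest m ts \<and>
     (larger_prefix a ts = [] \<or> (\<exists>v\<in>set us. \<forall>u\<in>set (larger_prefix a ts). label v < label u))"

lemma associate_candidates_Suc:
  "associate_candidates (t # ts) (Suc i) = Suc ` associate_candidates ts i"
proof -
  have "j \<in> associate_candidates (t # ts) (Suc i) \<longleftrightarrow> j \<in> Suc ` associate_candidates ts i" for j
  proof (cases j)
    case (Suc j')
    have "(\<forall>k. Suc i < k \<and> k < Suc j' \<longrightarrow> label (ts ! j') < label ((t # ts) ! k)) \<longleftrightarrow>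
        (\<forall>k. i < k \<and> k < j' \<longrightarrow> label (ts ! j') < label (ts ! k))"
      by (auto simp: less_Suc_eq_0_disj nth_Cons split: nat.split)
    then show ?thesis
      by (auto simp: Suc associate_candidates_def image_iff)
  qed (auto simp: associate_candidates_def)
  then show ?thesis by blast
qed

lemma associate_candidates_0:
  "associate_candidates (t # ts) 0 =
    Suc ` {j. j < length (larger_prefix (label t) ts) \<and> (\<forall>k<j. label (ts ! j) < label (ts ! k))}"
proof -
  let ?p = "larger_prefix (label t) ts"
  have prefix: "j < length ?p" if "j < length ts" "label t < label (ts ! j)"
    "\<forall>k<j. label (ts ! j) < label (ts ! k)" for j
  proof (rule ccontr)
    assume "\<not> j < length ?p"
    then have le: "length ?p \<le> j" by simp
    then have "length ?p < length ts" using that(1) by simp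
    then have "\<not> label t < label (ts ! length ?p)"
      unfolding larger_prefix_def by (rule nth_length_takeWhile)
    with that le show False by (cases "length ?p = j") (auto dest!: spec[of _ "length ?p"])
  qed
  have larger: "j < length ts \<and> label t < label (ts ! j)" if "j < length ?p" for j
    using that nth_mem[OF that] length_takeWhile_le[of "\<lambda>u. label t < label u" ts]
    unfolding larger_prefix_def by (auto simp: takeWhile_nth dest: set_takeWhileD)
  have "j \<in> associate_candidates (t # ts) 0 \<longleftrightarrow>
    j \<in> Suc ` {j. j < length ?p \<and> (\<forall>k<j. label (ts ! j) < label (ts ! k))}" for j
  proof (cases j)
    case (Suc i)
    have "(\<forall>k. 0 < k \<and> k < Suc i \<longrightarrow> label (ts ! i) < label ((t # ts) ! k)) \<longleftrightarrow>
        (\<forall>k<i. label (ts ! i) < label (ts ! k))"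
      by (auto simp: nth_Cons split: nat.split)
    then show ?thesis
      using prefix larger by (auto simp: Suc associate_candidates_def image_iff)
  qed (auto simp: associate_candidates_def)
  then show ?thesis by blast
qed

lemma is_right_associate_Suc:
  "is_right_associate (t # ts) (Suc i) j \<longleftrightarrow> (\<exists>j'. j = Suc j' \<and> is_right_associate ts i j')"
  by (auto simp: is_right_associate_def associate_candidates_Suc)

text \<open>
  The first position at which the minimum is attained is a candidate, since everything to its left is
  strictly larger.
\<close>

lemma minimum_of_larger_prefix_candidate:
  assumes "larger_prefix (label t) ts \<noteq> []"
  obtains i where "Suc i \<in> associate_candidates (t # ts) 0"
    "label (ts ! i) = Min (label ` set (larger_prefix (label t) ts))"
proof -
  let ?p = "larger_prefix (label t) ts"
  let ?M = "Min (label ` set ?p)"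
  have nth: "ts ! i = ?p ! i" if "i < length ?p" for i
    using that by (simp add: larger_prefix_def takeWhile_nth)
  have "?M \<in> label ` set ?p" using assms by (intro Min_in) auto
  then obtain i where "i < length ?p" "label (?p ! i) = ?M" by (auto simp: in_set_conv_nth)
  then have ex: "i < length ?p \<and> label (?p ! i) = ?M" by blast
  define i0 where "i0 = (LEAST i. i < length ?p \<and> label (?p ! i) = ?M)"
  have i0: "i0 < length ?p" "label (?p ! i0) = ?M"
    using LeastI[of "\<lambda>i. i < length ?p \<and> label (?p ! i) = ?M", OF ex] by (auto simp: i0_def)
  have "label (ts ! i0) < label (ts ! k)" if "k < i0" for k
  proof -
    have "label (?p ! k) \<noteq> ?M"
      using not_less_Least[of k "\<lambda>i. i < length ?p \<and> label (?p ! i) = ?M"] that i0(1)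
      by (auto simp: i0_def)
    moreover have "?M \<le> label (?p ! k)" using that i0(1) by (intro Min_le) auto
    ultimately show ?thesis using that i0 nth by (simp add: order_less_le)
  qed
  then have "Suc i0 \<in> associate_candidates (t # ts) 0"
    unfolding associate_candidates_0 using i0(1) by auto
  then show ?thesis using that i0 nth by simp
qed

lemma associate_candidate_ge_minimum:
  assumes "Suc j \<in> associate_candidates (t # ts) 0"
  shows "larger_prefix (label t) ts \<noteq> []"
    and "Min (label ` set (larger_prefix (label t) ts)) \<le> label (ts ! j)"
proof -
  let ?p = "larger_prefix (label t) ts"
  have "j < length ?p" using assms unfolding associate_candidates_0 by auto
  moreover from this have "ts ! j = ?p ! j" by (simp add: larger_prefix_def takeWhile_nth)
  ultimately show "?p \<noteq> []" "Min (label ` set ?p) \<le> label (ts ! j)" by (auto intro!: Min_le)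
qed

lemma is_right_associate_0:
  assumes "is_right_associate (t # ts) 0 j"
  shows "larger_prefix (label t) ts \<noteq> []"
    and "label ((t # ts) ! j) = Min (label ` set (larger_prefix (label t) ts))"
proof -
  from assms obtain i where j: "j = Suc i" and i: "Suc i \<in> associate_candidates (t # ts) 0"
    by (cases j) (auto simp: is_right_associate_def associate_candidates_def)
  note ge = associate_candidate_ge_minimum[OF i]
  show "larger_prefix (label t) ts \<noteq> []" by (rule ge)
  then obtain k where "Suc k \<in> associate_candidates (t # ts) 0"
    "label (ts ! k) = Min (label ` set (larger_prefix (label t) ts))"
    by (rule minimum_of_larger_prefix_candidate)
  with assms ge(2) show "label ((t # ts) ! j) = Min (label ` set (larger_prefix (label t) ts))"
    by (fastforce simp: is_right_associate_def j)
qed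

lemma right_associate_0_exists:
  assumes "larger_prefix (label t) ts \<noteq> []"
  shows "\<exists>j. is_right_associate (t # ts) 0 j"
proof -
  obtain k where k: "Suc k \<in> associate_candidates (t # ts) 0"
    "label (ts ! k) = Min (label ` set (larger_prefix (label t) ts))"
    using assms by (rule minimum_of_larger_prefix_candidate)
  have "label (ts ! k) \<le> label ((t # ts) ! j)" if j: "j \<in> associate_candidates (t # ts) 0" for j
  proof -
    from j obtain i where "j = Suc i" unfolding associate_candidates_0 by auto
    then show ?thesis using associate_candidate_ge_minimum(2) j k(2) by simp
  qed
  with k(1) have "is_right_associate (t # ts) 0 (Suc k)"
    by (simp add: is_right_associate_def)
  then show ?thesis ..
qed

definition klazar_siblings :: "nat ltree list \<Rightarrow> bool" where
  "klazar_siblings ts \<longleftrightarrow> (\<forall>i<length ts. \<forall>j. is_right_associate ts i j \<longrightarrow>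
     children (ts ! i) \<noteq> [] \<and> label (ts ! j) > Min (label ` set (children (ts ! i))))"

text \<open>
  A vertex in front does not change the right associates of its right siblings, which lie further to the
  right; so only the condition for the new vertex is added.
\<close>

lemma klazar_siblings_Cons:
  "klazar_siblings (Node a us # ts) \<longleftrightarrow> klazar_siblings ts \<and>
    (larger_prefix a ts = [] \<or> (\<exists>v\<in>set us. \<forall>u\<in>set (larger_prefix a ts). label v < label u))"
proof -
  let ?t = "Node a us" and ?p = "larger_prefix a ts"
  have "(\<forall>j. is_right_associate (?t # ts) 0 j \<longrightarrow>
      us \<noteq> [] \<and> label ((?t # ts) ! j) > Min (label ` set us)) \<longleftrightarrow>
      (?p = [] \<or> us \<noteq> [] \<and> Min (label ` set ?p) > Min (label ` set us))"
    using is_right_associate_0[of ?t ts] right_associate_0_exists[of ?t ts] by fastforce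
  also have "\<dots> \<longleftrightarrow> ?p = [] \<or> (\<exists>v\<in>set us. \<forall>u\<in>set ?p. label v < label u)"
  proof (cases "?p = [] \<or> us = []")
    case False
    have "Min (label ` set us) \<in> label ` set us" using False by (intro Min_in) auto
    then obtain v where v: "v \<in> set us" "label v = Min (label ` set us)" by auto
    have "(\<exists>v\<in>set us. \<forall>u\<in>set ?p. label v < label u) \<longleftrightarrow> (\<forall>u\<in>set ?p. label v < label u)"
    proof
      assume "\<exists>v\<in>set us. \<forall>u\<in>set ?p. label v < label u"
      then obtain w where w: "w \<in> set us" "\<forall>u\<in>set ?p. label w < label u" by blast
      have "label v \<le> label w" using w(1) v(2) by simp
      then show "\<forall>u\<in>set ?p. label v < label u" using w(2) le_less_trans by blast
    qed (use v(1) in blast)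
    moreover have "Min (label ` set us) < Min (label ` set ?p) \<longleftrightarrow> (\<forall>u\<in>set ?p. label v < label u)"
      using False unfolding v(2)[symmetric] by (subst Min_gr_iff) auto
    ultimately show ?thesis using False by simp
  qed auto
  finally have first: "(\<forall>j. is_right_associate (?t # ts) 0 j \<longrightarrow>
      us \<noteq> [] \<and> label ((?t # ts) ! j) > Min (label ` set us)) \<longleftrightarrow>
      (?p = [] \<or> (\<exists>v\<in>set us. \<forall>u\<in>set ?p. label v < label u))" .
  have shift: "(\<forall>j. (\<exists>j'. j = Suc j' \<and> Q j') \<longrightarrow> R j) \<longleftrightarrow> (\<forall>j. Q j \<longrightarrow> R (Suc j))" for Q R
    by auto
  have "klazar_siblings (?t # ts) \<longleftrightarrow>
      (\<forall>j. is_right_associate (?t # ts) 0 j \<longrightarrow> us \<noteq> [] \<and> label ((?t # ts) ! j) > Min (label ` set us)) \<and>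
      klazar_siblings ts"
    unfolding klazar_siblings_def length_Cons All_less_Suc2 is_right_associate_Suc shift by simp
  then show ?thesis
    unfolding first by blast
qed

text \<open>
  The conditions at a vertex involve only the list of its children, so they can be collected along the
  recursion over the forest.
\<close>

lemma klazar_forest_iff:
  "klazar_forest m ts \<longleftrightarrow> (\<forall>t\<in>set ts. m < label t) \<and> klazar_siblings ts \<and>
     (\<forall>t\<in>set ts. \<forall>p\<in>subtrees t. (\<forall>u\<in>set (children p). label p < label u) \<and> klazar_siblings (children p))"
proof (induction ts arbitrary: m rule: labelled_forest_induct)
  case Nil
  show ?case by (simp add: klazar_siblings_def)
next
  case (Cons a us ts)
  show ?case
    unfolding klazar_forest.simps Cons klazar_siblings_Cons by auto
qed

lemma klazar_forest_labels:
  "klazar_forest m ts \<Longrightarrow> x \<in> set (forest_labels ts) \<Longrightarrow> m < x"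
  by (induction m ts rule: klazar_forest.induct) (auto intro: less_trans)

definition klazar_forests :: "nat \<Rightarrow> nat ltree list set" where
  "klazar_forests n =
    {ts. klazar_forest 0 ts \<and> distinct (forest_labels ts) \<and> set (forest_labels ts) = {1..n}}"

lemma klazar_trees_eq: "klazar_trees n = Node 0 ` klazar_forests n"
proof -
  have klazar: "T \<in> klazar_trees n \<longleftrightarrow> klazar_forest (label T) (children T) \<and>
      distinct (labels T) \<and> set (labels T) = {0..n}" for T
    by (cases T) (auto simp: klazar_trees_def increasing_trees_def klazar_forest_iff klazar_siblings_def)
  have "T \<in> klazar_trees n \<longleftrightarrow> T \<in> Node 0 ` klazar_forests n" for T
  proof (cases T)
    case (Node a ts)
    have "a = 0" if "klazar_forest a ts" "insert a (set (forest_labels ts)) = {0..n}"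
    proof -
      have "0 \<in> insert a (set (forest_labels ts))" using that(2) by simp
      then show ?thesis using klazar_forest_labels[OF that(1)] by fastforce
    qed
    moreover have "insert 0 (set (forest_labels ts)) = {0..n} \<longleftrightarrow> set (forest_labels ts) = {1..n}"
      if "0 \<notin> set (forest_labels ts)"
    proof -
      have "{0..n} = insert 0 {1..n}" by auto
      with that show ?thesis by (simp add: insert_ident)
    qed
    ultimately show ?thesis
      unfolding klazar by (auto simp: Node klazar_forests_def forest_labels_def[symmetric])
  qed
  then show ?thesis by (rule set_eqI)
qed

text \<open>
  A leaf with the largest label \<open>N\<close> becomes the right associate of its left neighbour, if that
  neighbour has no other one, and then the neighbour must have a child; a neighbour with another right
  associate has a child anyway. This is the only restriction on the place of the leaf, because every
  child label is smaller than \<open>N\<close>.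
\<close>

inductive add_maximum :: "nat \<Rightarrow> nat ltree list \<Rightarrow> nat ltree list \<Rightarrow> bool" for N where
  first: "add_maximum N ts (Node N [] # ts)"
| inside: "add_maximum N us us' \<Longrightarrow> add_maximum N (Node a us # ts) (Node a us' # ts)"
| beyond: "add_maximum N ts ts' \<Longrightarrow> us \<noteq> [] \<or> ts' \<noteq> Node N [] # ts \<Longrightarrow>
    add_maximum N (Node a us # ts) (Node a us # ts')"

lemma add_maximum_labels:
  "add_maximum N ts ts' \<Longrightarrow> mset (forest_labels ts') = add_mset N (mset (forest_labels ts))"
  by (induction rule: add_maximum.induct) auto

lemma add_maximum_set_labels:
  "add_maximum N ts ts' \<Longrightarrow> set (forest_labels ts') = insert N (set (forest_labels ts))"
  using add_maximum_labels[of N ts ts'] by (metis set_mset_add_mset_insert set_mset_mset)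

lemma add_maximum_distinct:
  "add_maximum N ts ts' \<Longrightarrow>
    distinct (forest_labels ts') \<longleftrightarrow> N \<notin> set (forest_labels ts) \<and> distinct (forest_labels ts)"
  using mset_eq_imp_distinct_iff[of "forest_labels ts'" "N # forest_labels ts"] add_maximum_labels[of N ts ts']
  by simp

lemma add_maximum_root_labels:
  assumes "add_maximum N ts ts'"
  shows "label ` set ts \<subseteq> label ` set ts'" "label ` set ts' \<subseteq> insert N (label ` set ts)"
  using assms by (induction rule: add_maximum.induct) auto

lemma root_labels_larger_prefix:
  "label ` set (larger_prefix a ts) = set (takeWhile ((<) a) (map label ts))"
  by (simp add: larger_prefix_def takeWhile_map comp_def)

text \<open>
  How right associates change: the new root \<open>N\<close> can only be added to the prefix, and an empty prefix
  stays empty unless \<open>N\<close> is put directly in front of \<open>ts\<close>.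
\<close>

lemma add_maximum_larger_prefix:
  assumes "add_maximum N ts ts'"
  shows "label ` set (larger_prefix a ts') \<subseteq> insert N (label ` set (larger_prefix a ts))"
    and "a < N \<Longrightarrow> label ` set (larger_prefix a ts) \<subseteq> label ` set (larger_prefix a ts')"
    and "ts' \<noteq> Node N [] # ts \<Longrightarrow> larger_prefix a ts' = [] \<longleftrightarrow> larger_prefix a ts = []"
proof -
  have "set (takeWhile ((<) a) (map label ts')) \<subseteq> insert N (set (takeWhile ((<) a) (map label ts)))"
    using assms by (induction rule: add_maximum.induct) (auto dest: set_takeWhileD)
  then show "label ` set (larger_prefix a ts') \<subseteq> insert N (label ` set (larger_prefix a ts))"
    by (simp add: root_labels_larger_prefix)
  assume "a < N"
  with assms have "set (takeWhile ((<) a) (map label ts)) \<subseteq> set (takeWhile ((<) a) (map label ts'))"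
    by (induction rule: add_maximum.induct) auto
  then show "label ` set (larger_prefix a ts) \<subseteq> label ` set (larger_prefix a ts')"
    by (simp add: root_labels_larger_prefix)
next
  show "ts' \<noteq> Node N [] # ts \<Longrightarrow> larger_prefix a ts' = [] \<longleftrightarrow> larger_prefix a ts = []"
    using assms by cases (auto simp: larger_prefix_def)
qed

text \<open>
  If a vertex had a right associate, its witnessing child still works, as it is smaller than \<open>N\<close>. If
  it gets \<open>N\<close> as a right associate, any child works, and the side condition provides one.
\<close>

lemma add_maximum_klazar_forest:
  assumes "add_maximum N ts ts'" "klazar_forest m ts" "m < N" "\<forall>x\<in>set (forest_labels ts). x < N"
  shows "klazar_forest m ts'"
  using assms
proof (induction arbitrary: m rule: add_maximum.induct)
  case (first ts)
  have "larger_prefix N ts = []"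
    using first root_labels_subset[of ts]
    by (cases ts) (auto simp: larger_prefix_def)
  with first show ?case by simp
next
  case (inside us us' a ts)
  have "klazar_forest a us'" using inside by simp
  moreover have "\<exists>v'\<in>set us'. label v' = label v" if "v \<in> set us" for v
    using add_maximum_root_labels(1)[OF inside.hyps] that by fastforce
  ultimately show ?case using inside.prems by simp metis
next
  case (beyond ts ts' us a)
  have kl: "klazar_forest m ts'" using beyond by simp
  have us: "label v < N" if "v \<in> set us" for v
    using that beyond.prems(3) root_labels_subset[of us] by auto
  have "larger_prefix a ts' = [] \<or> (\<exists>v\<in>set us. \<forall>u\<in>set (larger_prefix a ts'). label v < label u)"
  proof (cases "larger_prefix a ts = []")
    case True
    note sub = add_maximum_larger_prefix(1)[OF beyond.hyps(1), of a]
    have "us \<noteq> []" if "larger_prefix a ts' \<noteq> []"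
      using beyond.hyps(2) add_maximum_larger_prefix(3)[OF beyond.hyps(1), of a] True that by auto
    then show ?thesis
      using us sub True by (cases us) auto
  next
    case False
    then obtain v where "v \<in> set us" "\<forall>u\<in>set (larger_prefix a ts). label v < label u"
      using beyond.prems(1) by auto
    then show ?thesis
      using add_maximum_larger_prefix(1)[OF beyond.hyps(1), of a] us by fastforce
  qed
  then show ?case using kl beyond.prems by simp
qed

text \<open>
  Conversely, the vertex with label \<open>N\<close> is a leaf, as labels increase downwards. A witnessing child
  is smaller than another label, so it is not the removed vertex.
\<close>

lemma remove_maximum:
  assumes "klazar_forest m ts'" "distinct (forest_labels ts')" "N \<in> set (forest_labels ts')"
    "\<forall>x\<in>set (forest_labels ts'). x \<le> N"
  shows "\<exists>ts. klazar_forest m ts \<and> add_maximum N ts ts'"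
  using assms
proof (induction ts' arbitrary: m rule: labelled_forest_induct)
  case (Cons a us ts)
  let ?p = "larger_prefix a ts"
  have p: "label u \<in> set (forest_labels ts)" if "u \<in> set ?p" for u
    using that root_labels_subset[of ts] by (auto simp: larger_prefix_def dest: set_takeWhileD)
  consider "a = N" | "N \<in> set (forest_labels us)" | "N \<in> set (forest_labels ts)"
    using Cons.prems(3) by auto
  then show ?case
  proof cases
    case 1
    have "us = []"
    proof (rule ccontr)
      assume "us \<noteq> []"
      then obtain u where u: "label u \<in> set (forest_labels us)"
        using root_labels_subset[of us] by (cases us) auto
      then have "a < label u" using Cons.prems(1) klazar_forest_labels[of a us] by simp
      moreover have "label u \<le> N" using Cons.prems(4) u by simp
      ultimately show False using 1 by simp
    qed
    then show ?thesis using Cons.prems(1) 1 by (auto intro: add_maximum.first)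
  next
    case 2
    then obtain us' where us': "klazar_forest a us'" "add_maximum N us' us"
      using Cons.IH(1)[of a] Cons.prems by auto
    have "\<exists>v\<in>set us'. \<forall>u\<in>set ?p. label v < label u"
      if "v \<in> set us" "\<forall>u\<in>set ?p. label v < label u" "?p \<noteq> []" for v
    proof -
      obtain u where "u \<in> set ?p" using \<open>?p \<noteq> []\<close> by (cases ?p) auto
      then have "label v < label u" "label u \<le> N" using that(2) p Cons.prems(4) by simp_all
      then have "label v < N" by simp
      then have "label v \<in> label ` set us'"
        using add_maximum_root_labels(2)[OF us'(2)] that(1) by auto
      then obtain v' where "v' \<in> set us'" "label v' = label v" by (metis imageE)
      then show ?thesis using that(2) by (intro bexI[of _ v']) simp_all
    qed
    then have "klazar_forest m (Node a us' # ts)"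
      using us' Cons.prems(1) by auto
    then show ?thesis using us' add_maximum.inside by blast
  next
    case 3
    then obtain ts' where ts': "klazar_forest m ts'" "add_maximum N ts' ts"
      using Cons.IH(2)[of m] Cons.prems by auto
    have "a < N" using 3 Cons.prems by (auto simp: order_less_le)
    then have sub: "label ` set (larger_prefix a ts') \<subseteq> label ` set ?p"
      using add_maximum_larger_prefix(2)[OF ts'(2)] by simp
    have "us \<noteq> []" if "ts = Node N [] # ts'"
      using that \<open>a < N\<close> Cons.prems(1) by (auto simp: larger_prefix_def)
    then have "add_maximum N (Node a us # ts') (Node a us # ts)"
      using ts'(2) by (intro add_maximum.beyond) auto
    moreover have "larger_prefix a ts' = [] \<or> (\<exists>v\<in>set us. \<forall>u\<in>set (larger_prefix a ts'). label v < label u)"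
    proof (cases "?p = []")
      case False
      then obtain v where v: "v \<in> set us" "\<forall>u\<in>set ?p. label v < label u"
        using Cons.prems(1) by auto
      have "label v < label u" if "u \<in> set (larger_prefix a ts')" for u
        using v(2) sub that by fastforce
      with v(1) show ?thesis by blast
    qed (use sub in simp)
    then have "klazar_forest m (Node a us # ts')"
      using ts' Cons.prems(1) by simp
    ultimately show ?thesis by blast
  qed
qed simp

lemma add_maximum_unique:
  assumes "add_maximum N ts ts'" "add_maximum N us ts'"
    "N \<notin> set (forest_labels ts)" "N \<notin> set (forest_labels us)"
  shows "ts = us"
  using assms
proof (induction arbitrary: us rule: add_maximum.induct)
  case (first ts)
  from first.prems show ?case by cases auto
next
  case (inside vs vs' a ts)
  from inside.prems(1) show ?case
  proof cases
    case (beyond ts0)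
    then show ?thesis using add_maximum_set_labels inside.prems by fastforce
  qed (use inside in auto)
next
  case (beyond ts ts' vs a)
  from beyond.prems(1) show ?case
  proof cases
    case (inside us0)
    then show ?thesis using add_maximum_set_labels beyond.prems beyond.hyps by fastforce
  qed (use beyond in auto)
qed


fun inner_vertices :: "'a ltree list \<Rightarrow> nat" where
  "inner_vertices [] = 0"
| "inner_vertices (Node a us # ts) = (if us = [] then 0 else Suc (inner_vertices us)) + inner_vertices ts"

definition growths :: "nat \<Rightarrow> nat ltree list \<Rightarrow> nat ltree list set" where
  "growths N ts = {ts'. add_maximum N ts ts'}"

lemma growths_Nil: "growths N [] = {[Node N []]}"
  by (auto simp: growths_def intro: add_maximum.intros elim: add_maximum.cases)

text \<open>
  The forest \<open>Node N [] # ts\<close> is excluded because it would place \<open>N\<close> directly to the right of a leaf.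
\<close>

lemma growths_leaf:
  "growths N (Node a [] # ts) = insert (Node N [] # Node a [] # ts)
    (insert (Node a [Node N []] # ts) ((#) (Node a []) ` (growths N ts - {Node N [] # ts})))"
proof -
  have nil: "add_maximum N [] us \<longleftrightarrow> us = [Node N []]" for us
    using growths_Nil by (auto simp: growths_def)
  have "add_maximum N (Node a [] # ts) ts' \<longleftrightarrow> ts' = Node N [] # Node a [] # ts \<or>
      ts' = Node a [Node N []] # ts \<or>
      (\<exists>us. ts' = Node a [] # us \<and> add_maximum N ts us \<and> us \<noteq> Node N [] # ts)" for ts'
    by (subst add_maximum.simps) (auto simp: nil)
  then show ?thesis
    by (auto simp: growths_def)
qed

lemma growths_Cons:
  assumes "us \<noteq> []"
  shows "growths N (Node a us # ts) = insert (Node N [] # Node a us # ts)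
    ((\<lambda>us'. Node a us' # ts) ` growths N us \<union> (#) (Node a us) ` growths N ts)"
proof -
  have "add_maximum N (Node a us # ts) ts' \<longleftrightarrow> ts' = Node N [] # Node a us # ts \<or>
      (\<exists>us'. ts' = Node a us' # ts \<and> add_maximum N us us') \<or>
      (\<exists>ts''. ts' = Node a us # ts'' \<and> add_maximum N ts ts'')" for ts'
    using assms by (subst add_maximum.simps) auto
  then show ?thesis
    by (auto simp: growths_def)
qed

lemma length_growth: "us \<in> growths N ts \<Longrightarrow> length (forest_labels us) = Suc (length (forest_labels ts))"
  unfolding growths_def mem_Collect_eq
  by (induction rule: add_maximum.induct) auto

lemma finite_growths: "finite (growths N ts)"
proof (induction ts rule: labelled_forest_induct)
  case (Cons a us ts)
  then show ?case by (cases "us = []") (simp_all add: growths_leaf growths_Cons)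
qed (simp add: growths_Nil)

text \<open>
  The allowed places of the new leaf are exactly the places that give different unlabelled trees in
  \<open>card_enlargements\<close>: the far left of a children list or directly to the right of a sibling with
  children.
\<close>

lemma card_growths:
  assumes "N \<notin> set (forest_labels ts)"
  shows "(\<forall>us\<in>growths N ts. inner_vertices us = inner_vertices ts \<or> inner_vertices us = Suc (inner_vertices ts)) \<and>
   card {us \<in> growths N ts. inner_vertices us = inner_vertices ts} = 2 * inner_vertices ts + 1 \<and>
   card {us \<in> growths N ts. inner_vertices us = Suc (inner_vertices ts)} + inner_vertices ts = length (forest_labels ts)"
  using assms
proof (induction ts rule: labelled_forest_induct)
  case Nil
  have "{us \<in> growths N []. inner_vertices us = 0} = {[Node N []]}"
    "{us \<in> growths N []. inner_vertices us = Suc 0} = {}"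
    by (auto simp: growths_Nil)
  then show ?case by (simp add: growths_Nil)
next
  case (Cons a us ts)
  let ?E = "\<lambda>ts c. {ts' \<in> growths N ts. inner_vertices ts' = c}"
  have aN: "a \<noteq> N" using Cons.prems by auto
  have ne: "us' \<noteq> []" if "us' \<in> growths N us" for us'
    using length_growth[OF that] by auto
  have ns: "us' \<noteq> us" if "us' \<in> growths N us" for us'
    using length_growth[OF that] by auto
  have fin: "finite (?E ts c)" for ts c using finite_growths by simp
  show ?case
  proof (cases "us = []")
    case True
    let ?g = "(#) (Node a [])" and ?n = "Node N [] # ts"
    have n: "?n \<in> ?E ts (inner_vertices ts)"
      by (simp add: growths_def add_maximum.first)
    have "?E (Node a us # ts) (inner_vertices ts) =
        insert (Node N [] # Node a [] # ts) (?g ` (?E ts (inner_vertices ts) - {?n}))"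
      unfolding True growths_leaf by auto
    moreover have "card (insert (Node N [] # Node a [] # ts) (?g ` (?E ts (inner_vertices ts) - {?n})))
        = Suc (card (?E ts (inner_vertices ts) - {?n}))"
      using fin aN by (subst card_insert_disjoint) (auto simp: card_image)
    moreover have "Suc (card (?E ts (inner_vertices ts) - {?n})) = card (?E ts (inner_vertices ts))"
      using fin n by (rule card_Suc_Diff1)
    moreover have "?E (Node a us # ts) (Suc (inner_vertices ts)) =
        insert (Node a [Node N []] # ts) (?g ` ?E ts (Suc (inner_vertices ts)))"
    proof -
      have "{y \<in> insert A (insert B (?g ` S)). inner_vertices y = c} =
          insert B (?g ` {x \<in> S. inner_vertices x = c})"
        if "inner_vertices A \<noteq> c" "inner_vertices B = c" for A B S c
        using that by auto
      moreover have "{x \<in> growths N ts - {?n}. inner_vertices x = Suc (inner_vertices ts)} =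
          ?E ts (Suc (inner_vertices ts))"
        using n by fastforce
      ultimately show ?thesis
        unfolding True growths_leaf by simp
    qed
    moreover have "card (insert (Node a [Node N []] # ts) (?g ` ?E ts (Suc (inner_vertices ts))))
        = Suc (card (?E ts (Suc (inner_vertices ts))))"
      using fin by (subst card_insert_disjoint) (auto simp: card_image)
    ultimately show ?thesis
      using Cons True by (auto simp: growths_leaf)
  next
    case False
    let ?f = "\<lambda>us'. Node a us' # ts" and ?g = "(#) (Node a us)"
    let ?s = "inner_vertices (Node a us # ts)"
    have rel: "\<forall>ts'\<in>growths N (Node a us # ts). inner_vertices ts' = ?s \<or> inner_vertices ts' = Suc ?s"
      using Cons False ne by (fastforce simp: growths_Cons)
    have split: "?E (Node a us # ts) (?s + i) =
        (if i = 0 then {Node N [] # Node a us # ts} else {}) \<union>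
        (?f ` ?E us (inner_vertices us + i) \<union> ?g ` ?E ts (inner_vertices ts + i))" for i
      using False ne by (auto simp: growths_Cons)
    have disj: "?f ` ?E us i \<inter> ?g ` ?E ts j = {}" for i j
      using ns by auto
    have notin: "Node N [] # Node a us # ts \<notin> ?f ` ?E us i \<union> ?g ` ?E ts j" for i j
      using aN by auto
    have both: "card (?f ` ?E us i \<union> ?g ` ?E ts j) = card (?E us i) + card (?E ts j)" for i j
      using fin disj by (subst card_Un_disjoint) (auto simp: card_image inj_on_def)
    have "card (?E (Node a us # ts) ?s) =
        Suc (card (?E us (inner_vertices us)) + card (?E ts (inner_vertices ts)))"
      using split[of 0] notin[of "inner_vertices us" "inner_vertices ts"] fin both by simp
    moreover have "card (?E (Node a us # ts) (Suc ?s)) =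
        card (?E us (Suc (inner_vertices us))) + card (?E ts (Suc (inner_vertices ts)))"
      using split[of 1] both by simp
    ultimately show ?thesis
      using Cons rel False by simp
  qed
qed

lemma klazar_forests_Suc:
  "klazar_forests (Suc n) = (\<Union>ts\<in>klazar_forests n. growths (Suc n) ts)"
proof (intro equalityI subsetI)
  fix ts' assume ts': "ts' \<in> klazar_forests (Suc n)"
  then have kl: "klazar_forest 0 ts'" "distinct (forest_labels ts')" "set (forest_labels ts') = {1..Suc n}"
    by (auto simp: klazar_forests_def)
  then obtain ts where ts: "klazar_forest 0 ts" "add_maximum (Suc n) ts ts'"
    using remove_maximum[of 0 ts' "Suc n"] by auto
  have d: "Suc n \<notin> set (forest_labels ts)" "distinct (forest_labels ts)"
    using add_maximum_distinct[OF ts(2)] kl by auto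
  have "insert (Suc n) (set (forest_labels ts)) = insert (Suc n) {1..n}"
    using add_maximum_set_labels[OF ts(2)] kl(3) by (auto simp: atLeastAtMostSuc_conv)
  then have "set (forest_labels ts) = {1..n}"
    using d(1) by (subst (asm) insert_ident) auto
  then show "ts' \<in> (\<Union>ts\<in>klazar_forests n. growths (Suc n) ts)"
    using ts d by (auto simp: klazar_forests_def growths_def)
next
  fix ts' assume "ts' \<in> (\<Union>ts\<in>klazar_forests n. growths (Suc n) ts)"
  then obtain ts where ts: "klazar_forest 0 ts" "distinct (forest_labels ts)"
      "set (forest_labels ts) = {1..n}" "add_maximum (Suc n) ts ts'"
    by (auto simp: klazar_forests_def growths_def)
  have "klazar_forest 0 ts'"
    using add_maximum_klazar_forest[OF ts(4,1)] ts(3) by simp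
  then show "ts' \<in> klazar_forests (Suc n)"
    using ts add_maximum_distinct[OF ts(4)] add_maximum_set_labels[OF ts(4)]
    by (simp add: klazar_forests_def atLeastAtMostSuc_conv)
qed

theorem card_klazar_trees:
  "finite (klazar_trees n) \<and> card (klazar_trees n) = half_fubini_number n"
proof -
  have "finite (klazar_forests n) \<and> card (klazar_forests n) = half_fubini_number n"
  proof (rule card_generating_tree[where offspring = "\<lambda>n. growths (Suc n)" and k = inner_vertices])
    show "klazar_forests (Suc n) = (\<Union>ts\<in>klazar_forests n. growths (Suc n) ts)" for n
      by (rule klazar_forests_Suc)
    have "ts = []" if "set (forest_labels ts) = {}" for ts :: "nat ltree list"
      using that root_labels_subset[of ts] by auto
    then show "klazar_forests 0 = {[]}"
      by (auto simp: klazar_forests_def)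
    show "inner_vertices [] = 0" by simp
  next
    fix n ts us assume ts: "ts \<in> klazar_forests n"
    then have N: "Suc n \<notin> set (forest_labels ts)" by (simp add: klazar_forests_def)
    have "length (forest_labels ts) = n"
      using ts distinct_card[of "forest_labels ts"] by (simp add: klazar_forests_def)
    then show "card {us \<in> growths (Suc n) ts. inner_vertices us = inner_vertices ts} = 2 * inner_vertices ts + 1"
      "card {us \<in> growths (Suc n) ts. inner_vertices us = Suc (inner_vertices ts)} + inner_vertices ts = n"
      using card_growths[OF N] by auto
    show "us \<in> growths (Suc n) ts \<Longrightarrow>
        inner_vertices us = inner_vertices ts \<or> inner_vertices us = Suc (inner_vertices ts)"
      using card_growths[OF N] by blast
    show "finite (growths (Suc n) ts)" by (rule finite_growths)
    assume us: "us \<in> klazar_forests n" "ts \<noteq> us"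
    then have "Suc n \<notin> set (forest_labels us)" by (simp add: klazar_forests_def)
    then show "growths (Suc n) ts \<inter> growths (Suc n) us = {}"
      using N us(2) add_maximum_unique unfolding growths_def by blast
  qed
  then show ?thesis
    by (simp add: klazar_trees_eq card_image inj_on_def)
qed

section \<open>Ordered partitions\<close>

text \<open>
  The product formula for exponential generating functions: choosing a structure of one kind on a subset
  and a structure of another kind on its complement.
\<close>

lemma sum_Pow_egf_product:
  fixes a b :: "real fps"
  assumes "finite S"
  shows "(\<Sum>A\<in>Pow S. (fact (card A) * fps_nth a (card A)) * (fact (card (S - A)) * fps_nth b (card (S - A))))
    = fact (card S) * fps_nth (a * b) (card S)"
proof -
  let ?n = "card S"
  let ?h = "\<lambda>k. (fact k * fps_nth a k) * (fact (?n - k) * fps_nth b (?n - k))"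
  have "(\<Sum>A\<in>Pow S. (fact (card A) * fps_nth a (card A)) * (fact (card (S - A)) * fps_nth b (card (S - A))))
      = (\<Sum>A\<in>Pow S. ?h (card A))"
    using assms by (intro sum.cong) (auto simp: card_Diff_subset finite_subset)
  also have "\<dots> = (\<Sum>k\<in>{0..?n}. \<Sum>A\<in>{A \<in> Pow S. card A = k}. ?h (card A))"
    using assms by (intro sum.group[symmetric]) (auto simp: card_mono)
  also have "\<dots> = (\<Sum>k\<in>{0..?n}. real (?n choose k) * ?h k)"
  proof (intro sum.cong refl)
    fix k
    have "(\<Sum>A\<in>{A \<in> Pow S. card A = k}. ?h (card A)) = (\<Sum>A\<in>{A \<in> Pow S. card A = k}. ?h k)"
      by (intro sum.cong) auto
    also have "card {A \<in> Pow S. card A = k} = ?n choose k"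
      using n_subsets[OF assms, of k] by simp
    then have "(\<Sum>A\<in>{A \<in> Pow S. card A = k}. ?h k) = real (?n choose k) * ?h k" by simp
    finally show "(\<Sum>A\<in>{A \<in> Pow S. card A = k}. ?h (card A)) = real (?n choose k) * ?h k" .
  qed
  also have "\<dots> = (\<Sum>k\<in>{0..?n}. fact ?n * (fps_nth a k * fps_nth b (?n - k)))"
    by (intro sum.cong refl) (simp add: binomial_fact)
  finally show ?thesis
    by (simp add: fps_mult_nth sum_distrib_left)
qed

definition ordered_partitions_of :: "'a set \<Rightarrow> 'a set list set" where
  "ordered_partitions_of S = {As. distinct As \<and> partition_on S (set As)}"

lemma Nil_ordered_partition [simp]: "[] \<in> ordered_partitions_of S \<longleftrightarrow> S = {}"
  by (auto simp: ordered_partitions_of_def partition_on_def)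

lemma Cons_ordered_partition [simp]:
  "A # As \<in> ordered_partitions_of S \<longleftrightarrow> A \<noteq> {} \<and> A \<subseteq> S \<and> As \<in> ordered_partitions_of (S - A)"
    (is "?l \<longleftrightarrow> ?r")
proof
  assume l: ?l
  then have "\<Union>(set As) \<union> A = S" "disjoint (insert A (set As))" "{} \<notin> insert A (set As)" "A \<notin> set As" "distinct As"
    by (auto simp: ordered_partitions_of_def partition_on_def)
  moreover from this have "disjoint (set As)" "\<Union>(set As) \<inter> A = {}"
    unfolding disjoint_def by auto
  ultimately show ?r
    by (auto simp: ordered_partitions_of_def partition_on_def)
next
  assume r: ?r
  then have "\<Union>(set As) = S - A" "disjoint (set As)" "{} \<notin> set As" "distinct As"
    by (auto simp: ordered_partitions_of_def partition_on_def)
  moreover from this r have "A \<notin> set As" by blast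
  moreover from calculation have "disjoint (insert A (set As))"
    unfolding disjoint_def by blast
  ultimately show ?l using r
    by (auto simp: ordered_partitions_of_def partition_on_def)
qed

lemma ordered_partitions_of_eq:
  assumes "S \<noteq> {}"
  shows "ordered_partitions_of S = (\<Union>A\<in>Pow S - {{}}. (#) A ` ordered_partitions_of (S - A))"
proof -
  have "As \<in> ordered_partitions_of S \<longleftrightarrow> As \<in> (\<Union>A\<in>Pow S - {{}}. (#) A ` ordered_partitions_of (S - A))" for As
    using assms by (cases As) auto
  then show ?thesis by (rule set_eqI)
qed

lemma fubini_unfold: "fubini = 1 + (fps_exp 1 - 1) * fubini"
  using fubini_inverse by (simp add: algebra_simps)

text \<open>
  Splitting off the first block, a nonempty set, gives \<open>F = 1 + (e^x - 1) F\<close>.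
\<close>

lemma card_ordered_partitions:
  assumes "finite S"
  shows "finite (ordered_partitions_of S) \<and>
    real (card (ordered_partitions_of S)) = fact (card S) * fps_nth fubini (card S)"
  using assms
proof (induction S rule: finite_psubset_induct)
  case (psubset S)
  show ?case
  proof (cases "S = {}")
    case True
    have "ordered_partitions_of S = {[]}"
    proof -
      have "As \<in> ordered_partitions_of {} \<longleftrightarrow> As = []" for As :: "'a set list" by (cases As) auto
      then show ?thesis using True by auto
    qed
    then show ?thesis using True by simp
  next
    case False
    let ?P = "Pow S - {{}}"
    have IH: "finite (ordered_partitions_of (S - A)) \<and>
        real (card (ordered_partitions_of (S - A))) = fact (card (S - A)) * fps_nth fubini (card (S - A))"
      if "A \<in> ?P" for A
      using that by (intro psubset.IH) auto
    have "card (ordered_partitions_of S) = (\<Sum>A\<in>?P. card ((#) A ` ordered_partitions_of (S - A)))"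
      unfolding ordered_partitions_of_eq[OF False]
      using psubset.hyps IH by (intro card_UN_disjoint) auto
    then have "real (card (ordered_partitions_of S)) =
        (\<Sum>A\<in>?P. fact (card (S - A)) * fps_nth fubini (card (S - A)))"
      using IH by (simp add: card_image)
    also have "\<dots> = (\<Sum>A\<in>Pow S. (fact (card A) * fps_nth (fps_exp 1 - 1) (card A)) *
        (fact (card (S - A)) * fps_nth fubini (card (S - A))))"
      \<comment> \<open>the factor \<open>fps_exp 1 - 1\<close> has coefficient \<open>0\<close> at the empty block and \<open>1 / k!\<close> otherwise\<close>
      using psubset.hyps by (intro sum.mono_neutral_cong_left) (auto simp: card_eq_0_iff dest: finite_subset)
    also have "\<dots> = fact (card S) * fps_nth ((fps_exp 1 - 1) * fubini) (card S)"
      by (rule sum_Pow_egf_product[OF psubset.hyps])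
    also have "\<dots> = fact (card S) * fps_nth fubini (card S)"
      using False psubset.hyps by (subst (2) fubini_unfold) (simp add: card_eq_0_iff)
    finally show ?thesis
      using psubset.hyps IH by (simp add: ordered_partitions_of_eq[OF False])
  qed
qed

section \<open>Signed words\<close>

text \<open>
  An entry of a word is a number together with a flag that is true for a positive sign.
\<close>

definition descending :: "(nat \<times> bool) list \<Rightarrow> bool" where
  "descending = successively (\<lambda>x y. snd x = snd y \<longrightarrow> fst y < fst x)"

definition signed_words :: "nat set \<Rightarrow> (nat \<times> bool) list set" where
  "signed_words S = {w. distinct (map fst w) \<and> set (map fst w) = S \<and> descending w}"

definition signed_words_from :: "bool \<Rightarrow> nat set \<Rightarrow> (nat \<times> bool) list set" where
  "signed_words_from s S = {w \<in> signed_words S. w = [] \<or> snd (hd w) = s}"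

text \<open>
  The inverse of cutting a descending word with first sign \<open>s\<close> into its maximal runs of equal sign.
\<close>

fun word_of_blocks :: "bool \<Rightarrow> nat set list \<Rightarrow> (nat \<times> bool) list" where
  "word_of_blocks s [] = []"
| "word_of_blocks s (A # As) = map (\<lambda>a. (a, s)) (rev (sorted_list_of_set A)) @ word_of_blocks (\<not> s) As"

lemma descending_append:
  "descending (u @ v) \<longleftrightarrow> descending u \<and> descending v \<and>
     (u = [] \<or> v = [] \<or> (snd (last u) = snd (hd v) \<longrightarrow> fst (hd v) < fst (last u)))"
  unfolding descending_def by (auto simp: successively_append_iff)

lemma descending_Cons:
  "descending (x # v) \<longleftrightarrow> descending v \<and> (v = [] \<or> (snd x = snd (hd v) \<longrightarrow> fst (hd v) < fst x))"
  unfolding descending_def by (cases v) auto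

lemma sorted_wrt_greater_rev_sorted_list_of_set:
  "sorted_wrt (>) (rev (sorted_list_of_set (A :: nat set)))"
  by (simp add: sorted_wrt_rev)

lemma descending_block:
  "sorted_wrt (>) xs \<Longrightarrow> descending (map (\<lambda>a. (a, s)) xs)"
proof (induction xs)
  case (Cons a xs)
  then show ?case by (cases xs) (auto simp: descending_Cons)
qed (simp add: descending_def)

lemma word_of_blocks_signed_words:
  assumes "As \<in> ordered_partitions_of S" "finite S"
  shows "word_of_blocks s As \<in> signed_words_from s S"
  using assms
proof (induction As arbitrary: s S)
  case Nil
  then show ?case by (simp add: signed_words_from_def signed_words_def descending_def)
next
  case (Cons A As)
  then have A: "A \<noteq> {}" "A \<subseteq> S" "finite A" and As: "As \<in> ordered_partitions_of (S - A)"
    by (auto intro: finite_subset)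
  let ?u = "map (\<lambda>a. (a, s)) (rev (sorted_list_of_set A))" and ?v = "word_of_blocks (\<not> s) As"
  have v: "?v \<in> signed_words_from (\<not> s) (S - A)"
    using Cons.IH[OF As] Cons.prems by simp
  have u: "?u \<noteq> []" using A by (simp add: sorted_list_of_set_eq_Nil_iff)
  have lu: "snd (last ?u) = s" "snd (hd ?u) = s"
    using last_in_set[OF u] hd_in_set[OF u] by auto
  have "descending (?u @ ?v)"
    using v u lu descending_block[OF sorted_wrt_greater_rev_sorted_list_of_set]
    unfolding descending_append signed_words_from_def signed_words_def by auto
  moreover have "distinct (map fst (?u @ ?v))" "set (map fst (?u @ ?v)) = S"
    using v A by (auto simp: signed_words_from_def signed_words_def comp_def)
  ultimately have "?u @ ?v \<in> signed_words S"
    by (simp only: signed_words_def mem_Collect_eq)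
  then show ?case
    by (simp only: word_of_blocks.simps signed_words_from_def mem_Collect_eq hd_append2[OF u] lu simp_thms)
qed

text \<open>
  The first block can be recovered as the first maximal run of equal signs.
\<close>

lemma takeWhile_word_of_blocks:
  assumes "A # As \<in> ordered_partitions_of S" "finite S"
  shows "takeWhile (\<lambda>x. snd x = s) (word_of_blocks s (A # As)) = map (\<lambda>a. (a, s)) (rev (sorted_list_of_set A))"
proof -
  have "word_of_blocks (\<not> s) As \<in> signed_words_from (\<not> s) (S - A)"
    using assms by (intro word_of_blocks_signed_words) auto
  then have "takeWhile (\<lambda>x. snd x = s) (word_of_blocks (\<not> s) As) = []"
    by (cases "word_of_blocks (\<not> s) As") (auto simp: signed_words_from_def)
  then show ?thesis unfolding word_of_blocks.simps by (subst takeWhile_append2) auto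
qed

lemma word_of_blocks_inject:
  assumes "As \<in> ordered_partitions_of S" "Bs \<in> ordered_partitions_of S" "finite S"
    and "word_of_blocks s As = word_of_blocks s Bs"
  shows "As = Bs"
  using assms
proof (induction As arbitrary: Bs s S)
  case Nil
  then show ?case by (cases Bs) auto
next
  case (Cons A As)
  obtain B Bs' where Bs: "Bs = B # Bs'" using Cons.prems by (cases Bs) auto
  have "map (\<lambda>a. (a, s)) (rev (sorted_list_of_set A)) = map (\<lambda>a. (a, s)) (rev (sorted_list_of_set B))"
    using takeWhile_word_of_blocks[of A As S s] takeWhile_word_of_blocks[of B Bs' S s] Cons.prems Bs
    by simp
  then have "sorted_list_of_set A = sorted_list_of_set B"
    by (subst (asm) inj_map_eq_map) (auto simp: inj_on_def)
  moreover have "finite A" "finite B" using Cons.prems Bs by (auto intro: finite_subset)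
  ultimately have "A = B" by (metis sorted_list_of_set.set_sorted_key_list_of_set)
  then show ?case using Cons.IH[of "S - A" Bs' "\<not> s"] Cons.prems Bs by simp
qed

lemma sorted_le_last: "sorted xs \<Longrightarrow> b \<in> set xs \<Longrightarrow> b \<le> last xs"
  by (induction xs) auto

lemma word_of_blocks_surj:
  assumes "w \<in> signed_words_from s S" "finite S"
  shows "\<exists>As\<in>ordered_partitions_of S. word_of_blocks s As = w"
  using assms
proof (induction w arbitrary: s S)
  case Nil
  then show ?case by (intro bexI[of _ "[]"]) (auto simp: signed_words_from_def signed_words_def)
next
  case (Cons x w)
  obtain a where x: "x = (a, s)"
    using Cons.prems by (cases x) (simp add: signed_words_from_def)
  have a: "a \<in> S" and w: "w \<in> signed_words (S - {a})"
    and desc: "w = [] \<or> (s = snd (hd w) \<longrightarrow> fst (hd w) < a)"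
    using Cons.prems by (auto simp: signed_words_from_def signed_words_def descending_Cons x)
  have "w \<in> signed_words_from (if w = [] then \<not> s else snd (hd w)) (S - {a})"
    using w by (auto simp: signed_words_from_def)
  with Cons.IH Cons.prems(2) obtain As where As: "As \<in> ordered_partitions_of (S - {a})"
      "word_of_blocks (if w = [] then \<not> s else snd (hd w)) As = w"
    by blast
  show ?case
  proof (cases "w = [] \<or> snd (hd w) \<noteq> s")
    case True
    then have "word_of_blocks (\<not> s) As = w" using As(2) by (auto split: if_splits)
    then show ?thesis
      using As a x by (intro bexI[of _ "{a} # As"]) auto
  next
    case False
    then have wAs: "word_of_blocks s As = w" using As(2) by auto
    then obtain A As' where AAs: "As = A # As'" using False by (cases As) auto
    have A: "A \<noteq> {}" "A \<subseteq> S - {a}" "finite A" "As' \<in> ordered_partitions_of (S - {a} - A)"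
      using As(1) AAs Cons.prems(2) by (auto intro: finite_subset)
    have ne: "sorted_list_of_set A \<noteq> []" using A by (simp add: sorted_list_of_set_eq_Nil_iff)
    have hd: "fst (hd w) = last (sorted_list_of_set A)"
      using wAs[symmetric] ne by (simp add: AAs hd_append hd_map hd_rev)
    have "\<forall>b\<in>A. b < a"
    proof
      fix b assume "b \<in> A"
      then have "b \<le> last (sorted_list_of_set A)"
        using A(3) by (intro sorted_le_last) auto
      then show "b < a" using desc False hd by simp
    qed
    then have "sorted_list_of_set (insert a A) = sorted_list_of_set A @ [a]"
    proof -
      have "a \<notin> A" using A(2) by blast
      then have "sorted_list_of_set (insert a A) = insort a (sorted_list_of_set A)"
        using A(3) by simp
      also have "\<dots> = sorted_list_of_set A @ [a]"
        using \<open>\<forall>b\<in>A. b < a\<close> A(3) by (intro sorted_insort_is_snoc) auto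
      finally show ?thesis .
    qed
    then have "word_of_blocks s (insert a A # As') = x # w"
      using wAs by (simp add: AAs x)
    moreover have "insert a A # As' \<in> ordered_partitions_of S"
      using A a by (auto simp: Diff_insert2[symmetric])
    ultimately show ?thesis by blast
  qed
qed

lemma bij_betw_word_of_blocks:
  assumes "finite S"
  shows "bij_betw (word_of_blocks s) (ordered_partitions_of S) (signed_words_from s S)"
  unfolding bij_betw_def inj_on_def
  using word_of_blocks_inject word_of_blocks_signed_words word_of_blocks_surj assms by blast

text \<open>
  The argument \<open>M\<close> collects the numbers read so far, so that the condition concerns the left-to-right
  minima of the whole word.
\<close>

fun positive_records :: "nat set \<Rightarrow> (nat \<times> bool) list \<Rightarrow> bool" where
  "positive_records M [] \<longleftrightarrow> True"
| "positive_records M (x # w) \<longleftrightarrow>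
     ((\<forall>m\<in>M. fst x < m) \<longrightarrow> snd x) \<and> positive_records (insert (fst x) M) w"

definition good_words :: "nat set \<Rightarrow> (nat \<times> bool) list set" where
  "good_words S = {w \<in> signed_words S. positive_records {} w}"

lemma positive_records_append:
  "positive_records M (u @ v) \<longleftrightarrow> positive_records M u \<and> positive_records (M \<union> fst ` set u) v"
  by (induction u arbitrary: M) auto

lemma positive_records_below:
  "m \<in> M \<Longrightarrow> \<forall>x\<in>fst ` set w. m < x \<Longrightarrow> positive_records M w"
  by (induction w arbitrary: M) fastforce+

text \<open>
  The new minimum \<open>m\<close> is a left-to-right minimum, hence positive, and nothing behind it is one, so
  the part behind it is arbitrary except for its first sign: it must be negative, because no number
  smaller than \<open>m\<close> is left. In front of \<open>m\<close> stands a good word on any subset.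
\<close>

lemma good_words_insert_minimum:
  assumes S: "\<forall>x\<in>S. m < x"
  shows "bij_betw (\<lambda>(T, u, v). u @ (m, True) # v)
    (SIGMA T:Pow S. good_words T \<times> signed_words_from False (S - T)) (good_words (insert m S))"
proof -
  let ?f = "\<lambda>(T :: nat set, u :: (nat \<times> bool) list, v :: (nat \<times> bool) list). u @ (m, True) # v"
  let ?D = "SIGMA T:Pow S. good_words T \<times> signed_words_from False (S - T)"
  have m: "m \<notin> S" using S by blast
  have "inj_on ?f ?D"
  proof (rule inj_onI)
    fix x y assume x: "x \<in> ?D" and y: "y \<in> ?D" and eq: "?f x = ?f y"
    obtain T u v T' u' v' where xy: "x = (T, u, v)" "y = (T', u', v')" by (metis prod.exhaust)
    have T: "T = fst ` set u" "T' = fst ` set u'"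
      using x y by (auto simp: xy good_words_def signed_words_def)
    have "(m, True) \<notin> set u" "(m, True) \<notin> set v"
      using x m unfolding xy good_words_def signed_words_from_def signed_words_def by force+
    then have "u = u' \<and> v = v'"
      using eq by (simp add: xy append_Cons_eq_iff)
    then show "x = y" using T xy by simp
  qed
  moreover have "?f x \<in> good_words (insert m S)" if "x \<in> ?D" for x
  proof -
    obtain T u v where x: "x = (T, u, v)" by (metis prod.exhaust)
    have T: "T \<subseteq> S" and u: "distinct (map fst u)" "fst ` set u = T" "descending u" "positive_records {} u"
      and v: "distinct (map fst v)" "fst ` set v = S - T" "descending v" "v = [] \<or> \<not> snd (hd v)"
      using that by (auto simp: x good_words_def signed_words_from_def signed_words_def)
    have "u = [] \<or> m < fst (last u)"
      using u(2) T S imageI[OF last_in_set[of u], of fst] by (cases "u = []") auto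
    then have "descending (u @ (m, True) # v)"
      using u v by (auto simp: descending_append descending_Cons)
    moreover have "positive_records (insert m (fst ` set u)) v"
      using S v(2) by (intro positive_records_below[of m]) auto
    then have "positive_records {} (u @ (m, True) # v)"
      using u(4) by (simp add: positive_records_append)
    moreover have "distinct (map fst (u @ (m, True) # v))" "set (map fst (u @ (m, True) # v)) = insert m S"
      using u v T m by auto
    ultimately show ?thesis
      by (simp add: x good_words_def signed_words_def image_Un)
  qed
  moreover have "w \<in> ?f ` ?D" if w: "w \<in> good_words (insert m S)" for w
  proof -
    have wp: "distinct (map fst w)" "fst ` set w = insert m S" "descending w" "positive_records {} w"
      using w by (auto simp: good_words_def signed_words_def)
    then obtain s where "(m, s) \<in> set w" by force
    then obtain u v where uv: "w = u @ (m, s) # v" by (meson split_list)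
    let ?T = "fst ` set u"
    have dj: "m \<notin> fst ` set u" "m \<notin> fst ` set v" "fst ` set u \<inter> fst ` set v = {}"
      "distinct (map fst u)" "distinct (map fst v)"
      using wp(1) by (auto simp: uv)
    have un: "insert m (fst ` set u \<union> fst ` set v) = insert m S"
      using wp(2) by (simp add: uv image_Un)
    then have "fst ` set u \<union> fst ` set v = S"
      using dj(1,2) m by (subst (asm) insert_ident) auto
    then have T: "?T \<subseteq> S" and v: "fst ` set v = S - ?T"
      using dj(3) by auto
    have s: s
      using wp(4) T S by (auto simp: uv positive_records_append)
    have "v = [] \<or> \<not> snd (hd v)"
    proof (cases v)
      case (Cons y v')
      then have "fst y \<in> S" using v by auto
      then show ?thesis using wp(3) S s by (auto simp: uv Cons descending_append descending_Cons)
    qed simp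
    then have "(?T, u, v) \<in> ?D"
      using T v dj wp by (auto simp: uv good_words_def signed_words_from_def signed_words_def
          descending_append descending_Cons positive_records_append)
    then show ?thesis using uv s by (intro image_eqI[of _ _ "(?T, u, v)"]) simp_all
  qed
  ultimately show ?thesis
    unfolding bij_betw_def by blast
qed

text \<open>
  By \<open>good_words_insert_minimum\<close> the generating function \<open>g\<close> satisfies \<open>g' = g * fubini\<close>, which is the
  differential equation of \<open>half_fubini\<close>.
\<close>

lemma card_good_words:
  assumes "finite S"
  shows "finite (good_words S) \<and> card (good_words S) = half_fubini_number (card S)"
proof -
  have "finite (good_words S) \<and> real (card (good_words S)) = fact (card S) * fps_nth half_fubini (card S)"
    using assms
  proof (induction "card S" arbitrary: S rule: less_induct)
    case less
    show ?case
    proof (cases "S = {}")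
      case True
      have "good_words {} = {[]}"
        by (auto simp: good_words_def signed_words_def descending_def)
      then show ?thesis using True by simp
    next
      case False
      define m where "m = Min S"
      define R where "R = S - {m}"
      have "m \<in> S" using False less.prems by (simp add: m_def)
      then have S: "S = insert m R" "card S = Suc (card R)" and fR: "finite R"
        using less.prems card.remove[of S m] by (auto simp: R_def)
      have "\<forall>x\<in>R. m < x"
        using less.prems by (auto simp: R_def m_def order_less_le)
      note bij = good_words_insert_minimum[OF this]
      let ?D = "SIGMA T:Pow R. good_words T \<times> signed_words_from False (R - T)"
      have neg: "finite (signed_words_from False (R - T)) \<and>
          real (card (signed_words_from False (R - T))) = fact (card (R - T)) * fps_nth fubini (card (R - T))" for T
        using card_ordered_partitions[of "R - T"] bij_betw_word_of_blocks[of "R - T" False] fR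
          bij_betw_finite bij_betw_same_card by (metis finite_Diff)
      have pos: "finite (good_words T) \<and> real (card (good_words T)) = fact (card T) * fps_nth half_fubini (card T)"
        if "T \<in> Pow R" for T
      proof (rule less.hyps)
        show "card T < card S" using that fR S(2) by (auto simp: less_Suc_eq_le card_mono)
        show "finite T" using that fR by (auto intro: finite_subset)
      qed
      have "card (good_words S) = card ?D"
        using bij_betw_same_card[OF bij] S(1) by simp
      also have "\<dots> = (\<Sum>T\<in>Pow R. card (good_words T \<times> signed_words_from False (R - T)))"
        using fR pos neg by (intro card_SigmaI) auto
      finally have "real (card (good_words S)) = (\<Sum>T\<in>Pow R. (fact (card T) * fps_nth half_fubini (card T)) *
          (fact (card (R - T)) * fps_nth fubini (card (R - T))))"
        using pos neg by (simp add: card_cartesian_product)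
      also have "\<dots> = fact (card R) * fps_nth (fps_deriv half_fubini) (card R)"
        unfolding half_fubini_deriv by (rule sum_Pow_egf_product[OF fR])
      also have "\<dots> = fact (card S) * fps_nth half_fubini (card S)"
        using S(2) by simp
      moreover have "finite (good_words S)"
        using bij_betw_finite[OF bij] S(1) fR pos neg by auto
      ultimately show ?thesis by simp
    qed
  qed
  then show ?thesis
    by (simp flip: half_fubini_number_egf)
qed

section \<open>Signed permutations\<close>

definition word_of_signed_permutation :: "nat list \<times> (nat \<Rightarrow> int) \<Rightarrow> (nat \<times> bool) list" where
  "word_of_signed_permutation p = map (\<lambda>a. (a, snd p a = 1)) (fst p)"

definition sign_of_word :: "nat \<Rightarrow> (nat \<times> bool) list \<Rightarrow> nat \<Rightarrow> int" where
  "sign_of_word n w = (\<lambda>i\<in>{1..n}. if (i, True) \<in> set w then 1 else - 1)"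

text \<open>
  The minimum of a prefix has to be examined only when the last entry is a new minimum; this turns the
  condition on all prefix minima into one on records.
\<close>

lemma positive_minima_snoc:
  "positive_minima (as @ [a]) \<sigma> \<longleftrightarrow>
     positive_minima as \<sigma> \<and> ((\<forall>b\<in>set as. a < b) \<longrightarrow> \<sigma> a = 1)"
proof -
  have "positive_minima (as @ [a]) \<sigma> \<longleftrightarrow> positive_minima as \<sigma> \<and> \<sigma> (Min (insert a (set as))) = 1"
  proof -
    have "{1..Suc (length as)} = insert (Suc (length as)) {1..length as}" by auto
    then show ?thesis unfolding positive_minima_def by auto
  qed
  moreover have "\<sigma> (Min (insert a (set as))) = 1 \<longleftrightarrow> ((\<forall>b\<in>set as. a < b) \<longrightarrow> \<sigma> a = 1)"
    if "positive_minima as \<sigma>"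
  proof (cases "as = []")
    case False
    define M where "M = Min (set as)"
    have "\<sigma> M = 1"
      using that False unfolding positive_minima_def M_def
      by (auto dest!: bspec[of _ _ "length as"] simp: Suc_le_eq)
    moreover have "(\<forall>b\<in>set as. a < b) \<longleftrightarrow> a < M" "Min (insert a (set as)) = min a M"
      using False by (simp_all add: M_def)
    ultimately show ?thesis
      by (cases a M rule: linorder_cases) (auto simp: min_def)
  qed simp
  ultimately show ?thesis by blast
qed

lemma positive_minima_iff_records:
  assumes "distinct as"
  shows "positive_minima as \<sigma> \<longleftrightarrow> positive_records {} (map (\<lambda>a. (a, \<sigma> a = 1)) as)"
  using assms
proof (induction as rule: rev_induct)
  case (snoc a as)
  then show ?case
    by (subst positive_minima_snoc) (auto simp: positive_records_append image_image)
qed (simp add: positive_minima_def)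

lemma decreasing_blocks_iff_descending:
  assumes "\<forall>a\<in>set as. \<sigma> a \<in> {1, - 1}"
  shows "decreasing_blocks as \<sigma> \<longleftrightarrow> descending (map (\<lambda>a. (a, \<sigma> a = 1)) as)"
proof -
  have "\<sigma> (as ! i) = \<sigma> (as ! Suc i) \<longleftrightarrow> (\<sigma> (as ! i) = 1) = (\<sigma> (as ! Suc i) = 1)"
    if "Suc i < length as" for i
  proof -
    have "\<sigma> (as ! i) \<in> {1, - 1}" "\<sigma> (as ! Suc i) \<in> {1, - 1}"
      using that assms by simp_all
    then show ?thesis by auto
  qed
  then show ?thesis
    by (auto simp: decreasing_blocks_def descending_def successively_conv_nth)
qed

lemma word_of_signed_permutation_good:
  assumes "p \<in> signed_permutations n"
  shows "word_of_signed_permutation p \<in> good_words {1..n} \<longleftrightarrow> p \<in> signed_permutations_pos_minima n"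
proof -
  obtain as \<sigma> where p: "p = (as, \<sigma>)" by (cases p)
  have as: "set as = {1..n}" "distinct as" and \<sigma>: "\<sigma> \<in> {1..n} \<rightarrow>\<^sub>E {1, - 1}"
    using assms by (auto simp: p signed_permutations_def permutations_of_set_def)
  have "\<forall>a\<in>set as. \<sigma> a \<in> {1, - 1}"
    unfolding as(1) using PiE_mem[OF \<sigma>] by blast
  note eq = decreasing_blocks_iff_descending[OF this] positive_minima_iff_records[OF as(2), of \<sigma>]
  have m: "map fst (map (\<lambda>a. (a, \<sigma> a = 1)) as) = as"
    by (simp add: comp_def)
  show ?thesis
    unfolding p word_of_signed_permutation_def fst_conv snd_conv good_words_def signed_words_def
      signed_permutations_pos_minima_def mem_Collect_eq m case_prod_conv eq
    using assms[unfolded p] as by blast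
qed

lemma bij_betw_word_of_signed_permutation:
  "bij_betw word_of_signed_permutation (signed_permutations_pos_minima n) (good_words {1..n})"
proof (rule bij_betw_byWitness[where f' = "\<lambda>w. (map fst w, sign_of_word n w)"])
  have sub: "signed_permutations_pos_minima n \<subseteq> signed_permutations n"
    by (auto simp: signed_permutations_pos_minima_def)
  show "word_of_signed_permutation ` signed_permutations_pos_minima n \<subseteq> good_words {1..n}"
  proof (rule image_subsetI)
    fix p assume p: "p \<in> signed_permutations_pos_minima n"
    then show "word_of_signed_permutation p \<in> good_words {1..n}"
      using word_of_signed_permutation_good[of p n] sub by (simp add: subsetD)
  qed
  have inverse_word: "(map fst w, sign_of_word n w) \<in> signed_permutations n"
    "word_of_signed_permutation (map fst w, sign_of_word n w) = w" if "w \<in> good_words {1..n}" for w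
  proof -
    have w: "distinct (map fst w)" "fst ` set w = {1..n}"
      using that by (auto simp: good_words_def signed_words_def)
    then show "(map fst w, sign_of_word n w) \<in> signed_permutations n"
      by (auto simp: signed_permutations_def permutations_of_set_def sign_of_word_def)
    have "(sign_of_word n w (fst x) = 1) = snd x" if x: "x \<in> set w" for x
    proof -
      have "fst x \<in> {1..n}" using x w(2) by blast
      moreover have "(fst x, True) \<in> set w \<longleftrightarrow> snd x"
      proof
        assume "(fst x, True) \<in> set w"
        then show "snd x" using w(1) x by (metis distinct_map fst_conv inj_onD snd_conv)
      next
        assume "snd x"
        then have "x = (fst x, True)" by (simp add: prod_eq_iff)
        then show "(fst x, True) \<in> set w" using x by simp
      qed
      ultimately show ?thesis by (simp add: sign_of_word_def)
    qed
    then show "word_of_signed_permutation (map fst w, sign_of_word n w) = w"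
      unfolding word_of_signed_permutation_def fst_conv snd_conv map_map
      by (intro map_idI) simp
  qed
  have "(map fst w, sign_of_word n w) \<in> signed_permutations_pos_minima n" if "w \<in> good_words {1..n}" for w
    using word_of_signed_permutation_good[OF inverse_word(1)[OF that]] inverse_word(2)[OF that] that by simp
  then show "(\<lambda>w. (map fst w, sign_of_word n w)) ` good_words {1..n} \<subseteq> signed_permutations_pos_minima n"
    by (rule image_subsetI)
  show "\<forall>w\<in>good_words {1..n}. word_of_signed_permutation (map fst w, sign_of_word n w) = w"
    using inverse_word by blast
  show "\<forall>p\<in>signed_permutations_pos_minima n.
      (map fst (word_of_signed_permutation p), sign_of_word n (word_of_signed_permutation p)) = p"
  proof
    fix p assume "p \<in> signed_permutations_pos_minima n"
    then obtain as \<sigma> where p: "p = (as, \<sigma>)" and as: "set as = {1..n}" and \<sigma>: "\<sigma> \<in> {1..n} \<rightarrow>\<^sub>E {1, - 1}"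
      by (auto simp: signed_permutations_pos_minima_def signed_permutations_def permutations_of_set_def)
    have "sign_of_word n (word_of_signed_permutation p) = \<sigma>"
    proof
      fix i
      show "sign_of_word n (word_of_signed_permutation p) i = \<sigma> i"
      proof (cases "i \<in> {1..n}")
        case True
        then have "(i, True) \<in> set (word_of_signed_permutation p) \<longleftrightarrow> \<sigma> i = 1"
          using as by (auto simp: p word_of_signed_permutation_def)
        then show ?thesis using True PiE_mem[OF \<sigma> True] by (auto simp: sign_of_word_def)
      next
        case False
        then show ?thesis unfolding sign_of_word_def restrict_def PiE_arb[OF \<sigma> False] by auto
      qed
    qed
    moreover have "map fst (word_of_signed_permutation p) = as"
      by (simp add: p word_of_signed_permutation_def comp_def)
    ultimately show "(map fst (word_of_signed_permutation p), sign_of_word n (word_of_signed_permutation p)) = p"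
      using p by simp
  qed
qed

theorem card_signed_permutations_pos_minima:
  "finite (signed_permutations_pos_minima n) \<and>
   card (signed_permutations_pos_minima n) = half_fubini_number n"
  using bij_betw_finite[OF bij_betw_word_of_signed_permutation[of n]]
    bij_betw_same_card[OF bij_betw_word_of_signed_permutation[of n]] card_good_words[of "{1..n}"]
  by simp

section \<open>Ordered partitions with minima at odd locations\<close>

fun positive_block_records :: "bool \<Rightarrow> nat set \<Rightarrow> nat set list \<Rightarrow> bool" where
  "positive_block_records s M [] \<longleftrightarrow> True"
| "positive_block_records s M (A # As) \<longleftrightarrow>
     ((\<forall>m\<in>M. Min A < m) \<longrightarrow> s) \<and> positive_block_records (\<not> s) (M \<union> A) As"

text \<open>
  In a decreasing run, earlier entries never prevent a later one from being a record.
\<close>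

lemma positive_records_block:
  assumes "sorted_wrt (>) xs"
  shows "positive_records M (map (\<lambda>a. (a, s)) xs) \<longleftrightarrow> s \<or> (\<forall>a\<in>set xs. \<exists>m\<in>M. m \<le> a)"
  using assms
proof (induction xs arbitrary: M)
  case (Cons a xs)
  then show ?case by (auto simp: not_less) (meson leD)+
qed simp

text \<open>
  A block contains a record if and only if its minimum is one.
\<close>

lemma positive_records_word_of_blocks:
  assumes "As \<in> ordered_partitions_of S" "finite S"
  shows "positive_records M (word_of_blocks s As) \<longleftrightarrow> positive_block_records s M As"
  using assms
proof (induction As arbitrary: s S M)
  case (Cons A As)
  then have A: "A \<noteq> {}" "A \<subseteq> S" "finite A" and As: "As \<in> ordered_partitions_of (S - A)"
    by (auto intro: finite_subset)
  have "(\<forall>a\<in>A. \<exists>m\<in>M. m \<le> a) \<longleftrightarrow> \<not> (\<forall>m\<in>M. Min A < m)"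
  proof
    assume "\<not> (\<forall>m\<in>M. Min A < m)"
    then obtain m where "m \<in> M" "m \<le> Min A" by (auto simp: not_less)
    then show "\<forall>a\<in>A. \<exists>m\<in>M. m \<le> a" using A(3) by (meson Min_le order_trans)
  qed (use Min_in[OF A(3,1)] in \<open>auto simp: not_less\<close>)
  then show ?case
    using Cons.IH[OF As] Cons.prems(2) A(3)
    by (auto simp: positive_records_append image_image
        positive_records_block[OF sorted_wrt_greater_rev_sorted_list_of_set])
qed simp

lemma positive_block_records_snoc:
  "positive_block_records s M (As @ [A]) \<longleftrightarrow> positive_block_records s M As \<and>
    ((\<forall>m\<in>M \<union> \<Union>(set As). Min A < m) \<longrightarrow> s = even (length As))"
  by (induction As arbitrary: s M) (auto simp: Un_assoc)

text \<open>
  As the blocks are disjoint, the block containing the minimum of a prefix belongs to this prefix, so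
  later blocks do not matter for it. Appending a block \<open>A\<close> gives a prefix with a different minimum only
  if \<open>Min A\<close> is a record.
\<close>

lemma odd_minima_iff_block_records:
  assumes "\<forall>A\<in>set As. finite A \<and> A \<noteq> {}" "distinct As" "disjoint (set As)"
  shows "(\<forall>i\<in>{1..length As}. \<exists>j<length As. odd (j + 1) \<and> Min (\<Union>(set (take i As))) \<in> As ! j) \<longleftrightarrow>
    positive_block_records True {} As"
  using assms
proof (induction As rule: rev_induct)
  case (snoc A As)
  let ?odd = "\<lambda>As i. \<exists>j<length As. odd (j + 1) \<and> Min (\<Union>(set (take i As))) \<in> As ! j"
  have dj: "A \<inter> \<Union>(set As) = {}"
    using snoc.prems by (auto simp: disjoint_def)
  have A: "finite A" "A \<noteq> {}" and As: "\<forall>A\<in>set As. finite A \<and> A \<noteq> {}" "distinct As" "disjoint (set As)"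
    using snoc.prems by (auto simp: disjoint_def)
  have fU: "finite (\<Union>(set As))" using As by auto
  have earlier: "?odd (As @ [A]) i \<longleftrightarrow> ?odd As i" if i: "i \<in> {1..length As}" for i
  proof -
    have "take i As \<noteq> []" using i by auto
    then have ne: "\<Union>(set (take i As)) \<noteq> {}"
    proof -
      obtain B where "B \<in> set (take i As)" using \<open>take i As \<noteq> []\<close> by (cases "take i As") auto
      then show ?thesis using As(1) in_set_takeD[of B i As] by blast
    qed
    have sub: "\<Union>(set (take i As)) \<subseteq> \<Union>(set As)" using set_take_subset[of i As] by blast
    have "Min (\<Union>(set (take i As))) \<in> \<Union>(set As)"
      using Min_in[OF finite_subset[OF sub fU] ne] sub by blast
    then have "Min (\<Union>(set (take i As))) \<notin> A" using dj by blast
    then show ?thesis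
      using i by (auto simp: less_Suc_eq nth_append)
  qed
  have last: "?odd (As @ [A]) (Suc (length As)) \<longleftrightarrow>
      ((\<forall>m\<in>\<Union>(set As). Min A < m) \<longrightarrow> even (length As))"
    if records: "positive_block_records True {} As"
  proof (cases "As = []")
    case True
    then show ?thesis using A by simp
  next
    case False
    let ?U = "\<Union>(set As)"
    have U: "?U \<noteq> {}" using False As(1) by (cases As) auto
    have Un: "Min (\<Union>(set (take (Suc (length As)) (As @ [A])))) = min (Min ?U) (Min A)"
      using Min_Un[OF fU U A] by (simp add: Un_commute)
    have rec: "(\<forall>m\<in>?U. Min A < m) \<longleftrightarrow> Min A < Min ?U"
      using fU U by simp
    show ?thesis
    proof (cases "Min A < Min ?U")
      case True
      then have mn: "min (Min ?U) (Min A) = Min A" by simp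
      have "Min A \<in> A" using A by simp
      then have "Min A \<notin> As ! j" if "j < length As" for j
        using dj nth_mem[OF that] by blast
      then show ?thesis
        unfolding Un mn rec using True \<open>Min A \<in> A\<close> by (auto simp: less_Suc_eq nth_append)
    next
      case 2: False
      then have mn: "min (Min ?U) (Min A) = Min ?U" by simp
      have "length As \<in> {1..length As}" using False by (simp add: Suc_le_eq)
      moreover have "\<forall>i\<in>{1..length As}. ?odd As i"
        using snoc.IH[OF As] records by (rule iffD2)
      ultimately have "?odd As (length As)" by (rule bspec[rotated])
      then have "\<exists>j<length (As @ [A]). odd (j + 1) \<and> Min ?U \<in> (As @ [A]) ! j"
        by (auto simp: less_Suc_eq nth_append)
      then show ?thesis unfolding Un mn rec using 2 by blast
    qed
  qed
  have range: "{1..length (As @ [A])} = insert (Suc (length As)) {1..length As}" by auto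
  have "(\<forall>i\<in>{1..length (As @ [A])}. ?odd (As @ [A]) i) \<longleftrightarrow>
      (\<forall>i\<in>{1..length As}. ?odd As i) \<and> ?odd (As @ [A]) (Suc (length As))"
  proof -
    have "(\<forall>i\<in>insert k B. P i) \<longleftrightarrow> (\<forall>i\<in>B. Q i) \<and> P k" if "\<And>i. i \<in> B \<Longrightarrow> P i = Q i"
      for k :: nat and B P Q using that by auto
    from this[OF earlier] show ?thesis unfolding range .
  qed
  also have "\<dots> \<longleftrightarrow> positive_block_records True {} As \<and>
      ((\<forall>m\<in>\<Union>(set As). Min A < m) \<longrightarrow> even (length As))"
    by (rule conj_cong[OF snoc.IH[OF As] last])
  also have "\<dots> \<longleftrightarrow> positive_block_records True {} (As @ [A])"
    by (simp add: positive_block_records_snoc)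
  finally show ?case .
qed simp

theorem card_ordered_partitions_odd_minima:
  "finite (ordered_partitions_odd_minima n) \<and>
   card (ordered_partitions_odd_minima n) = half_fubini_number n"
proof -
  let ?P = "ordered_partitions_of {1..n}"
  have odd: "As \<in> ordered_partitions_odd_minima n \<longleftrightarrow>
      As \<in> ?P \<and> positive_records {} (word_of_blocks True As)" for As
  proof (cases "As \<in> ?P")
    case True
    then have "distinct As" "disjoint (set As)" "\<Union>(set As) = {1..n}" "{} \<notin> set As"
      by (auto simp: ordered_partitions_of_def partition_on_def)
    moreover from this have "\<forall>A\<in>set As. finite A \<and> A \<noteq> {}"
      by (metis Union_upper finite_atLeastAtMost finite_subset)
    ultimately show ?thesis
      using True positive_records_word_of_blocks[OF True, of "{}" True]
        odd_minima_iff_block_records[of As]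
      unfolding ordered_partitions_odd_minima_def ordered_partitions_def
        ordered_partitions_of_def mem_Collect_eq by blast
  qed (auto simp: ordered_partitions_odd_minima_def ordered_partitions_def ordered_partitions_of_def)
  have good: "good_words {1..n} = {w \<in> signed_words_from True {1..n}. positive_records {} w}"
  proof -
    have "w = [] \<or> snd (hd w)" if "positive_records {} w" for w using that by (cases w) auto
    then show ?thesis by (auto simp: good_words_def signed_words_from_def)
  qed
  have bij: "bij_betw (word_of_blocks True) (ordered_partitions_odd_minima n) (good_words {1..n})"
  proof -
    have "ordered_partitions_odd_minima n = {As \<in> ?P. positive_records {} (word_of_blocks True As)}"
      using odd by blast
    then show ?thesis
      unfolding good using bij_betw_word_of_blocks[of "{1..n}" True]
      by (simp add: bij_betw_Collect)
  qed
  show ?thesis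
    using bij_betw_finite[OF bij] bij_betw_same_card[OF bij] card_good_words[of "{1..n}"] by simp
qed

section \<open>Regions of the arrangement\<close>

text \<open>
  The case \<open>i = j\<close> expresses \<open>x i \<noteq> 0\<close>, so both families of hyperplanes are covered.
\<close>

definition generic_points :: "nat \<Rightarrow> (nat \<Rightarrow> real) \<Rightarrow> (nat \<Rightarrow> real) set" where
  "generic_points n l = {x \<in> affine_slice n l. \<forall>i\<in>{1..n}. \<forall>j\<in>{1..n}. x i + x j \<noteq> 0}"

definition sign_class :: "nat \<Rightarrow> (nat \<Rightarrow> real) \<Rightarrow> (nat \<Rightarrow> real) \<Rightarrow> (nat \<Rightarrow> real) set" where
  "sign_class n l x =
     {y \<in> generic_points n l. \<forall>i\<in>{1..n}. \<forall>j\<in>{1..n}. sgn (y i + y j) = sgn (x i + x j)}"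

lemma generic_points_eq: "affine_slice n l - \<Union>(arrangement n) = generic_points n l"
proof -
  let ?X = "topspace (powertop_real {1..n})"
  have coordinate: "{x \<in> ?X. x i = 0} \<in> arrangement n" if "1 \<le> i" "i \<le> n" for i
    unfolding arrangement_def using that by (intro UnI1 CollectI exI[of _ i] conjI refl)
  have pair: "{x \<in> ?X. x i + x j = 0} \<in> arrangement n" if "1 \<le> i" "i < j" "j \<le> n" for i j
    unfolding arrangement_def using that by (intro UnI2 CollectI exI[of _ i] exI[of _ j] conjI refl)
  have "x \<in> \<Union>(arrangement n) \<longleftrightarrow> (\<exists>i\<in>{1..n}. \<exists>j\<in>{1..n}. x i + x j = 0)" if x: "x \<in> ?X" for x
  proof
    assume "x \<in> \<Union>(arrangement n)"
    then consider i where "1 \<le> i" "i \<le> n" "x i = 0"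
      | i j where "1 \<le> i" "i < j" "j \<le> n" "x i + x j = 0"
      unfolding arrangement_def by blast
    then show "\<exists>i\<in>{1..n}. \<exists>j\<in>{1..n}. x i + x j = 0"
    proof cases
      case (1 i)
      then show ?thesis by (intro bexI[of _ i]) simp_all
    next
      case (2 i j)
      then show ?thesis by (intro bexI[of _ i] bexI[of _ j]) simp_all
    qed
  next
    assume "\<exists>i\<in>{1..n}. \<exists>j\<in>{1..n}. x i + x j = 0"
    then obtain i j where ij: "i \<in> {1..n}" "j \<in> {1..n}" "x i + x j = 0" by blast
    have bounds: "1 \<le> i" "i \<le> n" "1 \<le> j" "j \<le> n" using ij(1,2) by simp_all
    consider "i = j" | "i < j" | "j < i" by linarith
    then show "x \<in> \<Union>(arrangement n)"
    proof cases
      case 1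
      then have "x i = 0" using ij(3) by simp
      then show ?thesis using x by (intro UnionI[OF coordinate[OF bounds(1,2)]] CollectI conjI)
    next
      case 2
      show ?thesis using x ij(3) by (intro UnionI[OF pair[OF bounds(1) 2 bounds(4)]] CollectI conjI)
    next
      case 3
      have "x j + x i = 0" using ij(3) by simp
      then show ?thesis using x by (intro UnionI[OF pair[OF bounds(3) 3 bounds(2)]] CollectI conjI)
    qed
  qed
  then show ?thesis
    unfolding generic_points_def affine_slice_def by blast
qed

lemma sgn_convex_combination:
  fixes a b :: real
  assumes "sgn a = sgn b" "0 \<le> t" "t \<le> 1"
  shows "sgn ((1 - t) * a + t * b) = sgn a"
proof -
  consider "a = 0" "b = 0" | "a > 0" "b > 0" | "a < 0" "b < 0"
    using assms(1) by (auto simp: sgn_if split: if_splits)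
  then show ?thesis
  proof cases
    case 2
    have "0 < (1 - t) * a + t * b"
    proof (cases "t = 0")
      case False
      then have "0 < t * b" "0 \<le> (1 - t) * a" using assms 2 by simp_all
      then show ?thesis by simp
    qed (use 2 in simp)
    then show ?thesis using 2 by simp
  next
    case 3
    have "(1 - t) * a + t * b < 0"
    proof (cases "t = 0")
      case False
      then have "t * b < 0" "(1 - t) * a \<le> 0" using assms 3 by (simp_all add: mult_pos_neg mult_nonneg_nonpos)
      then show ?thesis by simp
    qed (use 3 in simp)
    then show ?thesis using 3 by simp
  qed simp
qed

lemma topspace_generic_points:
  "topspace (subtopology (powertop_real {1..n}) (generic_points n l)) = generic_points n l"
proof -
  have "generic_points n l \<subseteq> topspace (powertop_real {1..n})"
    unfolding generic_points_def affine_slice_def by blast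
  then show ?thesis by (simp only: topspace_subtopology Int_absorb1)
qed

text \<open>
  A sum \<open>x i + x j\<close> cannot change its sign on a connected set of generic points, and points with equal
  signs are joined by a segment of such points.
\<close>

lemma connected_component_generic_points:
  assumes x: "x \<in> generic_points n l"
  shows "connected_component_of_set (subtopology (powertop_real {1..n}) (generic_points n l)) x
    = sign_class n l x" (is "connected_component_of_set ?Z x = _")
proof -
  note top = topspace_generic_points[of n l]
  have in_class: "y \<in> sign_class n l x" if comp: "connected_component_of ?Z x y" for y
  proof -
    obtain T where T: "connectedin ?Z T" "x \<in> T" "y \<in> T"
      using comp unfolding connected_component_of_def by blast
    then have sub: "T \<subseteq> generic_points n l" using connectedin_subset_topspace top by metis
    have "sgn (y i + y j) = sgn (x i + x j)" if ij: "i \<in> {1..n}" "j \<in> {1..n}" for i j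
    proof -
      have "continuous_map ?Z euclideanreal (\<lambda>z. z i + z j)"
        using ij by (intro continuous_intros continuous_map_from_subtopology continuous_map_product_projection)
      then have "connected ((\<lambda>z. z i + z j) ` T)"
        using connectedin_continuous_map_image[OF _ T(1)] by (metis connectedin_iff_connected)
      moreover have "0 \<notin> (\<lambda>z. z i + z j) ` T"
        using sub ij by (auto simp: generic_points_def)
      ultimately have "\<not> (x i + x j \<le> 0 \<and> 0 \<le> y i + y j)" "\<not> (y i + y j \<le> 0 \<and> 0 \<le> x i + x j)"
        using T(2,3) connectedD_interval[of "(\<lambda>z. z i + z j) ` T"] by blast+
      then show ?thesis by (auto simp: sgn_if)
    qed
    then show ?thesis using T sub by (auto simp: sign_class_def)
  qed
  have in_component: "connected_component_of ?Z x y" if y: "y \<in> sign_class n l x" for y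
  proof -
    define g where "g = (\<lambda>t. \<lambda>k\<in>{1..n}. (1 - t) * x k + t * y k)"
    have "g t \<in> generic_points n l" if t: "t \<in> {0..1}" for t
    proof -
      have "(\<Sum>i=1..n. l i * g t i) = (1 - t) * (\<Sum>i=1..n. l i * x i) + t * (\<Sum>i=1..n. l i * y i)"
        by (simp add: g_def sum_distrib_left sum.distrib[symmetric] algebra_simps)
      also have "\<dots> = 1"
        using x y by (simp add: sign_class_def generic_points_def affine_slice_def)
      finally have "g t \<in> affine_slice n l"
        by (simp add: affine_slice_def g_def)
      moreover have "g t i + g t j \<noteq> 0" if ij: "i \<in> {1..n}" "j \<in> {1..n}" for i j
      proof -
        have "g t i + g t j = (1 - t) * (x i + x j) + t * (y i + y j)"
          using ij by (simp add: g_def algebra_simps)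
        moreover have "sgn (x i + x j) = sgn (y i + y j)" "x i + x j \<noteq> 0"
          using x y ij by (auto simp: sign_class_def generic_points_def)
        ultimately show ?thesis
          using sgn_convex_combination[of "x i + x j" "y i + y j" t] t by (auto simp: sgn_zero_iff)
      qed
      ultimately show ?thesis by (simp add: generic_points_def)
    qed
    moreover have "continuous_map (top_of_set {0..1}) (powertop_real {1..n}) g"
      unfolding continuous_map_componentwise
    proof
      show "g ` topspace (top_of_set {0..1}) \<subseteq> extensional {1..n}"
        by (auto simp: g_def)
      show "\<forall>k\<in>{1..n}. continuous_map (top_of_set {0..1}) euclideanreal (\<lambda>t. g t k)"
        by (auto simp: g_def intro!: continuous_intros)
    qed
    ultimately have "continuous_map (top_of_set {0..1}) ?Z g"
      by (auto simp: continuous_map_in_subtopology)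
    moreover have "connectedin (top_of_set {0..1}) {0..1::real}"
      by (simp add: connectedin_subtopology)
    ultimately have "connectedin ?Z (g ` {0..1})"
      by (rule connectedin_continuous_map_image)
    moreover have "x \<in> extensional {1..n}" "y \<in> extensional {1..n}"
      using x y by (simp_all add: sign_class_def generic_points_def affine_slice_def PiE_def)
    then have "g 0 = x" "g 1 = y"
      by (simp_all add: g_def extensional_restrict)
    then have "x \<in> g ` {0..1}" "y \<in> g ` {0..1}" by force+
    ultimately show ?thesis by (auto simp: connected_component_of_def)
  qed
  show ?thesis
  proof (intro equalityI subsetI)
    fix y assume "y \<in> connected_component_of_set ?Z x"
    then show "y \<in> sign_class n l x" by (intro in_class) simp
  next
    fix y assume "y \<in> sign_class n l x"
    then show "y \<in> connected_component_of_set ?Z x" using in_component by simp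
  qed
qed

lemma regions_eq: "regions n l = sign_class n l ` generic_points n l"
proof -
  show ?thesis
    unfolding regions_def generic_points_eq connected_components_of_def topspace_generic_points
  proof (rule image_cong)
    fix x assume "x \<in> generic_points n l"
    then show "connected_component_of_set (subtopology (powertop_real {1..n}) (generic_points n l)) x
        = sign_class n l x"
      by (rule connected_component_generic_points)
  qed (rule refl)
qed

section \<open>Sorting coordinates by absolute value\<close>

text \<open>
  For coordinates of opposite sign this compares absolute values; coordinates of equal sign dominate
  each other.
\<close>

definition dominates :: "(nat \<Rightarrow> real) \<Rightarrow> nat \<Rightarrow> nat \<Rightarrow> bool" where
  "dominates x i j \<longleftrightarrow> sgn (x i + x j) = sgn (x i)"

definition descends :: "(nat \<Rightarrow> real) \<Rightarrow> nat \<Rightarrow> nat \<Rightarrow> bool" where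
  "descends x i j \<longleftrightarrow> (sgn (x i) = sgn (x j) \<longrightarrow> j < i)"

lemma dominates_refl [simp]: "dominates x i i"
  by (simp add: dominates_def mult_2[symmetric] sgn_mult)

lemma dominates_both: "dominates x i j \<Longrightarrow> dominates x j i \<Longrightarrow> sgn (x i) = sgn (x j)"
  by (simp add: dominates_def add.commute)

lemma dominates_same_sign: "sgn (x i) = sgn (x j) \<Longrightarrow> dominates x i j"
  by (auto simp: dominates_def sgn_if split: if_splits)

text \<open>
  The list starts with the largest index among those that dominate every other one. The next entry, if
  it has the same sign, also dominates every index, so it is smaller.
\<close>

lemma dominated_list_exists:
  assumes "finite S" "\<forall>i\<in>S. \<forall>j\<in>S. x i + x j \<noteq> 0"
  shows "\<exists>as. distinct as \<and> set as = S \<and> sorted_wrt (dominates x) as \<and> successively (descends x) as"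
  using assms
proof (induction S rule: finite_psubset_induct)
  case (psubset S)
  show ?case
  proof (cases "S = {}")
    case False
    define B where "B = {i \<in> S. \<forall>j\<in>S. dominates x i j}"
    \<comment> \<open>an index with the largest absolute value dominates all others\<close>
    have "B \<noteq> {}"
    proof -
      have "Max ((\<lambda>i. \<bar>x i\<bar>) ` S) \<in> (\<lambda>i. \<bar>x i\<bar>) ` S"
        using psubset.hyps False by (intro Max_in) auto
      then obtain i where i: "i \<in> S" "\<bar>x i\<bar> = Max ((\<lambda>i. \<bar>x i\<bar>) ` S)" by auto
      have "dominates x i j" if "j \<in> S" for j
      proof -
        have "\<bar>x j\<bar> \<le> \<bar>x i\<bar>" unfolding i(2) using psubset.hyps that by auto
        moreover have "x i + x j \<noteq> 0" using psubset.prems i that by blast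
        ultimately show ?thesis by (auto simp: dominates_def sgn_if)
      qed
      then show ?thesis using i by (auto simp: B_def)
    qed
    moreover have "finite B" using psubset.hyps by (simp add: B_def)
    ultimately have a: "Max B \<in> B" and max: "\<And>b. b \<in> B \<Longrightarrow> b \<le> Max B" by auto
    define a where "a = Max B"
    have aS: "a \<in> S" "\<forall>j\<in>S. dominates x a j" using a by (auto simp: B_def a_def)
    then obtain as where as: "distinct as" "set as = S - {a}" "sorted_wrt (dominates x) as"
        "successively (descends x) as"
      using psubset.IH[of "S - {a}"] psubset.prems by blast
    have "descends x a (hd as)" if "as \<noteq> []"
      unfolding descends_def
    proof
      assume s: "sgn (x a) = sgn (x (hd as))"
      have "hd as \<in> S" "hd as \<noteq> a" using hd_in_set[OF that] as(2) by auto
      moreover have "dominates x (hd as) j" if "j \<in> S" for j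
      proof (cases "j = a")
        case True
        then show ?thesis using s dominates_same_sign by metis
      next
        case False
        then have "j \<in> set as" using as(2) \<open>j \<in> S\<close> by blast
        then show ?thesis using as(3) by (cases as) auto
      qed
      ultimately have "hd as \<in> B" by (auto simp: B_def)
      then show "hd as < a" using max \<open>hd as \<noteq> a\<close> by (fastforce simp: a_def order_less_le)
    qed
    then have "successively (descends x) (a # as)" using as(4) by (cases as) auto
    then show ?thesis
      using as aS by (intro exI[of _ "a # as"]) auto
  qed simp
qed

text \<open>
  Every entry in front of a dominating index has the same sign as that index, so the list decreases up
  to it. Hence the head of such a list is determined by \<open>x\<close> alone.
\<close>

lemma dominating_le_hd:
  assumes "sorted_wrt (dominates x) as" "successively (descends x) as"
    "e \<in> set as" "\<forall>j\<in>set as. dominates x e j"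
  shows "e \<le> hd as"
  using assms
proof (induction as)
  case (Cons c as)
  show ?case
  proof (cases "e = c")
    case False
    then have e: "e \<in> set as" using Cons.prems by simp
    then obtain h as' where as: "as = h # as'" by (cases as) auto
    have "successively (descends x) as" using Cons.prems(2) as by simp
    then have "e \<le> h" using Cons e as by simp
    moreover have "sgn (x c) = sgn (x e)" using Cons.prems e by (auto intro: dominates_both)
    moreover have "sgn (x h) = sgn (x e)"
    proof (cases "h = e")
      case False
      then have "dominates x h e" using Cons.prems(1) e as by auto
      then show ?thesis using Cons.prems(4) as dominates_both by simp
    qed simp
    ultimately show ?thesis using Cons.prems(2) as by (simp add: descends_def)
  qed simp
qed simp

lemma dominated_list_unique:
  assumes "sorted_wrt (dominates x) as" "successively (descends x) as" "distinct as"
    "sorted_wrt (dominates x) bs" "successively (descends x) bs" "distinct bs" "set as = set bs"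
  shows "as = bs"
  using assms
proof (induction as arbitrary: bs)
  case (Cons a as)
  then obtain b bs' where bs: "bs = b # bs'" by (cases bs) auto
  have "\<forall>j\<in>set (a # as). dominates x a j" "\<forall>j\<in>set bs. dominates x b j"
    using Cons.prems(1,4) by (simp_all add: bs)
  then have "a \<le> hd bs" "b \<le> hd (a # as)"
    using dominating_le_hd[OF Cons.prems(4,5), of a] dominating_le_hd[OF Cons.prems(1,2), of b]
      list.set_intros(1)[of a as] list.set_intros(1)[of b bs'] bs
    unfolding Cons.prems(7) by blast+
  then have ab: "a = b" by (simp add: bs)
  moreover have "set as = set bs'"
    using Cons.prems(3,6,7) bs ab by (auto simp: insert_ident)
  moreover have "successively (descends x) as" "successively (descends x) bs'"
    using Cons.prems bs by (auto simp: successively_Cons)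
  ultimately show ?case
    using Cons.IH[of bs'] Cons.prems bs by simp
qed simp

text \<open>
  Every new front entry gets an absolute value exceeding all others.
\<close>

lemma dominated_list_realizable:
  fixes \<sigma> :: "nat \<Rightarrow> int"
  assumes "distinct as" "\<forall>i\<in>set as. \<sigma> i \<in> {1, - 1}"
  shows "\<exists>x. (\<forall>i\<in>set as. sgn (x i) = real_of_int (\<sigma> i)) \<and> sorted_wrt (dominates x) as"
  using assms
proof (induction as)
  case (Cons a as)
  then obtain x where x: "\<forall>i\<in>set as. sgn (x i) = real_of_int (\<sigma> i)" "sorted_wrt (dominates x) as"
    by auto
  \<comment> \<open>an upper bound for the old absolute values that is positive also for an empty list\<close>
  define m where "m = 1 + (\<Sum>i\<in>set as. \<bar>x i\<bar>)"
  define y where "y = x(a := real_of_int (\<sigma> a) * m)"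
  have m: "\<bar>x i\<bar> < m" if "i \<in> set as" for i
    using member_le_sum[of i "set as" "\<lambda>i. \<bar>x i\<bar>"] that by (simp add: m_def)
  have "0 \<le> (\<Sum>i\<in>set as. \<bar>x i\<bar>)" by (intro sum_nonneg) simp
  then have m0: "0 < m" unfolding m_def by linarith
  have \<sigma>a: "\<sigma> a = 1 \<or> \<sigma> a = - 1" using Cons.prems by simp
  have y: "y i = x i" if "i \<in> set as" for i using that Cons.prems by (auto simp: y_def)
  have "dominates y a i" if "i \<in> set as" for i
    using \<sigma>a m[OF that] m0 y[OF that] by (auto simp: dominates_def y_def sgn_if)
  moreover have "sorted_wrt (dominates y) as"
    using x(2) by (rule sorted_wrt_mono_rel[rotated]) (auto simp: dominates_def y)
  moreover have "sgn (y a) = real_of_int (\<sigma> a)"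
    using \<sigma>a m0 by (auto simp: y_def sgn_mult)
  ultimately show ?case
    using x(1) y by (intro exI[of _ y]) simp
qed simp

section \<open>Bounded regions\<close>

definition tail_gap :: "nat \<Rightarrow> (nat \<Rightarrow> real) \<Rightarrow> nat \<Rightarrow> real" where
  "tail_gap n l i = l i - (\<Sum>j=i+1..n. l j)"

lemma tail_gap_pos:
  assumes "far_decreasing n l" "i \<in> {1..n}"
  shows "tail_gap n l i > 0"
proof (cases "i = n")
  case True
  then show ?thesis using assms by (simp add: tail_gap_def far_decreasing_def)
next
  case False
  then have "i \<in> {1..n - 1}" using assms(2) by auto
  then show ?thesis using assms(1) by (simp add: tail_gap_def far_decreasing_def)
qed

lemma far_decreasing_pos:
  assumes "far_decreasing n l" "i \<in> {1..n}"
  shows "l i > 0"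
  using assms(2)
proof (induction "n - i" arbitrary: i rule: less_induct)
  case less
  have "0 < l j" if "j \<in> {i+1..n}" for j
    using that less.prems by (intro less.hyps) auto
  then have "0 \<le> (\<Sum>j=i+1..n. l j)" by (intro sum_nonneg) (auto intro: less_imp_le)
  then show ?case using tail_gap_pos[OF assms(1) less.prems] by (simp add: tail_gap_def)
qed

text \<open>
  Charge each negative coordinate \<open>i\<close> to a positive coordinate \<open>m < i\<close> of larger absolute value. All
  that is charged to \<open>m\<close> has indices beyond \<open>m\<close>, so it amounts to at most \<open>x m\<close> times
  \<open>\<Sum>j=m+1..n. l j\<close>, and \<open>x m\<close> keeps at least the weight \<open>tail_gap n l m\<close>.
\<close>

lemma weighted_sum_bound:
  assumes l: "far_decreasing n l"
    and neg: "\<And>i. i \<in> {1..n} \<Longrightarrow> x i < 0 \<Longrightarrow> \<exists>m\<in>{1..n}. m < i \<and> \<bar>x i\<bar> < x m"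
    and k: "k \<in> {1..n}" "x k > 0"
  shows "tail_gap n l k * x k \<le> (\<Sum>i=1..n. l i * x i)"
proof -
  define P where "P = {i \<in> {1..n}. x i > 0}"
  define N where "N = {i \<in> {1..n}. x i < 0}"
  have fin: "finite P" "finite N" by (simp_all add: P_def N_def)
  have "\<exists>m. m \<in> P \<and> m < i \<and> \<bar>x i\<bar> < x m" if "i \<in> N" for i
    using neg[of i] that by (fastforce simp: N_def P_def)
  \<comment> \<open>\<open>f i\<close> is the coordinate to which \<open>i\<close> is charged\<close>
  then obtain f where f: "\<And>i. i \<in> N \<Longrightarrow> f i \<in> P \<and> f i < i \<and> \<bar>x i\<bar> < x (f i)" by metis
  have lpos: "l i > 0" if "i \<in> {1..n}" for i using far_decreasing_pos[OF l that] .
  have "(\<Sum>i\<in>N. l i * \<bar>x i\<bar>) \<le> (\<Sum>i\<in>N. l i * x (f i))"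
    using f lpos by (intro sum_mono mult_left_mono) (auto simp: N_def less_imp_le)
  also have "\<dots> = (\<Sum>m\<in>P. \<Sum>i\<in>{i \<in> N. f i = m}. l i * x (f i))"
    using fin f by (intro sum.group[symmetric]) auto
  also have "\<dots> = (\<Sum>m\<in>P. (\<Sum>i\<in>{i \<in> N. f i = m}. l i) * x m)"
    by (intro sum.cong refl) (simp add: sum_distrib_right)
  also have "\<dots> \<le> (\<Sum>m\<in>P. (\<Sum>j=m+1..n. l j) * x m)"
  proof (intro sum_mono mult_right_mono)
    fix m assume m: "m \<in> P"
    show "0 \<le> x m" using m by (simp add: P_def)
    show "(\<Sum>i\<in>{i \<in> N. f i = m}. l i) \<le> (\<Sum>j=m+1..n. l j)"
      using f lpos m by (intro sum_mono2) (auto simp: N_def P_def less_imp_le Suc_le_eq)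
  qed
  finally have N: "(\<Sum>i\<in>N. l i * \<bar>x i\<bar>) \<le> (\<Sum>m\<in>P. (\<Sum>j=m+1..n. l j) * x m)" .
  have "tail_gap n l k * x k \<le> (\<Sum>m\<in>P. tail_gap n l m * x m)"
    using k tail_gap_pos[OF l] fin
    by (intro member_le_sum) (auto simp: P_def intro!: mult_nonneg_nonneg less_imp_le)
  also have "\<dots> = (\<Sum>m\<in>P. l m * x m) - (\<Sum>m\<in>P. (\<Sum>j=m+1..n. l j) * x m)"
    by (simp add: tail_gap_def algebra_simps sum_subtractf)
  also have "\<dots> \<le> (\<Sum>m\<in>P. l m * x m) - (\<Sum>i\<in>N. l i * \<bar>x i\<bar>)"
    using N by simp
  also have "(\<Sum>i\<in>N. l i * \<bar>x i\<bar>) = - (\<Sum>i\<in>N. l i * x i)"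
    by (subst sum_negf[symmetric]) (auto simp: N_def intro!: sum.cong)
  also have "(\<Sum>m\<in>P. l m * x m) - - (\<Sum>i\<in>N. l i * x i) = (\<Sum>i\<in>P \<union> N. l i * x i)"
    using fin by (subst sum.union_disjoint) (auto simp: P_def N_def)
  also have "\<dots> = (\<Sum>i=1..n. l i * x i)"
    by (intro sum.mono_neutral_left) (auto simp: P_def N_def)
  finally show ?thesis .
qed

text \<open>
  The region belonging to a signed permutation: its entries are listed by decreasing absolute value,
  up to the order inside a run of equal signs.
\<close>

definition cell :: "nat \<Rightarrow> (nat \<Rightarrow> real) \<Rightarrow> nat list \<times> (nat \<Rightarrow> int) \<Rightarrow> (nat \<Rightarrow> real) set" where
  "cell n l p = {x \<in> affine_slice n l.
     (\<forall>i\<in>{1..n}. sgn (x i) = real_of_int (snd p i)) \<and> sorted_wrt (dominates x) (fst p)}"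

lemma signed_permutationsD:
  assumes "(as, \<sigma>) \<in> signed_permutations n"
  shows "distinct as" "set as = {1..n}" "length as = n" "\<sigma> \<in> extensional {1..n}"
    "\<And>i. i \<in> {1..n} \<Longrightarrow> \<sigma> i = 1 \<or> \<sigma> i = - 1"
proof -
  show *: "distinct as" "set as = {1..n}" "\<sigma> \<in> extensional {1..n}"
    using assms by (auto simp: signed_permutations_def permutations_of_set_def PiE_def)
  show "length as = n" using distinct_card[OF *(1)] *(2) by simp
  show "\<sigma> i = 1 \<or> \<sigma> i = - 1" if "i \<in> {1..n}" for i
    using assms that by (auto simp: signed_permutations_def)
qed

lemma dominated_list_signs:
  assumes "sorted_wrt (dominates x) as" "sorted_wrt (dominates y) as"
    "\<forall>i\<in>set as. sgn (x i) = sgn (y i)" "i \<in> set as" "j \<in> set as"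
  shows "sgn (x i + x j) = sgn (y i + y j)"
  using assms
proof (induction as)
  case (Cons a as)
  have a: "sgn (x a + x k) = sgn (y a + y k)" if "k \<in> set (a # as)" for k
  proof -
    have "dominates x a k" "dominates y a k" using Cons.prems(1,2) that by auto
    then show ?thesis using Cons.prems(3) by (simp add: dominates_def)
  qed
  consider "i = a" | "j = a" | "i \<in> set as" "j \<in> set as" using Cons.prems(4,5) by auto
  then show ?case
  proof cases
    case 1
    then show ?thesis using a[OF Cons.prems(5)] by simp
  next
    case 2
    then show ?thesis using a[OF Cons.prems(4)] by (simp add: add.commute)
  next
    case 3
    then show ?thesis using Cons.IH Cons.prems by simp
  qed
qed simp

lemma cell_subset_generic:
  assumes "(as, \<sigma>) \<in> signed_permutations n"
  shows "cell n l (as, \<sigma>) \<subseteq> generic_points n l"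
proof
  fix x assume x: "x \<in> cell n l (as, \<sigma>)"
  note p = signed_permutationsD[OF assms]
  have nz: "sgn (x i) \<noteq> 0" if "i \<in> {1..n}" for i
    using x p(5)[OF that] that by (auto simp: cell_def)
  have "sorted_wrt (dominates x) as" using x by (simp add: cell_def)
  then have dom: "dominates x i j \<or> dominates x j i" if "i \<in> set as" "j \<in> set as" for i j
    using that by (induction as) auto
  have "x i + x j \<noteq> 0" if ij: "i \<in> {1..n}" "j \<in> {1..n}" for i j
  proof
    assume "x i + x j = 0"
    moreover from this have "x j + x i = 0" by simp
    ultimately have "sgn (x i) = 0 \<or> sgn (x j) = 0"
      using dom[of i j] ij unfolding p(2) dominates_def by (metis sgn_0)
    then show False using nz ij by blast
  qed
  then show "x \<in> generic_points n l"
    using x unfolding generic_points_def cell_def by blast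
qed

lemma cell_eq_sign_class:
  assumes p: "(as, \<sigma>) \<in> signed_permutations n" and x: "x \<in> cell n l (as, \<sigma>)"
  shows "cell n l (as, \<sigma>) = sign_class n l x"
proof (intro equalityI subsetI)
  note p' = signed_permutationsD[OF p]
  fix y assume y: "y \<in> cell n l (as, \<sigma>)"
  have "sgn (y i + y j) = sgn (x i + x j)" if "i \<in> {1..n}" "j \<in> {1..n}" for i j
    using x y that p'(2) by (intro dominated_list_signs[of y as x]) (auto simp: cell_def)
  then show "y \<in> sign_class n l x"
    using cell_subset_generic[OF p] y by (auto simp: sign_class_def)
next
  note p' = signed_permutationsD[OF p]
  fix y assume y: "y \<in> sign_class n l x"
  have two: "sgn (z + z) = sgn z" for z :: real by (simp add: mult_2[symmetric] sgn_mult)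
  have s: "sgn (y i) = sgn (x i)" if "i \<in> {1..n}" for i
    using y that two[of "x i"] two[of "y i"] unfolding sign_class_def by force
  have "dominates y i j" if "dominates x i j" "i \<in> set as" "j \<in> set as" for i j
    using that y s p'(2) unfolding sign_class_def dominates_def by force
  then have "sorted_wrt (dominates y) as"
    using x by (auto simp: cell_def intro: sorted_wrt_mono_rel[rotated])
  then show "y \<in> cell n l (as, \<sigma>)"
    using x y s by (simp add: cell_def sign_class_def generic_points_def)
qed

lemma decreasing_blocks_iff_descends:
  assumes "(as, \<sigma>) \<in> signed_permutations n" "x \<in> cell n l (as, \<sigma>)"
  shows "decreasing_blocks as \<sigma> \<longleftrightarrow> successively (descends x) as"
proof -
  note p = signed_permutationsD[OF assms(1)]
  have "sgn (x i) = sgn (x j) \<longleftrightarrow> \<sigma> i = \<sigma> j" if "i \<in> set as" "j \<in> set as" for i j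
    using that assms(2) p(2) by (simp add: cell_def)
  then show ?thesis
    by (auto simp: decreasing_blocks_def successively_conv_nth descends_def)
qed

text \<open>
  The minimum of the prefix ending at a negative entry is positive, hence another entry.
\<close>

lemma negative_entry_preceded:
  assumes "positive_minima as \<sigma>" "p < length as" "\<sigma> (as ! p) \<noteq> 1"
  shows "\<exists>q<p. as ! q < as ! p \<and> \<sigma> (as ! q) = 1"
proof -
  define m where "m = Min (set (take (Suc p) as))"
  have p: "as ! p \<in> set (take (Suc p) as)"
    using assms(2) by (auto simp: in_set_conv_nth)
  have "m \<in> set (take (Suc p) as)"
    unfolding m_def using p by (intro Min_in) auto
  then obtain q where q: "q < Suc p" "as ! q = m"
    using assms(2) by (auto simp: in_set_conv_nth)
  have "\<sigma> m = 1"
    using assms(1,2) unfolding positive_minima_def m_def by (simp add: Suc_le_eq)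
  then have "m \<noteq> as ! p" using assms(3) by auto
  moreover have "m \<le> as ! p" unfolding m_def using p by (intro Min_le) auto
  moreover have "q \<noteq> p" using q(2) \<open>m \<noteq> as ! p\<close> by auto
  ultimately show ?thesis
    using q \<open>\<sigma> m = 1\<close> by (intro exI[of _ q]) auto
qed

lemma negative_coordinate_dominated:
  assumes p: "(as, \<sigma>) \<in> signed_permutations n" and pos: "positive_minima as \<sigma>"
    and sgn: "\<forall>i\<in>{1..n}. sgn (x i) = real_of_int (\<sigma> i)" and sorted: "sorted_wrt (dominates x) as"
    and i: "i \<in> {1..n}" "x i < 0"
  shows "\<exists>m\<in>{1..n}. m < i \<and> \<bar>x i\<bar> < x m"
proof -
  note p' = signed_permutationsD[OF p]
  obtain k where k: "k < length as" "as ! k = i"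
    using i(1) unfolding p'(2)[symmetric] in_set_conv_nth by blast
  have "real_of_int (\<sigma> i) = - 1" using sgn i by force
  then have "\<sigma> (as ! k) \<noteq> 1" using k(2) by auto
  then obtain q where q: "q < k" "as ! q < i" "\<sigma> (as ! q) = 1"
    using negative_entry_preceded[OF pos k(1)] k(2) by blast
  have m: "as ! q \<in> {1..n}"
    using nth_mem[of q as] q(1) k(1) unfolding p'(2) by simp
  have "sgn (x (as ! q)) = 1" using sgn m q(3) by simp
  moreover have "dominates x (as ! q) i"
    using sorted_wrt_nth_less[OF sorted q(1) k(1)] k(2) by simp
  ultimately have "sgn (x (as ! q) + x i) = 1" by (simp add: dominates_def)
  then have "\<bar>x i\<bar> < x (as ! q)" using i(2) by (simp add: sgn_1_pos)
  then show ?thesis using m q(2) by blast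
qed

text \<open>
  By \<open>weighted_sum_bound\<close>, with the weighted sum being \<open>1\<close>, each positive coordinate is at most
  \<open>1 / tail_gap n l k\<close>; negative coordinates are dominated by positive ones.
\<close>

lemma cell_bounded:
  assumes l: "far_decreasing n l" and p: "(as, \<sigma>) \<in> signed_permutations n"
    and pos: "positive_minima as \<sigma>"
  shows "\<exists>B. \<forall>x\<in>cell n l (as, \<sigma>). L2_set x {1..n} \<le> B"
proof (intro exI ballI)
  fix x assume x: "x \<in> cell n l (as, \<sigma>)"
  let ?K = "\<Sum>k=1..n. 1 / tail_gap n l k"
  have sum: "(\<Sum>i=1..n. l i * x i) = 1" and sgn: "\<forall>i\<in>{1..n}. sgn (x i) = real_of_int (\<sigma> i)"
    and sorted: "sorted_wrt (dominates x) as"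
    using x by (auto simp: cell_def affine_slice_def)
  note neg = negative_coordinate_dominated[OF p pos sgn sorted]
  have up: "x k \<le> ?K" if k: "k \<in> {1..n}" "x k > 0" for k
  proof -
    have "tail_gap n l k * x k \<le> 1"
      using weighted_sum_bound[OF l neg k] sum by simp
    then have "x k \<le> 1 / tail_gap n l k"
      using tail_gap_pos[OF l k(1)] by (simp add: field_simps)
    also have "\<dots> \<le> ?K"
      using k(1) tail_gap_pos[OF l] by (intro member_le_sum) (auto intro!: less_imp_le)
    finally show ?thesis .
  qed
  have "\<bar>x i\<bar> \<le> ?K" if i: "i \<in> {1..n}" for i
  proof -
    have "sgn (x i) \<noteq> 0" using sgn signed_permutationsD(5)[OF p i] i by auto
    then have "x i \<noteq> 0" by auto
    then consider "x i > 0" | "x i < 0" by linarith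
    then show ?thesis
    proof cases
      case 1
      then show ?thesis using up i by simp
    next
      case 2
      then obtain m where m: "m \<in> {1..n}" "\<bar>x i\<bar> < x m" using neg[OF i] by blast
      then have "x m > 0" by linarith
      then show ?thesis using up[OF m(1)] m(2) by linarith
    qed
  qed
  then have "(\<Sum>i\<in>{1..n}. \<bar>x i\<bar>) \<le> (\<Sum>i\<in>{1..n}. ?K)" by (rule sum_mono)
  then show "L2_set x {1..n} \<le> (\<Sum>i\<in>{1..n}. ?K)"
    using L2_set_le_sum_abs order_trans by blast
qed

text \<open>
  Cells are cut out of a cone, so any vector of the cone with positive weighted sum can be scaled into
  the affine slice.
\<close>

lemma normalized_in_cell:
  assumes p: "(as, \<sigma>) \<in> signed_permutations n"
    and sgn: "\<forall>i\<in>{1..n}. sgn (x i) = real_of_int (\<sigma> i)" and sorted: "sorted_wrt (dominates x) as"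
    and L: "L = (\<Sum>i=1..n. l i * x i)" "L > 0"
  shows "(\<lambda>i\<in>{1..n}. x i / L) \<in> cell n l (as, \<sigma>)"
proof -
  let ?y = "\<lambda>i\<in>{1..n}. x i / L"
  note p' = signed_permutationsD[OF p]
  have sg: "sgn (z / L) = sgn z" for z :: real
    using L(2) by (cases z "0 :: real" rule: linorder_cases) (simp_all add: divide_neg_pos)
  have "(\<Sum>i=1..n. l i * ?y i) = (\<Sum>i=1..n. l i * x i) / L"
    unfolding sum_divide_distrib by (intro sum.cong) auto
  also have "\<dots> = 1" using L by simp
  finally have "(\<Sum>i=1..n. l i * ?y i) = 1" .
  moreover have "?y \<in> topspace (powertop_real {1..n})"
    unfolding topspace_product_topology by simp
  ultimately have slice: "?y \<in> affine_slice n l"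
    unfolding affine_slice_def by blast
  have "sgn (?y i) = real_of_int (\<sigma> i)" if i: "i \<in> {1..n}" for i
  proof -
    have "sgn (?y i) = sgn (x i / L)" using i by simp
    then show ?thesis unfolding sg using sgn i by simp
  qed
  moreover have "dominates ?y i j" if "i \<in> set as" "j \<in> set as" "dominates x i j" for i j
  proof -
    have "?y i + ?y j = (x i + x j) / L" "?y i = x i / L"
      using that(1,2) unfolding p'(2) by (simp_all add: add_divide_distrib)
    then show ?thesis using that(3) unfolding dominates_def by (simp only: sg)
  qed
  then have "sorted_wrt (dominates ?y) as"
    using sorted by (rule sorted_wrt_mono_rel)
  ultimately show ?thesis
    using slice by (simp add: cell_def)
qed

text \<open>
  The first coordinate has the largest weight; it cannot be dominated by a smaller index and is
  therefore positive, which makes the weighted sum positive.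
\<close>

lemma cell_nonempty:
  assumes l: "far_decreasing n l" and p: "(as, \<sigma>) \<in> signed_permutations n"
    and pos: "positive_minima as \<sigma>" and n: "n \<ge> 1"
  shows "cell n l (as, \<sigma>) \<noteq> {}"
proof -
  note p' = signed_permutationsD[OF p]
  have "\<forall>i\<in>set as. \<sigma> i \<in> {1, - 1}" unfolding p'(2) using p'(5) by blast
  from dominated_list_realizable[OF p'(1) this] obtain x
    where x: "\<forall>i\<in>{1..n}. sgn (x i) = real_of_int (\<sigma> i)" "sorted_wrt (dominates x) as"
    unfolding p'(2) by blast
  note neg = negative_coordinate_dominated[OF p pos x]
  have one: "1 \<in> {1..n}" using n by simp
  have "sgn (x 1) \<noteq> 0" using x(1) p'(5)[OF one] one by auto
  moreover have "\<not> x 1 < 0"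
  proof
    assume "x 1 < 0"
    from neg[OF one this] show False by simp
  qed
  ultimately have x1: "x 1 > 0" by (simp add: sgn_zero_iff)
  have "0 < tail_gap n l 1 * x 1" using tail_gap_pos[OF l one] x1 by simp
  also have "\<dots> \<le> (\<Sum>i=1..n. l i * x i)" by (rule weighted_sum_bound[OF l neg one x1])
  finally show ?thesis using normalized_in_cell[OF p x refl] by blast
qed

lemma sgn_add_same_sign:
  fixes a b :: real
  assumes "sgn a = e" "e = 1 \<or> e = - 1" "0 \<le> e * b"
  shows "sgn (a + b) = e"
  using assms by (auto simp: sgn_1_pos sgn_1_neg)

text \<open>
  Let \<open>T\<close> be a prefix whose minimum \<open>m\<close> is negative. The signed indicator vector \<open>d\<close> of \<open>T\<close> lies in the
  closure of the cone, and its weighted sum \<open>D\<close> is negative because \<open>l m\<close> exceeds all later weights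
  together. Moving from \<open>x\<close> in the direction \<open>d\<close> thus drives the weighted sum to \<open>0\<close>, while the
  coordinate \<open>m\<close> does not shrink; rescaling to the slice produces arbitrarily large points.
\<close>

lemma cell_unbounded:
  assumes l: "far_decreasing n l" and p: "(as, \<sigma>) \<in> signed_permutations n"
    and neg: "\<not> positive_minima as \<sigma>" and x: "x \<in> cell n l (as, \<sigma>)"
  shows "\<not> (\<exists>B. \<forall>y\<in>cell n l (as, \<sigma>). L2_set y {1..n} \<le> B)"
proof
  note p' = signed_permutationsD[OF p]
  assume "\<exists>B. \<forall>y\<in>cell n l (as, \<sigma>). L2_set y {1..n} \<le> B"
  then obtain B where B: "\<And>y. y \<in> cell n l (as, \<sigma>) \<Longrightarrow> L2_set y {1..n} \<le> B" by blast
  have "0 \<le> L2_set x {1..n}" by simp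
  then have B0: "0 \<le> B" using B[OF x] by linarith
  have sum: "(\<Sum>i=1..n. l i * x i) = 1" and sgn: "\<forall>i\<in>{1..n}. sgn (x i) = real_of_int (\<sigma> i)"
    and sorted: "sorted_wrt (dominates x) as"
    using x by (auto simp: cell_def affine_slice_def)
  obtain k where k: "k \<in> {1..length as}" "\<sigma> (Min (set (take k as))) \<noteq> 1"
    using neg unfolding positive_minima_def by blast
  define T where "T = set (take k as)"
  define m where "m = Min T"
  have "T \<noteq> {}" "finite T" using k(1) by (auto simp: T_def)
  then have mT: "m \<in> T" by (simp add: m_def)
  have T: "T \<subseteq> {1..n}" unfolding T_def p'(2)[symmetric] by (rule set_take_subset)
  have mn: "m \<in> {1..n}" using mT T by blast
  have \<sigma>m: "\<sigma> m = - 1" using k(2) p'(5)[OF mn] by (simp add: m_def T_def)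
  define d where "d = (\<lambda>i. if i \<in> T then real_of_int (\<sigma> i) else 0)"
  define D where "D = (\<Sum>i=1..n. l i * d i)"
  have lpos: "l i > 0" if "i \<in> {1..n}" for i using far_decreasing_pos[OF l that] .
  have "D = (\<Sum>i\<in>T. l i * real_of_int (\<sigma> i))"
    unfolding D_def d_def using T by (intro sum.mono_neutral_cong_right) auto
  also have "\<dots> = - l m + (\<Sum>i\<in>T - {m}. l i * real_of_int (\<sigma> i))"
    using mT \<open>finite T\<close> \<sigma>m by (subst sum.remove[of T m]) auto
  also have "(\<Sum>i\<in>T - {m}. l i * real_of_int (\<sigma> i)) \<le> (\<Sum>i\<in>T - {m}. l i)"
  proof (intro sum_mono)
    fix i assume "i \<in> T - {m}"
    then have "i \<in> {1..n}" using T by blast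
    then show "l i * real_of_int (\<sigma> i) \<le> l i" using p'(5)[of i] lpos[of i] by auto
  qed
  also have "(\<Sum>i\<in>T - {m}. l i) \<le> (\<Sum>j=m+1..n. l j)"
  proof (intro sum_mono2)
    have "m \<le> i" if "i \<in> T" for i using that \<open>finite T\<close> by (simp add: m_def)
    show "T - {m} \<subseteq> {m+1..n}"
    proof
      fix i assume i: "i \<in> T - {m}"
      then have "m \<le> i" "i \<noteq> m" using \<open>\<And>i. i \<in> T \<Longrightarrow> m \<le> i\<close> by blast+
      moreover have "i \<le> n" using i T by auto
      ultimately show "i \<in> {m+1..n}" by simp
    qed
    show "0 \<le> l b" if "b \<in> {m+1..n} - (T - {m})" for b
      using that lpos[of b] by simp
  qed simp
  finally have D: "D < 0" using tail_gap_pos[OF l mn] by (simp add: tail_gap_def)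
  define c where "c = \<bar>x m\<bar>"
  have "sgn (x m) = - 1" using sgn mn \<sigma>m by simp
  then have xm: "x m < 0" by (simp add: sgn_1_neg)
  then have c: "c > 0" by (simp add: c_def)
  \<comment> \<open>the weighted sum \<open>s\<close> to aim at: then \<open>c / s = B + 1 + c\<close> exceeds the bound\<close>
  define s where "s = c / (B + 1 + c)"
  have s: "0 < s" "s < 1" using c B0 by (simp_all add: s_def)
  \<comment> \<open>solves \<open>1 + t * D = s\<close>\<close>
  define t where "t = (1 - s) / (- D)"
  have t: "0 \<le> t" using s(2) D by (simp add: t_def divide_nonneg_neg)
  define z where "z = (\<lambda>i. x i + t * d i)"
  have tD: "t * D = s - 1" using D by (simp add: t_def field_simps)
  have "(\<Sum>i=1..n. l i * z i) = (\<Sum>i=1..n. l i * x i) + t * D"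
    by (simp add: z_def D_def sum.distrib sum_distrib_left algebra_simps)
  then have zs: "s = (\<Sum>i=1..n. l i * z i)" using sum tD by simp
  have zsgn: "\<forall>i\<in>{1..n}. sgn (z i) = real_of_int (\<sigma> i)"
  proof
    fix i assume i: "i \<in> {1..n}"
    show "sgn (z i) = real_of_int (\<sigma> i)"
      unfolding z_def
    proof (rule sgn_add_same_sign)
      show "sgn (x i) = real_of_int (\<sigma> i)" using sgn i by blast
      show "real_of_int (\<sigma> i) = 1 \<or> real_of_int (\<sigma> i) = - 1" using p'(5)[OF i] by auto
      show "0 \<le> real_of_int (\<sigma> i) * (t * d i)" using p'(5)[OF i] t by (auto simp: d_def)
    qed
  qed
  have "sorted_wrt (dominates z) as"
    unfolding sorted_wrt_iff_nth_less
  proof (intro allI impI)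
    fix q r assume qr: "q < r" "r < length as"
    let ?i = "as ! q" and ?j = "as ! r"
    have ij: "?i \<in> {1..n}" "?j \<in> {1..n}"
      using qr nth_mem[of q as] nth_mem[of r as] unfolding p'(2) by simp_all
    have "?i \<in> T" if jT: "?j \<in> T"
    proof -
      obtain r' where r': "r' < k" "r' < length as" "as ! r' = ?j"
        using jT unfolding T_def in_set_conv_nth by auto
      then have "r' = r" using p'(1) qr(2) nth_eq_iff_index_eq by blast
      then have "q < k" using r'(1) qr(1) by simp
      then show ?thesis using qr by (auto simp: T_def in_set_conv_nth intro!: exI[of _ q])
    qed
    then have dd: "0 \<le> real_of_int (\<sigma> ?i) * (d ?i + d ?j)"
      using p'(5)[OF ij(1)] p'(5)[OF ij(2)] by (auto simp: d_def)
    have "sgn ((x ?i + x ?j) + t * (d ?i + d ?j)) = real_of_int (\<sigma> ?i)"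
    proof (rule sgn_add_same_sign)
      show "sgn (x ?i + x ?j) = real_of_int (\<sigma> ?i)"
        using sorted_wrt_nth_less[OF sorted qr] sgn ij(1) by (simp add: dominates_def)
      show "real_of_int (\<sigma> ?i) = 1 \<or> real_of_int (\<sigma> ?i) = - 1" using p'(5)[OF ij(1)] by auto
      show "0 \<le> real_of_int (\<sigma> ?i) * (t * (d ?i + d ?j))"
        using mult_nonneg_nonneg[OF t dd] by (simp only: mult.left_commute)
    qed
    moreover have "z ?i + z ?j = (x ?i + x ?j) + t * (d ?i + d ?j)"
      by (simp add: z_def algebra_simps)
    ultimately show "dominates z ?i ?j"
      using zsgn ij(1) by (simp add: dominates_def)
  qed
  from normalized_in_cell[OF p zsgn this zs s(1)]
  have "L2_set (\<lambda>i\<in>{1..n}. z i / s) {1..n} \<le> B" by (rule B)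
  moreover have "- (z m / s) \<le> L2_set (\<lambda>i\<in>{1..n}. z i / s) {1..n}"
  proof -
    have "- (z m / s) \<le> L2_set (\<lambda>i. - (z i / s)) {1..n}"
      using mn by (intro member_le_L2_set) auto
    also have "\<dots> = L2_set (\<lambda>i\<in>{1..n}. z i / s) {1..n}"
      by (simp add: L2_set_def)
    finally show ?thesis .
  qed
  moreover have "c / s \<le> - (z m / s)"
  proof -
    have "c \<le> - z m" using xm t mT \<sigma>m by (simp add: c_def z_def d_def)
    then have "c / s \<le> - z m / s" using s(1) by (intro divide_right_mono) simp_all
    then show ?thesis by simp
  qed
  moreover have "c / s = B + 1 + c" using c B0 by (simp add: s_def)
  ultimately show False using c by linarith
qed

lemma bij_betw_cell:
  assumes l: "far_decreasing n l" and n: "n \<ge> 1"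
  shows "bij_betw (cell n l) (signed_permutations_pos_minima n) (bounded_regions n l)"
proof -
  have pos: "(as, \<sigma>) \<in> signed_permutations n" "decreasing_blocks as \<sigma>" "positive_minima as \<sigma>"
    if "(as, \<sigma>) \<in> signed_permutations_pos_minima n" for as \<sigma>
    using that by (simp_all add: signed_permutations_pos_minima_def)
  have "inj_on (cell n l) (signed_permutations_pos_minima n)"
  proof (rule inj_onI, clarify)
    fix as \<sigma> bs \<tau>
    assume as: "(as, \<sigma>) \<in> signed_permutations_pos_minima n"
      and bs: "(bs, \<tau>) \<in> signed_permutations_pos_minima n"
      and eq: "cell n l (as, \<sigma>) = cell n l (bs, \<tau>)"
    note A = pos[OF as] and B = pos[OF bs]
    note A' = signed_permutationsD[OF A(1)] and B' = signed_permutationsD[OF B(1)]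
    obtain x where x: "x \<in> cell n l (as, \<sigma>)" "x \<in> cell n l (bs, \<tau>)"
      using cell_nonempty[OF l A(1) A(3) n] eq by auto
    have "\<sigma> i = \<tau> i" if i: "i \<in> {1..n}" for i
    proof -
      have "real_of_int (\<sigma> i) = real_of_int (\<tau> i)"
        using x i unfolding cell_def by auto
      then show ?thesis by simp
    qed
    then have "\<sigma> = \<tau>" using A'(4) B'(4) by (intro extensionalityI) auto
    moreover have "sorted_wrt (dominates x) as" "sorted_wrt (dominates x) bs"
      using x by (simp_all add: cell_def)
    moreover have "successively (descends x) as" "successively (descends x) bs"
      using A(2) B(2) decreasing_blocks_iff_descends[OF A(1) x(1)]
        decreasing_blocks_iff_descends[OF B(1) x(2)] by simp_all
    ultimately show "as = bs \<and> \<sigma> = \<tau>"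
      using dominated_list_unique[of x as bs] A'(1,2) B'(1,2) by simp
  qed
  moreover have "cell n l p \<in> bounded_regions n l" if p: "p \<in> signed_permutations_pos_minima n" for p
  proof -
    obtain as \<sigma> where as: "p = (as, \<sigma>)" by (cases p)
    note A = pos[OF p[unfolded as]]
    obtain x where x: "x \<in> cell n l (as, \<sigma>)"
      using cell_nonempty[OF l A(1) A(3) n] by blast
    have "cell n l (as, \<sigma>) \<in> regions n l"
      unfolding regions_eq using cell_eq_sign_class[OF A(1) x] cell_subset_generic[OF A(1)] x by blast
    then show ?thesis
      unfolding as bounded_regions_def using cell_bounded[OF l A(1) A(3)] by blast
  qed
  moreover have "R \<in> cell n l ` signed_permutations_pos_minima n" if R: "R \<in> bounded_regions n l" for R
  proof -
    obtain x where x: "x \<in> generic_points n l" "R = sign_class n l x"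
      using R unfolding bounded_regions_def regions_eq by blast
    have bounded: "\<exists>B. \<forall>y\<in>R. L2_set y {1..n} \<le> B"
      using R unfolding bounded_regions_def by blast
    have gen: "\<forall>i\<in>{1..n}. \<forall>j\<in>{1..n}. x i + x j \<noteq> 0"
      using x(1) unfolding generic_points_def by blast
    then obtain as where as: "distinct as" "set as = {1..n}" "sorted_wrt (dominates x) as"
      "successively (descends x) as"
      using dominated_list_exists[of "{1..n}" x] by auto
    define \<sigma> :: "nat \<Rightarrow> int" where "\<sigma> = (\<lambda>i\<in>{1..n}. if x i > 0 then 1 else - 1)"
    have p: "(as, \<sigma>) \<in> signed_permutations n"
      using as by (auto simp: signed_permutations_def permutations_of_set_def \<sigma>_def)
    have "sgn (x i) = real_of_int (\<sigma> i)" if i: "i \<in> {1..n}" for i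
    proof -
      have "x i + x i \<noteq> 0" using gen i by blast
      then have "x i \<noteq> 0" by simp
      then show ?thesis using i by (simp add: \<sigma>_def sgn_if)
    qed
    then have c: "x \<in> cell n l (as, \<sigma>)"
      using x(1) as(3) unfolding cell_def generic_points_def by simp
    have Rc: "R = cell n l (as, \<sigma>)" using cell_eq_sign_class[OF p c] x(2) by simp
    have "positive_minima as \<sigma>"
      using cell_unbounded[OF l p _ c] bounded unfolding Rc by blast
    moreover have "decreasing_blocks as \<sigma>"
      using decreasing_blocks_iff_descends[OF p c] as(4) by simp
    ultimately have "(as, \<sigma>) \<in> signed_permutations_pos_minima n"
      using p by (simp add: signed_permutations_pos_minima_def)
    then show ?thesis unfolding Rc by (rule imageI)
  qed
  ultimately show ?thesis unfolding bij_betw_def by blast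
qed

section \<open>Equality of the seven cardinalities\<close>

theorem theorem7:
  shows "\<exists>b :: nat \<Rightarrow> nat. b 0 = 1 \<and>
    (\<forall>n\<ge>1.
      (\<forall>l :: nat \<Rightarrow> real. far_decreasing n l \<longrightarrow>
         finite (bounded_regions n l) \<and> card (bounded_regions n l) = b n) \<and>
      finite (ordered_partitions_odd_minima n) \<and> card (ordered_partitions_odd_minima n) = b n \<and>
      finite (signed_permutations_pos_minima n) \<and> card (signed_permutations_pos_minima n) = b n \<and>
      finite (build_tree_codes_plus_after n) \<and> card (build_tree_codes_plus_after n) = b n \<and>
      finite (build_tree_codes_plus_before n) \<and> card (build_tree_codes_plus_before n) = b n \<and>
      finite (klazar_trees n) \<and> card (klazar_trees n) = b n \<and>
      finite (drawings n) \<and> card (drawings n) = b n) \<and>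
    Abs_fps (\<lambda>n. real (b n) / fact n) =
      fps_radical root 2 (fps_exp (1 :: real) / (2 - fps_exp 1))"
proof (rule exI[of _ half_fubini_number], intro conjI allI impI)
  show "half_fubini_number 0 = 1"
    by (simp add: half_fubini_number_def)
  show "Abs_fps (\<lambda>n. real (half_fubini_number n) / fact n) =
      fps_radical root 2 (fps_exp (1 :: real) / (2 - fps_exp 1))"
    unfolding half_fubini_def[symmetric] by (rule fps_ext) (simp add: half_fubini_number_egf)
  fix n :: nat assume n: "1 \<le> n"
  show "finite (bounded_regions n l)" "card (bounded_regions n l) = half_fubini_number n"
    if l: "far_decreasing n l" for l
    using card_signed_permutations_pos_minima[of n]
      bij_betw_finite[OF bij_betw_cell[OF l n]] bij_betw_same_card[OF bij_betw_cell[OF l n]]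
    by simp_all
  show "finite (ordered_partitions_odd_minima n)"
    "card (ordered_partitions_odd_minima n) = half_fubini_number n"
    using card_ordered_partitions_odd_minima by blast+
  show "finite (signed_permutations_pos_minima n)"
    "card (signed_permutations_pos_minima n) = half_fubini_number n"
    using card_signed_permutations_pos_minima by blast+
  show "finite (build_tree_codes_plus_after n)"
    "card (build_tree_codes_plus_after n) = half_fubini_number n"
    using card_codes_after by blast+
  show "finite (build_tree_codes_plus_before n)"
    "card (build_tree_codes_plus_before n) = half_fubini_number n"
    using card_codes_before by blast+
  show "finite (klazar_trees n)" "card (klazar_trees n) = half_fubini_number n"
    using card_klazar_trees by blast+
  show "finite (drawings n)" "card (drawings n) = half_fubini_number n"
    using card_drawings by blast+
qed

end
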